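(* Let $k$ be even. A matching of size $k$ belongs to a connected component of $\mathbf{DCM}_k$ with exactly two vertices if and only if it is a DB-matching.
   Context: Let $k\ge 1$ and let $X_{2k}=\{P_1,\dots,P_{2k}\}$ be $2k$ points in convex position in the plane, labeled in clockwise cyclic order. A matching of $X_{2k}$ means a set of $k$ pairwise non-crossing straight segments (edges) with endpoints in $X_{2k}$ covering every point exactly once; its size is $k$. Two matchings $M,M'$ of $X_{2k}$ are disjoint compatible if they have no common edge and no edge of $M$ crosses an edge of $M'$. $\mathbf{DCM}_k$ is the graph whose vertices are the matchings of $X_{2k}$, two being adjacent iff they are disjoint compatible. Dual tree: place the points on a circle and regard the edges of a matching $M$ as pairwise disjoint chords; they cut the disk into $k+1$ regions. The dual tree $D(M)$ is the (abstract) tree whose vertices are these regions, two regions being adjacent iff their boundaries share a chord of $M$. For even $k=2\ell$, a DB-matching is a matching $M$ whose dual tree is isomorphic (as an abstract graph) to the tree with vertices $B_0,\dots,B_\ell,D_1,\dots,D_\ell$ and edges $B_0D_1$, $D_iD_{i+1}$ ($1\le i\le \ell-1$), and $D_iB_i$ ($1\le i\le \ell$). *)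

theory Defs
  imports Main
begin

text \<open>Points P_1..P_2k in convex (clockwise) position are encoded as 0..2k-1 in cyclic order.
An edge (segment) is a 2-element set of points.\<close>

definition cross0 :: "nat set \<Rightarrow> nat set \<Rightarrow> bool" where
  "cross0 e f \<longleftrightarrow> (\<exists>a b c d. e = {a, b} \<and> f = {c, d} \<and> a < c \<and> c < b \<and> b < d)"

text \<open>Two segments between points in convex position cross iff their endpoints interleave.\<close>
definition crosses :: "nat set \<Rightarrow> nat set \<Rightarrow> bool" where
  "crosses e f \<longleftrightarrow> cross0 e f \<or> cross0 f e"

definition is_matching :: "nat \<Rightarrow> nat set set \<Rightarrow> bool" where
  "is_matching k M \<longleftrightarrow>
     M \<subseteq> {{a, b} | a b. a < b \<and> b < 2 * k} \<and>
     (\<forall>p < 2 * k. \<exists>!e. e \<in> M \<and> p \<in> e) \<and>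
     (\<forall>e \<in> M. \<forall>f \<in> M. \<not> crosses e f)"

definition disjoint_compatible :: "nat set set \<Rightarrow> nat set set \<Rightarrow> bool" where
  "disjoint_compatible M M' \<longleftrightarrow> M \<inter> M' = {} \<and> (\<forall>e \<in> M. \<forall>f \<in> M'. \<not> crosses e f)"

definition DCM_adj :: "nat \<Rightarrow> nat set set \<Rightarrow> nat set set \<Rightarrow> bool" where
  "DCM_adj k M M' \<longleftrightarrow> is_matching k M \<and> is_matching k M' \<and> disjoint_compatible M M'"

definition DCM_component :: "nat \<Rightarrow> nat set set \<Rightarrow> nat set set set" where
  "DCM_component k M = {M'. (DCM_adj k)\<^sup>*\<^sup>* M M'}"

text \<open>Dual tree. The boundary circle is cut by the points into 2k arcs; arc i runs from
point i to point i+1 (mod 2k). Chord e = {a,b}, a<b, has arc i on its "inner" side iff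
a \<le> i < b. Every region of the disk contains at least one arc, and two arcs lie in the same
region iff no chord separates them; so regions = classes of arcs. Two regions share a chord
iff some (equivalently any) arcs of them are separated by exactly one chord.\<close>

definition chord_side :: "nat set \<Rightarrow> nat \<Rightarrow> bool" where
  "chord_side e i \<longleftrightarrow> Min e \<le> i \<and> i < Max e"

definition separates :: "nat set \<Rightarrow> nat \<Rightarrow> nat \<Rightarrow> bool" where
  "separates e i j \<longleftrightarrow> chord_side e i \<noteq> chord_side e j"

definition regions :: "nat \<Rightarrow> nat set set \<Rightarrow> nat set set" where
  "regions k M = {{j \<in> {0..<2 * k}. \<forall>e \<in> M. \<not> separates e i j} | i. i < 2 * k}"

definition dual_adj :: "nat set set \<Rightarrow> nat set \<Rightarrow> nat set \<Rightarrow> bool" where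
  "dual_adj M R S \<longleftrightarrow> (\<exists>i \<in> R. \<exists>j \<in> S. card {e \<in> M. separates e i j} = 1)"

definition graph_iso :: "'a set \<Rightarrow> ('a \<Rightarrow> 'a \<Rightarrow> bool) \<Rightarrow> 'b set \<Rightarrow> ('b \<Rightarrow> 'b \<Rightarrow> bool) \<Rightarrow> bool" where
  "graph_iso V1 E1 V2 E2 \<longleftrightarrow>
     (\<exists>f. bij_betw f V1 V2 \<and> (\<forall>x \<in> V1. \<forall>y \<in> V1. E1 x y \<longleftrightarrow> E2 (f x) (f y)))"

text \<open>The tree with vertices B_0..B_l (Inl i) and D_1..D_l (Inr i), edges B_0 D_1,
D_i D_(i+1), D_i B_i.\<close>
definition db_verts :: "nat \<Rightarrow> (nat + nat) set" where
  "db_verts l = Inl ` {0..l} \<union> Inr ` {1..l}"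

definition db_edge :: "nat \<Rightarrow> nat + nat \<Rightarrow> nat + nat \<Rightarrow> bool" where
  "db_edge l x y \<longleftrightarrow>
     (x = Inl 0 \<and> y = Inr 1) \<or>
     (\<exists>i. 1 \<le> i \<and> i < l \<and> x = Inr i \<and> y = Inr (i + 1)) \<or>
     (\<exists>i. 1 \<le> i \<and> i \<le> l \<and> x = Inr i \<and> y = Inl i)"

definition db_adj :: "nat \<Rightarrow> nat + nat \<Rightarrow> nat + nat \<Rightarrow> bool" where
  "db_adj l x y \<longleftrightarrow> db_edge l x y \<or> db_edge l y x"

definition is_DB_matching :: "nat \<Rightarrow> nat set set \<Rightarrow> bool" where
  "is_DB_matching k M \<longleftrightarrow> is_matching k M \<and> even k \<and>
     graph_iso (regions k M) (dual_adj M) (db_verts (k div 2)) (db_adj (k div 2))"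

end

(* If M and N are disjoint compatible and each is the only neighbour of the other, then the cycles
   of their union are convex polygons with sides alternately in M and N. Exchanging sides shows that
   a polygon with at least eight sides, two polygons facing each other with sides of the same
   matching, a hexagon facing another polygon, or a quadrilateral with two facing sides of one
   matching would each give a second neighbour to M or to N. So, for even k, the polygons are
   quadrilaterals forming a chain (a "ladder"), in which consecutive quadrilaterals face each other
   with a side in M and a side in N. Conversely an innermost quadrilateral at the end of a chain
   forces the edges of any neighbour, and the dual tree of M for a chain is the DB-tree:
   B_l and D_l come from the last quadrilateral. *)
theory Submission
  imports Defs
begin

section \<open>Cyclic order, crossings and non-crossing perfect matchings\<close>

text \<open>Both directions remove four consecutive points at a time, so matchings live on arbitrary
  finite point sets and positions are compared cyclically. The obstacle is that a change at one
  polygon has to become a matching of all points. This is the role of \<open>splice\<close>: a block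
  lying in a gap is opened at one of its edges, an outer edge visible from the block is opened as
  well, and two new edges join inside and outside. These lie in neither part of the other matching,
  and an opened edge is no longer shared with it. One common edge may therefore be created
  beforehand and spliced away. That is how a hexagon, or a quadrilateral occupied at both
  \<open>N\<close>-sides, is excluded: exchange inside first, then splice the side that became
  common. The converse meets the same mechanism from the other side. Uniqueness of neighbours is not
  inductive by itself, because a neighbour could make a detour from the old end of the chain around
  the new quadrilateral; hence the additional invariant \<open>no_single\<close>. Evenness of k is
  essential: the two alternating matchings of a single hexagon are also unique neighbours of each
  other.\<close>

definition cyc :: "nat \<Rightarrow> nat \<Rightarrow> nat \<Rightarrow> bool" where
  "cyc a b c \<longleftrightarrow> a < b \<and> b < c \<or> b < c \<and> c < a \<or> c < a \<and> a < b"

lemma cyc_rot: "cyc a b c \<Longrightarrow> cyc b c a" by (auto simp: cyc_def)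
lemma cyc_trans: "cyc a b c \<Longrightarrow> cyc a c d \<Longrightarrow> cyc a b d" unfolding cyc_def by linarith
lemma cyc_total: "a \<noteq> b \<Longrightarrow> b \<noteq> c \<Longrightarrow> a \<noteq> c \<Longrightarrow> cyc a b c \<or> cyc a c b"
  unfolding cyc_def by linarith
lemma cyc_asym: "cyc a b c \<Longrightarrow> \<not> cyc a c b" unfolding cyc_def by linarith
lemma cyc_neq: "cyc a b c \<Longrightarrow> a \<noteq> b \<and> b \<noteq> c \<and> a \<noteq> c" unfolding cyc_def by linarith

text \<open>The axioms of a cyclic order. Most facts on positions of points below follow from these
  alone, so they do not depend on where the labelling cuts the circle.\<close>

lemmas cyc_ax = cyc_rot cyc_trans cyc_total cyc_asym cyc_neq

lemma crosses_iff:
  "crosses {a, b} {c, d} \<longleftrightarrow> cyc a c b \<and> cyc b d a \<or> cyc a d b \<and> cyc b c a"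
proof -
  have 1: "cross0 {a, b} {c, d} \<longleftrightarrow> a < c \<and> c < b \<and> b < d \<or> b < c \<and> c < a \<and> a < d
     \<or> a < d \<and> d < b \<and> b < c \<or> b < d \<and> d < a \<and> a < c" for a b c d
    unfolding cross0_def doubleton_eq_iff by auto
  show ?thesis unfolding crosses_def 1 cyc_def by (smt (z3) nat_neq_iff less_trans less_asym)
qed

lemma crosses_sym: "crosses e f \<longleftrightarrow> crosses f e"
  by (auto simp: crosses_def)

definition compat :: "nat set set \<Rightarrow> nat set set \<Rightarrow> bool" where
  "compat X Y \<longleftrightarrow> (\<forall>e\<in>X. \<forall>f\<in>Y. \<not> crosses e f)"

lemma compat_sym: "compat X Y \<longleftrightarrow> compat Y X"
  unfolding compat_def using crosses_sym by blast

text \<open>The vertex set is arbitrary because the inductions remove and insert blocks of points.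
  Uniqueness is expressed as single-valuedness of the partner, the form in which it gets applied;
  \<open>is_matching_pm\<close> makes the link to \<open>is_matching\<close>.\<close>

definition pm :: "nat set \<Rightarrow> nat set set \<Rightarrow> bool" where
  "pm V M \<longleftrightarrow> (\<forall>e\<in>M. \<exists>a\<in>V. \<exists>b\<in>V. a \<noteq> b \<and> e = {a, b}) \<and> (\<forall>p\<in>V. \<exists>q. {p, q} \<in> M) \<and>
     (\<forall>p q r. {p, q} \<in> M \<longrightarrow> {p, r} \<in> M \<longrightarrow> q = r) \<and> compat M M"

lemma pm_edge: "pm V M \<Longrightarrow> e \<in> M \<Longrightarrow> \<exists>a\<in>V. \<exists>b\<in>V. a \<noteq> b \<and> e = {a, b}"
  by (auto simp: pm_def)

lemma pm_edgeD: assumes "pm V M" "{a, b} \<in> M" shows "a \<in> V \<and> b \<in> V \<and> a \<noteq> b"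
  using pm_edge[OF assms] by (auto simp: doubleton_eq_iff)

lemma pm_ex: assumes "pm V M" "p \<in> V" obtains q where "{p, q} \<in> M" "q \<in> V" "q \<noteq> p"
proof -
  obtain q where q: "{p, q} \<in> M" using assms unfolding pm_def by blast
  show thesis using that[OF q] pm_edgeD[OF assms(1) q] by blast
qed

lemma pm_uniq: "pm V M \<Longrightarrow> {p, q} \<in> M \<Longrightarrow> {p, r} \<in> M \<Longrightarrow> q = r"
  by (auto simp: pm_def)

lemma is_matching_pm: "is_matching k M \<longleftrightarrow> pm {0..<2 * k} M"
proof
  assume m: "is_matching k M"
  then have e: "\<exists>a b. e = {a, b} \<and> a < b \<and> b < 2 * k" if "e \<in> M" for e
    using that unfolding is_matching_def by blast
  have u: "\<exists>!e. e \<in> M \<and> p \<in> e" if "p < 2 * k" for p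
    using m that unfolding is_matching_def by blast
  have "\<exists>a\<in>{0..<2 * k}. \<exists>b\<in>{0..<2 * k}. a \<noteq> b \<and> x = {a, b}" if "x \<in> M" for x
    using e[OF that] by (metis atLeastLessThan_iff le0 less_trans less_irrefl)
  moreover have "\<exists>q. {p, q} \<in> M" if "p \<in> {0..<2 * k}" for p
  proof -
    have "p < 2 * k" using that by simp
    from u[OF this] obtain x where "x \<in> M" "p \<in> x" by blast
    then show ?thesis using e[of x] by (auto simp: insert_commute)
  qed
  moreover have "q = r" if "{p, q} \<in> M" "{p, r} \<in> M" for p q r
  proof -
    have "p < 2 * k" using e[OF that(1)] by (auto simp: doubleton_eq_iff)
    from u[OF this] that have "{p, q} = {p, r}" by blast
    then show ?thesis by (auto simp: doubleton_eq_iff)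
  qed
  ultimately show "pm {0..<2 * k} M"
    using m unfolding pm_def is_matching_def compat_def by blast
next
  assume m: "pm {0..<2 * k} M"
  have "\<exists>a b. e = {a, b} \<and> a < b \<and> b < 2 * k" if "e \<in> M" for e
    using pm_edge[OF m that] by (metis atLeastLessThan_iff insert_commute nat_neq_iff)
  moreover have "\<exists>!e. e \<in> M \<and> p \<in> e" if "p < 2 * k" for p
  proof -
    from that have "p \<in> {0..<2 * k}" by simp
    from pm_ex[OF m this] obtain q where q: "{p, q} \<in> M" .
    have "x = {p, q}" if x: "x \<in> M" "p \<in> x" for x
    proof -
      obtain r where "x = {p, r}" using pm_edge[OF m x(1)] x(2) by auto
      then show ?thesis using pm_uniq[OF m q] x(1) by auto
    qed
    then show ?thesis using q by blast
  qed
  ultimately show "is_matching k M"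
    using m unfolding pm_def is_matching_def compat_def by blast
qed

section \<open>Exchanging opposite sides of a quadrilateral\<close>

lemma compat_replace:
  assumes "compat X X" "\<And>e. e \<in> X \<Longrightarrow> \<not> crosses P e \<and> \<not> crosses Q e"
    "\<not> crosses P P" "\<not> crosses Q Q" "\<not> crosses P Q"
  shows "compat (X - D \<union> {P, Q}) (X - D \<union> {P, Q})"
  using assms crosses_sym unfolding compat_def by blast

text \<open>Two opposite sides of the convex quadrilateral a, b, c, d make way for the other two, so
  the covered points stay the same. Every rival matching below is built from exchanges of this kind;
  what has to be supplied each time is that the new sides cross nothing.\<close>

lemma switch:
  assumes X: "pm V X" and ad: "{a, d} \<in> X" and bc: "{b, c} \<in> X"
    and abc: "cyc a b c" and acd: "cyc a c d"
    and nc: "\<And>e. e \<in> X \<Longrightarrow> \<not> crosses {a, b} e \<and> \<not> crosses {c, d} e"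
  shows "pm V (X - {{a, d}, {b, c}} \<union> {{a, b}, {c, d}})" (is "pm V ?Y")
proof -
  have d: "a \<noteq> b" "a \<noteq> c" "a \<noteq> d" "b \<noteq> c" "b \<noteq> d" "c \<noteq> d"
    using abc acd by (smt (verit) cyc_ax)+
  have V: "a \<in> V" "b \<in> V" "c \<in> V" "d \<in> V" using pm_edgeD[OF X] ad bc by auto
  have e: "\<exists>a\<in>V. \<exists>b\<in>V. a \<noteq> b \<and> e = {a, b}" if "e \<in> ?Y" for e
    using that pm_edge[OF X] V d by auto
  have ex: "\<exists>q. {p, q} \<in> ?Y" if p: "p \<in> V" for p
  proof (cases "p \<in> {a, b, c, d}")
    case True
    then show ?thesis by (elim insertE emptyE) (blast, metis insert_commute insertCI UnCI, blast, metis insert_commute insertCI UnCI)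
  next
    case False
    obtain q where "{p, q} \<in> X" using pm_ex[OF X p] by auto
    then show ?thesis using False by (auto simp: doubleton_eq_iff)
  qed
  \<comment> \<open>The partners of the four corners are known, so an edge that survives the
    exchange avoids all of them.\<close>
  have old: "x \<notin> {a, b, c, d}" if "{x, y} \<in> X" "{x, y} \<noteq> {a, d}" "{x, y} \<noteq> {b, c}" for x y
  proof -
    have "{d, a} \<in> X" "{c, b} \<in> X" using ad bc by (simp_all add: insert_commute)
    then have "x = a \<Longrightarrow> y = d" "x = d \<Longrightarrow> y = a" "x = b \<Longrightarrow> y = c" "x = c \<Longrightarrow> y = b"
      using that(1) ad bc pm_uniq[OF X] by blast+
    then show ?thesis using that(2,3) by (metis insertE insert_commute singletonD)
  qed
  have u: "q = r" if "{p, q} \<in> ?Y" "{p, r} \<in> ?Y" for p q r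
  proof -
    have new: "p = a \<and> x = b \<or> p = b \<and> x = a \<or> p = c \<and> x = d \<or> p = d \<and> x = c \<or>
        p \<noteq> a \<and> p \<noteq> b \<and> p \<noteq> c \<and> p \<noteq> d \<and> {p, x} \<in> X" if "{p, x} \<in> ?Y" for x
    proof (cases "{p, x} \<in> {{a, b}, {c, d}}")
      case True then show ?thesis by (auto simp: doubleton_eq_iff)
    next
      case False
      then have h: "{p, x} \<in> X" "{p, x} \<noteq> {a, d}" "{p, x} \<noteq> {b, c}" using that by blast+
      show ?thesis using old[OF h] h(1) by simp
    qed
    show ?thesis using new[OF that(1)] new[OF that(2)] d pm_uniq[OF X, of p q r] by argo
  qed
  have n: "\<not> crosses {a, b} {a, b}" "\<not> crosses {c, d} {c, d}" "\<not> crosses {a, b} {c, d}"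
    using abc acd unfolding crosses_iff by (smt (verit) cyc_ax)+
  have "compat X X" using X unfolding pm_def by blast
  from compat_replace[OF this] have "compat ?Y ?Y" using nc n by presburger
  then show ?thesis unfolding pm_def using e ex u by (intro conjI ballI allI impI) assumption+
qed

section \<open>Splicing a block into a gap\<close>

lemma pm_Un:
  assumes X: "pm V X" and Y: "pm I Y" and dj: "V \<inter> I = {}" and c: "compat X Y"
  shows "pm (V \<union> I) (X \<union> Y)"
proof -
  have "\<exists>a\<in>V \<union> I. \<exists>b\<in>V \<union> I. a \<noteq> b \<and> e = {a, b}" if "e \<in> X \<union> Y" for e
    using that pm_edge[OF X, of e] pm_edge[OF Y, of e] by blast
  moreover have "\<exists>q. {p, q} \<in> X \<union> Y" if "p \<in> V \<union> I" for p
    using that pm_ex[OF X, of p] pm_ex[OF Y, of p] by (metis UnE UnI1 UnI2)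
  moreover have "q = r" if "{p, q} \<in> X \<union> Y" "{p, r} \<in> X \<union> Y" for p q r
    using that pm_edgeD[OF X, of p q] pm_edgeD[OF X, of p r] pm_edgeD[OF Y, of p q] pm_edgeD[OF Y, of p r]
      pm_uniq[OF X, of p q r] pm_uniq[OF Y, of p q r] dj by (metis UnE disjoint_iff)
  moreover have "compat (X \<union> Y) (X \<union> Y)"
    using X Y c compat_sym[of X Y] unfolding pm_def compat_def by (metis UnE)
  ultimately show ?thesis unfolding pm_def by (intro conjI ballI allI impI) assumption+
qed

lemma pm_restrict:
  assumes X: "pm W X" and VW: "V \<subseteq> W" and cl: "\<And>p q. {p, q} \<in> X \<Longrightarrow> p \<in> V \<Longrightarrow> q \<in> V"
  shows "pm V {e \<in> X. e \<subseteq> V}"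
proof -
  have "\<exists>a\<in>V. \<exists>b\<in>V. a \<noteq> b \<and> e = {a, b}" if "e \<in> {e \<in> X. e \<subseteq> V}" for e
    using that pm_edge[OF X, of e] by auto
  moreover have "\<exists>q. {p, q} \<in> {e \<in> X. e \<subseteq> V}" if p: "p \<in> V" for p
  proof -
    obtain q where q: "{p, q} \<in> X" using pm_ex[OF X] p VW by blast
    show ?thesis using q cl[OF q p] p by blast
  qed
  moreover have "q = r" if "{p, q} \<in> {e \<in> X. e \<subseteq> V}" "{p, r} \<in> {e \<in> X. e \<subseteq> V}" for p q r
    using that pm_uniq[OF X, of p q r] by simp
  moreover have "compat {e \<in> X. e \<subseteq> V} {e \<in> X. e \<subseteq> V}"
    using X unfolding pm_def compat_def by simp
  ultimately show ?thesis unfolding pm_def by (intro conjI ballI allI impI) assumption+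
qed

lemma pm_quad:
  assumes "cyc a b c" "cyc a c d"
  shows "pm {a, b, c, d} {{a, b}, {c, d}}"
proof -
  have d: "a \<noteq> b" "a \<noteq> c" "a \<noteq> d" "b \<noteq> c" "b \<noteq> d" "c \<noteq> d"
    using assms by (smt (verit) cyc_ax)+
  have "\<exists>q. {p, q} \<in> {{a, b}, {c, d}}" if "p \<in> {a, b, c, d}" for p
    using that by (elim insertE emptyE) (blast, metis insert_commute insertCI, blast, metis insert_commute insertCI)
  moreover have "q = r" if "{p, q} \<in> {{a, b}, {c, d}}" "{p, r} \<in> {{a, b}, {c, d}}" for p q r
    using that d unfolding insert_iff doubleton_eq_iff empty_iff by metis
  moreover have "compat {{a, b}, {c, d}} {{a, b}, {c, d}}"
  proof -
    have "\<not> crosses {a, b} {a, b}" "\<not> crosses {c, d} {c, d}" "\<not> crosses {a, b} {c, d}"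
      using assms unfolding crosses_iff by (smt (verit) cyc_ax)+
    then show ?thesis unfolding compat_def using crosses_sym by (metis insert_iff empty_iff)
  qed
  ultimately show ?thesis using d unfolding pm_def by simp
qed

text \<open>\<open>I\<close> fills, from \<open>b\<close> to \<open>c\<close>, a part of a gap between two cyclically consecutive points of \<open>V\<close>.\<close>

definition block :: "nat set \<Rightarrow> nat set \<Rightarrow> nat \<Rightarrow> nat \<Rightarrow> bool" where
  "block V I b c \<longleftrightarrow> V \<inter> I = {} \<and> b \<in> I \<and> c \<in> I \<and>
     (\<forall>x\<in>V. \<forall>y\<in>V. \<forall>i\<in>I. \<forall>j\<in>I. cyc x i y \<longrightarrow> cyc x j y) \<and>
     (\<forall>x\<in>V. \<forall>i\<in>I. (i \<noteq> b \<longrightarrow> cyc x b i) \<and> (i \<noteq> c \<longrightarrow> cyc x i c))"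

lemma block_clone: "block V I b c \<Longrightarrow> x \<in> V \<Longrightarrow> y \<in> V \<Longrightarrow> i \<in> I \<Longrightarrow> j \<in> I \<Longrightarrow> cyc x i y \<Longrightarrow> cyc x j y"
  unfolding block_def by blast

lemma block_first: "block V I b c \<Longrightarrow> x \<in> V \<Longrightarrow> i \<in> I \<Longrightarrow> i \<noteq> b \<Longrightarrow> cyc x b i"
  unfolding block_def by blast

lemma block_last: "block V I b c \<Longrightarrow> x \<in> V \<Longrightarrow> i \<in> I \<Longrightarrow> i \<noteq> c \<Longrightarrow> cyc x i c"
  unfolding block_def by blast

text \<open>Seen from \<open>V\<close> the points of a block are interchangeable: a chord with ends
  in \<open>V\<close> has the whole block on one side, so it cannot separate the ends of a chord
  inside the block.\<close>

lemma block_compat: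
  assumes B: "block V I b c" and X: "pm V X" and Y: "pm I Y"
  shows "compat X Y"
  unfolding compat_def
proof (intro ballI)
  fix e f assume e: "e \<in> X" and f: "f \<in> Y"
  obtain x y where x: "x \<in> V" "y \<in> V" "e = {x, y}" using pm_edge[OF X e] by blast
  obtain i j where i: "i \<in> I" "j \<in> I" "f = {i, j}" using pm_edge[OF Y f] by blast
  have "cyc x i y \<longleftrightarrow> cyc x j y" "cyc y i x \<longleftrightarrow> cyc y j x"
    using block_clone[OF B x(1,2)] block_clone[OF B x(2,1)] i by blast+
  then show "\<not> crosses e f" unfolding x(3) i(3) crosses_iff by (metis cyc_rot cyc_asym)
qed

text \<open>The exchange acts on s t and b c within the union of \<open>X\<close> and
  \<open>Y\<close>. Visibility is assumed for b and passes to c, as both are equivalent with respect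
  to \<open>V\<close>; edges inside the block do no harm because b and c are its extremes. The new
  edges join \<open>V\<close> to the block and so lie in neither \<open>N\<close> nor
  \<open>N1\<close>. This gives the last conclusion: common edges are old ones, and the two opened
  edges are no longer among them.\<close>

lemma splice_cyc:
  assumes B: "block V I b c" and X: "pm V X" and Y: "pm I Y" and bc: "{b, c} \<in> Y"
    and N: "pm V N" and N1: "pm I N1" and XN: "compat X N" and YN: "compat Y N1"
    and st: "{s, t} \<in> X" and vis: "\<And>e. e \<in> X \<union> N \<Longrightarrow> \<not> crosses {s, b} e \<and> \<not> crosses {b, t} e"
    and sbt: "cyc s b t"
  obtains X' where "pm (V \<union> I) X'" "compat X' (N \<union> N1)" "{s, b} \<in> X'" "X - {{s, t}} \<subseteq> X'"
    "X' \<inter> (N \<union> N1) \<subseteq> (X \<inter> N - {{s, t}}) \<union> (Y \<inter> N1 - {{b, c}})"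
proof -
  have V: "s \<in> V" "t \<in> V" using pm_edgeD[OF X st] by auto
  have I: "b \<in> I" "c \<in> I" "b \<noteq> c" using pm_edgeD[OF Y bc] by auto
  have dj: "V \<inter> I = {}" using B unfolding block_def by blast
  have nc: "\<not> crosses {s, b} e \<and> \<not> crosses {c, t} e" if "e \<in> (X \<union> N) \<union> (Y \<union> N1)" for e
    using that
  proof
    assume e: "e \<in> X \<union> N"
    then obtain x y where x: "x \<in> V" "y \<in> V" "e = {x, y}" using pm_edge[OF X] pm_edge[OF N] by blast
    have "cyc t b z \<longleftrightarrow> cyc t c z" "cyc z b t \<longleftrightarrow> cyc z c t" if "z \<in> V" for z
      using block_clone[OF B] V I that by blast+
    then have "crosses {b, t} e \<longleftrightarrow> crosses {c, t} e"
      unfolding x(3) crosses_iff using x(1,2) V(2) cyc_rot by metis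
    then show ?thesis using vis[OF e] by blast
  next
    assume e: "e \<in> Y \<union> N1"
    then obtain i j where i: "i \<in> I" "j \<in> I" "e = {i, j}" using pm_edge[OF Y] pm_edge[OF N1] by blast
    have "cyc s b z \<or> z = b" "cyc t z c \<or> z = c" if "z \<in> I" for z
      using block_first[OF B V(1) that] block_last[OF B V(2) that] by blast+
    then show ?thesis unfolding i(3) crosses_iff using i(1,2) by (metis cyc_rot cyc_asym cyc_neq)
  qed
  let ?X = "X \<union> Y - {{s, t}, {b, c}} \<union> {{s, b}, {c, t}}"
  have 1: "pm (V \<union> I) (X \<union> Y)" by (rule pm_Un[OF X Y dj block_compat[OF B X Y]])
  have sbc: "cyc s b c" using block_first[OF B V(1) I(2)] I(3) by blast
  have sct: "cyc s c t" using block_clone[OF B V I(1,2) sbt] .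
  have pm': "pm (V \<union> I) ?X"
    by (rule switch[OF 1 _ _ sbc sct]) (use st bc nc in auto)
  have "compat (X \<union> Y) (N \<union> N1)"
    using XN YN block_compat[OF B X N1] block_compat[OF B N Y] crosses_sym
    unfolding compat_def by (metis UnE)
  then have c': "compat ?X (N \<union> N1)"
    using nc unfolding compat_def by (metis Diff_iff UnE UnI1 UnI2 empty_iff insert_iff)
  have "{s, b} \<notin> N \<union> N1" "{c, t} \<notin> N \<union> N1"
    using pm_edgeD[OF N, of s b] pm_edgeD[OF N1, of s b] pm_edgeD[OF N, of c t] pm_edgeD[OF N1, of c t]
      V I dj by blast+
  moreover have "e \<notin> N1" if "e \<in> X" for e
    using pm_edge[OF X that] pm_edgeD[OF N1] dj by blast
  moreover have "e \<notin> N" if "e \<in> Y" for e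
    using pm_edge[OF Y that] pm_edgeD[OF N] dj by blast
  ultimately have "?X \<inter> (N \<union> N1) \<subseteq> (X \<inter> N - {{s, t}}) \<union> (Y \<inter> N1 - {{b, c}})" by auto
  moreover have "{b, c} \<notin> X" using pm_edgeD[OF X] I(1) dj by blast
  then have "X - {{s, t}} \<subseteq> ?X" by auto
  ultimately show thesis using that[OF pm' c'] by blast
qed

text \<open>Frees the previous lemma from the orientation of s t. The end that becomes the partner
  of b is kept only as some x outside the block, which is enough to distinguish the result from a
  matching that respects the block.\<close>

lemma splice:
  assumes B: "block V I b c" and X: "pm V X" and Y: "pm I Y" and bc: "{b, c} \<in> Y"
    and N: "pm V N" and N1: "pm I N1" and XN: "compat X N" and YN: "compat Y N1"
    and st: "{s, t} \<in> X" and vis: "\<And>e. e \<in> X \<union> N \<Longrightarrow> \<not> crosses {s, b} e \<and> \<not> crosses {b, t} e"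
  obtains X' x where "pm (V \<union> I) X'" "compat X' (N \<union> N1)" "x \<in> V" "{x, b} \<in> X'" "X - {{s, t}} \<subseteq> X'"
    "X' \<inter> (N \<union> N1) \<subseteq> (X \<inter> N - {{s, t}}) \<union> (Y \<inter> N1 - {{b, c}})"
proof -
  have V: "s \<in> V" "t \<in> V" "s \<noteq> t" using pm_edgeD[OF X st] by auto
  have "b \<notin> V" using B unfolding block_def by blast
  then have "cyc s b t \<or> cyc t b s" using V cyc_total cyc_rot by metis
  then show thesis
  proof
    assume "cyc s b t"
    from splice_cyc[OF B X Y bc N N1 XN YN st vis this] show thesis using that V by metis
  next
    assume c: "cyc t b s"
    have st': "{t, s} \<in> X" using st by (simp add: insert_commute)
    have vis': "\<not> crosses {t, b} e \<and> \<not> crosses {b, s} e" if "e \<in> X \<union> N" for e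
      using vis[OF that] by (simp add: insert_commute)
    show thesis
    proof (rule splice_cyc[OF B X Y bc N N1 XN YN st' vis' c])
      fix X' assume "pm (V \<union> I) X'" "compat X' (N \<union> N1)" "{t, b} \<in> X'" "X - {{t, s}} \<subseteq> X'"
        "X' \<inter> (N \<union> N1) \<subseteq> X \<inter> N - {{t, s}} \<union> (Y \<inter> N1 - {{b, c}})"
      then show thesis using that V(2) by (simp only: insert_commute[of t s])
    qed
  qed
qed

section \<open>Ladders\<close>

text \<open>The tuple records the first and \<open>p1 p2 p3 p4\<close> the last quadrilateral of the chain. A new last
quadrilateral is attached along the \<open>N\<close>-side \<open>p1 p2\<close>; by \<open>swap_end\<close> the \<open>N\<close>-side \<open>p3 p4\<close> serves as well.
The first quadrilateral is recorded only so that ladders can be reversed.\<close>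

inductive ladder :: "nat set \<Rightarrow> nat set set \<Rightarrow> nat set set \<Rightarrow> nat \<times> nat \<times> nat \<times> nat \<Rightarrow>
    nat \<Rightarrow> nat \<Rightarrow> nat \<Rightarrow> nat \<Rightarrow> bool" where
  base: "cyc a b c \<Longrightarrow> cyc a c d \<Longrightarrow>
    ladder {a, b, c, d} {{b, c}, {d, a}} {{a, b}, {c, d}} (a, b, c, d) a b c d"
| step: "ladder V M N f p1 p2 p3 p4 \<Longrightarrow> V \<inter> {a, b, c, d} = {} \<Longrightarrow>
    cyc p1 a b \<Longrightarrow> cyc p1 b c \<Longrightarrow> cyc p1 c d \<Longrightarrow> cyc p1 d p2 \<Longrightarrow>
    ladder (V \<union> {a, b, c, d}) (M \<union> {{b, c}, {d, a}}) (N \<union> {{a, b}, {c, d}}) f a b c d"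
| swap_end: "ladder V M N f p1 p2 p3 p4 \<Longrightarrow> ladder V M N f p3 p4 p1 p2"
| swap_start: "ladder V M N (f1, f2, f3, f4) p1 p2 p3 p4 \<Longrightarrow> ladder V M N (f3, f4, f1, f2) p1 p2 p3 p4"

lemma gap_block:
  assumes p: "p1 \<in> V" "p2 \<in> V" and gap: "\<And>x. x \<in> V \<Longrightarrow> \<not> cyc p1 x p2"
    and q: "cyc p1 a b" "cyc p1 b c" "cyc p1 c d" "cyc p1 d p2"
  shows "block V {a, b, c, d} a d"
proof -
  have in_gap: "cyc p1 i p2" if "i \<in> {a, b, c, d}" for i
    using that q by (elim insertE emptyE) (smt (verit) cyc_ax)+
  then have dj: "V \<inter> {a, b, c, d} = {}" using gap by auto
  have side: "cyc x j y" if "x \<in> V" "y \<in> V" "i \<in> {a, b, c, d}" "j \<in> {a, b, c, d}" "cyc x i y" for x y i j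
  proof -
    have "x \<noteq> j" "y \<noteq> j" using dj that by blast+
    then show ?thesis using in_gap[OF that(3)] in_gap[OF that(4)] gap[OF that(1)] gap[OF that(2)] that(5)
      by (smt (verit) cyc_ax)
  qed
  have abcd: "cyc x a b" "cyc x b c" "cyc x c d" "cyc x a c" "cyc x a d" "cyc x b d" if "x \<in> V" for x
  proof -
    have "x \<noteq> a" "x \<noteq> b" "x \<noteq> c" "x \<noteq> d" using dj that by blast+
    then show "cyc x a b" "cyc x b c" "cyc x c d" "cyc x a c" "cyc x a d" "cyc x b d"
      using gap[OF that] q by (smt (verit) cyc_ax)+
  qed
  have ends: "(i \<noteq> a \<longrightarrow> cyc x a i) \<and> (i \<noteq> d \<longrightarrow> cyc x i d)" if "x \<in> V" "i \<in> {a, b, c, d}" for x i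
    using that(2) abcd[OF that(1)] by (elim insertE emptyE) simp_all
  show ?thesis unfolding block_def
    by (intro conjI ballI dj) (simp, simp, intro impI, erule side, assumption+, (erule (1) ends[THEN conjunct1] ends[THEN conjunct2])+)
qed

text \<open>The last conjunct says that the two \<open>N\<close>-sides of the last quadrilateral
  span empty gaps; these are the places where the chain can grow. The rest of the ladder, if any,
  lies behind one of the \<open>M\<close>-sides.\<close>

definition ladder_inv :: "nat set \<Rightarrow> nat set set \<Rightarrow> nat set set \<Rightarrow> nat \<Rightarrow> nat \<Rightarrow> nat \<Rightarrow> nat \<Rightarrow> bool" where
  "ladder_inv V M N p1 p2 p3 p4 \<longleftrightarrow> finite V \<and> pm V M \<and> pm V N \<and> compat M N \<and> M \<inter> N = {} \<and>
     cyc p1 p2 p3 \<and> cyc p1 p3 p4 \<and> {p2, p3} \<in> M \<and> {p4, p1} \<in> M \<and> {p1, p2} \<in> N \<and> {p3, p4} \<in> N \<and>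
     (\<forall>x\<in>V. \<not> cyc p1 x p2 \<and> \<not> cyc p3 x p4)"

lemma ladder_inv_swap: "ladder_inv V M N p1 p2 p3 p4 \<Longrightarrow> ladder_inv V M N p3 p4 p1 p2"
  unfolding ladder_inv_def by (smt (verit) cyc_ax)

lemma ladder_inv_mem: "ladder_inv V M N p1 p2 p3 p4 \<Longrightarrow> p1 \<in> V \<and> p2 \<in> V \<and> p3 \<in> V \<and> p4 \<in> V"
  unfolding ladder_inv_def using pm_edgeD by meson

lemma ladder_inv_block:
  assumes "ladder_inv V M N p1 p2 p3 p4" "cyc p1 a b" "cyc p1 b c" "cyc p1 c d" "cyc p1 d p2"
  shows "block V {a, b, c, d} a d"
  by (rule gap_block[OF _ _ _ assms(2-5)]) (use assms(1) ladder_inv_mem[OF assms(1)] in \<open>auto simp: ladder_inv_def\<close>)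

lemma quad_ladder_inv:
  assumes q: "cyc a b c" "cyc a c d"
  shows "ladder_inv {a, b, c, d} {{b, c}, {d, a}} {{a, b}, {c, d}} a b c d"
proof -
  have "cyc b c d" "cyc b d a" using q by (smt (verit) cyc_ax)+
  from pm_quad[OF this] have 1: "pm {a, b, c, d} {{b, c}, {d, a}}" by (simp add: insert_commute)
  have "\<not> cyc a x b \<and> \<not> cyc c x d" if "x \<in> {a, b, c, d}" for x
    using that q by (elim insertE emptyE) (smt (verit) cyc_ax)+
  moreover have "a \<noteq> b" "a \<noteq> c" "a \<noteq> d" "b \<noteq> c" "b \<noteq> d" "c \<noteq> d" using q by (smt (verit) cyc_ax)+
  moreover have "\<not> crosses {b, c} {a, b}" "\<not> crosses {b, c} {c, d}" "\<not> crosses {d, a} {a, b}"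
     "\<not> crosses {d, a} {c, d}" unfolding crosses_iff by (smt (verit) cyc_ax)+
  then have "compat {{b, c}, {d, a}} {{a, b}, {c, d}}" unfolding compat_def by simp
  ultimately show ?thesis unfolding ladder_inv_def using q 1 pm_quad[OF q] by (simp add: doubleton_eq_iff)
qed

lemma ladder_inv_step:
  assumes g: "ladder_inv V M N p1 p2 p3 p4" and q: "cyc p1 a b" "cyc p1 b c" "cyc p1 c d" "cyc p1 d p2"
  shows "ladder_inv (V \<union> {a, b, c, d}) (M \<union> {{b, c}, {d, a}}) (N \<union> {{a, b}, {c, d}}) a b c d"
proof -
  have B: "block V {a, b, c, d} a d" by (rule ladder_inv_block[OF g q])
  then have dj: "V \<inter> {a, b, c, d} = {}" unfolding block_def by blast
  have q': "cyc a b c" "cyc a c d" using q by (smt (verit) cyc_ax)+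
  note Q = quad_ladder_inv[OF q'] and g' = g[unfolded ladder_inv_def] and Q' = quad_ladder_inv[OF q', unfolded ladder_inv_def]
  have M: "pm V M" "pm {a, b, c, d} {{b, c}, {d, a}}" and N: "pm V N" "pm {a, b, c, d} {{a, b}, {c, d}}"
    using g' Q' by blast+
  have pms: "pm (V \<union> {a, b, c, d}) (M \<union> {{b, c}, {d, a}})" "pm (V \<union> {a, b, c, d}) (N \<union> {{a, b}, {c, d}})"
    using pm_Un[OF _ _ dj] M N block_compat[OF B] by meson+
  have c: "compat (M \<union> {{b, c}, {d, a}}) (N \<union> {{a, b}, {c, d}})"
  proof -
    have "compat M N" "compat {{b, c}, {d, a}} {{a, b}, {c, d}}" using g' Q' by blast+
    moreover have "compat M {{a, b}, {c, d}}" "compat {{b, c}, {d, a}} N"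
      using block_compat[OF B] M N compat_sym by blast+
    ultimately show ?thesis unfolding compat_def by (metis UnE)
  qed
  have "e \<inter> {a, b, c, d} = {}" if "e \<in> M \<union> N" for e
    using that pm_edge[OF M(1), of e] pm_edge[OF N(1), of e] dj by blast
  then have "M \<inter> {{a, b}, {c, d}} = {}" "{{b, c}, {d, a}} \<inter> N = {}" by blast+
  moreover have "M \<inter> N = {}" using g' by (elim conjE)
  moreover have "{{b, c}, {d, a}} \<inter> {{a, b}, {c, d}} = {}" using Q' by (elim conjE)
  ultimately have i: "(M \<union> {{b, c}, {d, a}}) \<inter> (N \<union> {{a, b}, {c, d}}) = {}"
    by (simp only: Int_Un_distrib Int_Un_distrib2 Un_empty_left)
  have gap: "\<not> cyc a x b \<and> \<not> cyc c x d" if "x \<in> V \<union> {a, b, c, d}" for x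
  proof (cases "x \<in> V")
    case True
    then have "cyc x a b" "cyc x c d" using block_first[OF B, of x b] block_last[OF B, of x c] q'
      by (metis cyc_neq insertCI)+
    then show ?thesis using cyc_asym cyc_rot by metis
  next
    case False
    then show ?thesis using that Q' by blast
  qed
  show ?thesis unfolding ladder_inv_def using pms c i q' gap g' by simp
qed

lemma ladder_imp_inv: "ladder V M N f p1 p2 p3 p4 \<Longrightarrow> ladder_inv V M N p1 p2 p3 p4"
proof (induction rule: ladder.induct)
  case (base a b c d) then show ?case by (rule quad_ladder_inv)
next
  case (step V M N f p1 p2 p3 p4 a b c d) show ?case by (rule ladder_inv_step[OF step.IH step.hyps(3-6)])
next
  case swap_end show ?case by (rule ladder_inv_swap[OF swap_end.IH])
qed

section \<open>Attaching at the first quadrilateral and reversing a ladder\<close>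

lemma prepend_base:
  assumes f: "cyc f1 f2 f3" "cyc f1 f3 f4" and dj: "{f1, f2, f3, f4} \<inter> {a, b, c, d} = {}"
    and q: "cyc f4 a b" "cyc f4 b c" "cyc f4 c d" "cyc f4 d f1"
  shows "ladder ({f1, f2, f3, f4} \<union> {a, b, c, d}) ({{f2, f3}, {f4, f1}} \<union> {{c, d}, {a, b}})
    ({{f1, f2}, {f3, f4}} \<union> {{b, c}, {d, a}}) (b, c, d, a) f1 f2 f3 f4"
proof -
  have 1: "cyc b c d" "cyc b d a" using q by (smt (verit) cyc_ax)+
  have g: "cyc d f1 f2" "cyc d f2 f3" "cyc d f3 f4" "cyc d f4 a" using f q by (smt (verit) cyc_ax)+
  have 2: "ladder {b, c, d, a} {{c, d}, {a, b}} {{b, c}, {d, a}} (b, c, d, a) d a b c"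
    by (rule swap_end[OF base[OF 1]])
  have 3: "{b, c, d, a} \<inter> {f1, f2, f3, f4} = {}" using dj by auto
  have "ladder ({b, c, d, a} \<union> {f1, f2, f3, f4}) ({{c, d}, {a, b}} \<union> {{f2, f3}, {f4, f1}})
    ({{b, c}, {d, a}} \<union> {{f1, f2}, {f3, f4}}) (b, c, d, a) f1 f2 f3 f4"
    by (rule step[OF 2 3 g])
  then show ?thesis by (simp add: Un_commute insert_commute)
qed

text \<open>The induction runs down to the single first quadrilateral, where the construction is
  restarted: the new quadrilateral becomes the first one and the old one is attached to it. The
  later steps are then repeated, since their conditions concern only the gap that they fill and
  disjointness.\<close>

lemma prepend:
  assumes "ladder V M N f p1 p2 p3 p4" "f = (f1, f2, f3, f4)" "V \<inter> {a, b, c, d} = {}"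
    "cyc f4 a b \<and> cyc f4 b c \<and> cyc f4 c d \<and> cyc f4 d f1 \<or> cyc f2 a b \<and> cyc f2 b c \<and> cyc f2 c d \<and> cyc f2 d f3"
  shows "ladder (V \<union> {a, b, c, d}) (M \<union> {{c, d}, {a, b}}) (N \<union> {{b, c}, {d, a}}) (b, c, d, a) p1 p2 p3 p4"
  using assms
proof (induction arbitrary: f1 f2 f3 f4 rule: ladder.induct)
  case (base x y z w)
  have f: "f1 = x" "f2 = y" "f3 = z" "f4 = w" using base.prems(1) by auto
  from base.prems(3) show ?case
  proof
    assume "cyc f4 a b \<and> cyc f4 b c \<and> cyc f4 c d \<and> cyc f4 d f1"
    then show ?thesis unfolding f using prepend_base[OF base.hyps base.prems(2)] by blast
  next
    assume q: "cyc f2 a b \<and> cyc f2 b c \<and> cyc f2 c d \<and> cyc f2 d f3"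
    have 1: "cyc z w x" "cyc z x y" using base.hyps by (smt (verit) cyc_ax)+
    have 2: "{z, w, x, y} \<inter> {a, b, c, d} = {}" using base.prems(2) by auto
    have "ladder ({z, w, x, y} \<union> {a, b, c, d}) ({{w, x}, {y, z}} \<union> {{c, d}, {a, b}})
       ({{z, w}, {x, y}} \<union> {{b, c}, {d, a}}) (b, c, d, a) z w x y"
      using prepend_base[OF 1 2] q unfolding f by blast
    from swap_end[OF this] show ?thesis by (simp add: insert_commute)
  qed
next
  case (step V M N f p1 p2 p3 p4 q r s t)
  have 1: "V \<inter> {a, b, c, d} = {}" "(V \<union> {a, b, c, d}) \<inter> {q, r, s, t} = {}"
    using step.prems(2) step.hyps(2) by auto
  have "ladder (V \<union> {a, b, c, d} \<union> {q, r, s, t}) (M \<union> {{c, d}, {a, b}} \<union> {{r, s}, {t, q}})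
     (N \<union> {{b, c}, {d, a}} \<union> {{q, r}, {s, t}}) (b, c, d, a) q r s t"
    by (rule ladder.step[OF step.IH[OF step.prems(1) 1(1) step.prems(3)] 1(2) step.hyps(3-6)])
  then show ?case by (simp only: Un_ac)
next
  case (swap_end V M N f p1 p2 p3 p4)
  show ?case by (rule ladder.swap_end[OF swap_end.IH[OF swap_end.prems]])
next
  case (swap_start V M N g1 g2 g3 g4 p1 p2 p3 p4)
  show ?case
    by (rule swap_start.IH[OF refl swap_start.prems(2)]) (use swap_start.prems in auto)
qed

text \<open>Read from its other end, the chain has \<open>M\<close> and \<open>N\<close> in
  exchanged roles. Shifting the corners of both end quadrilaterals by one turns
  \<open>N\<close>-sides into sides of the first matching, as the format of the tuples
  demands.\<close>

lemma ladder_reverse: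
  "ladder V M N f p1 p2 p3 p4 \<Longrightarrow>
    (case f of (f1, f2, f3, f4) \<Rightarrow> ladder V N M (p2, p3, p4, p1) f2 f3 f4 f1)"
proof (induction rule: ladder.induct)
  case (base a b c d)
  have "cyc b c d" "cyc b d a" using base by (smt (verit) cyc_ax)+
  from ladder.base[OF this] show ?case by (simp add: insert_commute)
next
  case (step V M N f p1 p2 p3 p4 a b c d)
  obtain f1 f2 f3 f4 where f: "f = (f1, f2, f3, f4)" by (cases f)
  have "ladder V N M (p2, p3, p4, p1) f2 f3 f4 f1" using step.IH f by simp
  from prepend[OF this refl step.hyps(2)] step.hyps(3-6)
  have "ladder (V \<union> {a, b, c, d}) (N \<union> {{c, d}, {a, b}}) (M \<union> {{b, c}, {d, a}}) (b, c, d, a) f2 f3 f4 f1"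
    by blast
  then show ?case unfolding f by (simp add: insert_commute)
next
  case (swap_end V M N f p1 p2 p3 p4)
  then show ?case by (auto intro: ladder.swap_start split: prod.splits)
next
  case (swap_start V M N f1 f2 f3 f4 p1 p2 p3 p4)
  then show ?case by (auto intro: ladder.swap_end)
qed

section \<open>Ladders are mutually unique neighbours\<close>

lemma nc_trap: "\<not> crosses {a, b} {x, y} \<Longrightarrow> cyc a x b \<Longrightarrow> x \<noteq> y \<Longrightarrow> y = a \<or> y = b \<or> cyc a y b"
  unfolding crosses_iff by (smt (verit) cyc_ax)

lemma pm_nc: "pm V X \<Longrightarrow> e \<in> X \<Longrightarrow> f \<in> X \<Longrightarrow> \<not> crosses e f"
  unfolding pm_def compat_def by blast

lemma pm_trap:
  assumes X: "pm V X" and ab: "{a, b} \<in> X" and xy: "{x, y} \<in> X" and c: "cyc a x b"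
  shows "cyc a y b"
proof -
  have "x \<noteq> a" "x \<noteq> b" using cyc_neq[OF c] by auto
  then have "y \<noteq> a" "y \<noteq> b"
    using pm_uniq[OF X, of a b x] pm_uniq[OF X, of b a x] ab xy by (auto simp: insert_commute)
  then show ?thesis using nc_trap[OF pm_nc[OF X ab xy] c] pm_edgeD[OF X xy] by blast
qed

lemma pm_split:
  assumes X: "pm (V \<union> Q) X" and Y: "pm Q Y" and YX: "Y \<subseteq> X" and dj: "V \<inter> Q = {}"
  shows "pm V {e \<in> X. e \<subseteq> V}" "X = {e \<in> X. e \<subseteq> V} \<union> Y"
proof -
  have q: "{p, q} \<in> Y" if pq: "{p, q} \<in> X" "p \<in> Q" for p q
  proof -
    obtain r where r: "{p, r} \<in> Y" using pm_ex[OF Y pq(2)] .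
    then show ?thesis using pm_uniq[OF X pq(1), of r] YX by blast
  qed
  have cl: "q \<in> V" if pq: "{p, q} \<in> X" "p \<in> V" for p q
  proof (rule ccontr)
    assume "q \<notin> V"
    then have "q \<in> Q" using pm_edgeD[OF X pq(1)] by blast
    then have "{q, p} \<in> Y" using q[of q p] pq(1) by (simp add: insert_commute)
    then show False using pm_edgeD[OF Y] pq(2) dj by blast
  qed
  show "pm V {e \<in> X. e \<subseteq> V}" by (rule pm_restrict[OF X _ cl]) auto
  have "e \<subseteq> V \<or> e \<in> Y" if e: "e \<in> X" for e
  proof -
    obtain x y where xy: "x \<in> V \<union> Q" "e = {x, y}" using pm_edge[OF X e] by blast
    then show ?thesis using cl[of x y] q[of x y] e by blast
  qed
  then show "X = {e \<in> X. e \<subseteq> V} \<union> Y" using YX by blast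
qed

lemma Int_doubleton_eq_single:
  assumes i: "X \<inter> (N \<union> {P, Q}) = {P}" and PQ: "P \<noteq> Q" and PN: "P \<notin> N"
  shows "P \<in> X \<and> Q \<notin> X \<and> X \<inter> N = {}"
proof -
  have *: "e \<in> X \<and> (e \<in> N \<or> e = P \<or> e = Q) \<longleftrightarrow> e = P" for e
    using i by (simp only: set_eq_iff) blast
  show ?thesis using *[of P] *[of Q] * PQ PN by (metis disjoint_iff)
qed

lemma pm_sub_eq:
  assumes X: "pm V X" and Y: "pm V Y" and YX: "Y \<subseteq> X"
  shows "X = Y"
proof
  show "X \<subseteq> Y"
  proof
    fix e assume e: "e \<in> X"
    obtain x y where xy: "x \<in> V" "e = {x, y}" using pm_edge[OF X e] by blast
    obtain r where r: "{x, r} \<in> Y" using pm_ex[OF Y xy(1)] .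
    then show "e \<in> Y" using pm_uniq[OF X, of x r y] YX e xy(2) by blast
  qed
qed (rule YX)

text \<open>Uniqueness alone: that \<open>N\<close> is a neighbour is recorded elsewhere, in
  \<open>ladder_inv\<close> or \<open>mutual\<close>.\<close>

definition only_nbr :: "nat set \<Rightarrow> nat set set \<Rightarrow> nat set set \<Rightarrow> bool" where
  "only_nbr V M N \<longleftrightarrow> (\<forall>X. pm V X \<longrightarrow> compat X M \<longrightarrow> X \<inter> M = {} \<longrightarrow> X = N)"

text \<open>For a side \<open>e\<close> of the last quadrilateral this makes the next step of the ladder rigid: a second
neighbour of the extended \<open>N\<close> would have to run around the new quadrilateral along \<open>e\<close>, and undoing that
detour would leave a matching sharing exactly \<open>e\<close> with \<open>N\<close>.\<close>

definition no_single :: "nat set \<Rightarrow> nat set set \<Rightarrow> nat set \<Rightarrow> bool" where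
  "no_single V N e \<longleftrightarrow> (\<forall>X. pm V X \<longrightarrow> compat X N \<longrightarrow> X \<inter> N \<noteq> {e})"

text \<open>A diagonal a c would leave b alone on its side, without a partner.\<close>

lemma quad_cases:
  assumes q: "cyc a b c" "cyc a c d" and X: "pm {a, b, c, d} X"
  shows "X = {{a, b}, {c, d}} \<or> X = {{b, c}, {d, a}}"
proof -
  have ne: "a \<noteq> b" "a \<noteq> c" "a \<noteq> d" "b \<noteq> c" "b \<noteq> d" "c \<noteq> d" using q by (smt (verit) cyc_ax)+
  obtain r where r: "{a, r} \<in> X" "r \<in> {a, b, c, d}" "r \<noteq> a" by (rule pm_ex[OF X, of a]) auto
  obtain s where s: "{c, s} \<in> X" "s \<in> {a, b, c, d}" "s \<noteq> c" by (rule pm_ex[OF X, of c]) auto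
  obtain t where t: "{b, t} \<in> X" "t \<in> {a, b, c, d}" "t \<noteq> b" by (rule pm_ex[OF X, of b]) auto
  have sub: "X = Y" if "pm {a, b, c, d} Y" "Y \<subseteq> X" for Y
    by (rule pm_sub_eq[OF X that])
  have "r \<noteq> c"
  proof
    assume rc: "r = c"
    have "cyc a t c" by (rule pm_trap[OF X _ t(1)]) (use r rc q in auto)
    then show False using t(2,3) q by (smt (verit) cyc_ax insertE emptyE)
  qed
  then consider "r = b" | "r = d" using r by blast
  then show ?thesis
  proof cases
    case 1
    have "s \<noteq> a" "s \<noteq> b" using pm_uniq[OF X, of a r s] pm_uniq[OF X, of a r c] pm_uniq[OF X, of b a c] r s 1 ne
      by (metis insert_commute)+
    then have "s = d" using s by blast
    then show ?thesis using sub[OF pm_quad[OF q]] r s 1 by simp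
  next
    case 2
    have "s \<noteq> a" "s \<noteq> d" using pm_uniq[OF X, of a r c] pm_uniq[OF X, of d a c] r s 2 ne
      by (metis insert_commute)+
    then have "s = b" using s by blast
    moreover have "cyc b c d" "cyc b d a" using q by (smt (verit) cyc_ax)+
    from pm_quad[OF this] have "pm {a, b, c, d} {{b, c}, {d, a}}" by (simp add: insert_commute)
    ultimately show ?thesis using sub r s 2 by (simp add: insert_commute)
  qed
qed

lemma compat_sub: "compat X N \<Longrightarrow> Y \<subseteq> X \<Longrightarrow> P \<subseteq> N \<Longrightarrow> compat Y P"
  unfolding compat_def by blast

section \<open>One more quadrilateral keeps the neighbours unique\<close>

context
  fixes V M N p1 p2 p3 p4 a b c d W
  assumes g: "ladder_inv V M N p1 p2 p3 p4" and q: "cyc p1 a b" "cyc p1 b c" "cyc p1 c d" "cyc p1 d p2"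
  defines "W \<equiv> V \<union> {a, b, c, d}"
begin

lemma new_quad_block: "block V {a, b, c, d} a d" by (rule ladder_inv_block[OF g q])

lemma new_quad_disj: "V \<inter> {a, b, c, d} = {}" using new_quad_block unfolding block_def by blast

lemma new_quad_cyc: "cyc a b c" "cyc a c d" "cyc b c d" "cyc b d a" "cyc a b p2" "cyc b c p2" "cyc c d p2" "cyc a p2 p1"
  "cyc p1 a c" "cyc p1 a d" "cyc p1 b d" "cyc p1 a p2" "cyc p1 b p2" "cyc p1 c p2"
  using q by (smt (verit) cyc_ax)+

lemma new_quad_neq: "a \<noteq> b" "a \<noteq> c" "a \<noteq> d" "b \<noteq> c" "b \<noteq> d" "c \<noteq> d"
  "p1 \<noteq> a" "p1 \<noteq> b" "p1 \<noteq> c" "p1 \<noteq> d" "p2 \<noteq> a" "p2 \<noteq> b" "p2 \<noteq> c" "p2 \<noteq> d" "p1 \<noteq> p2"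
  using q by (smt (verit) cyc_ax)+

lemma new_quad_gap: assumes "x \<in> W" "cyc p1 x p2" shows "x \<in> {a, b, c, d}"
  using assms g unfolding W_def ladder_inv_def by blast

lemma new_quad_between:
  assumes "x \<in> W"
  shows "cyc a x d \<Longrightarrow> x = b \<or> x = c" "cyc b x d \<Longrightarrow> x = c" "cyc c x p2 \<Longrightarrow> x = d"
    "cyc b x p2 \<Longrightarrow> x = c \<or> x = d" "cyc a x p2 \<Longrightarrow> x = b \<or> x = c \<or> x = d" "cyc p1 x b \<Longrightarrow> x = a"
proof -
  have *: "x = a \<or> x = b \<or> x = c \<or> x = d \<or> \<not> cyc p1 x p2" using new_quad_gap[OF assms] by blast
  show "cyc a x d \<Longrightarrow> x = b \<or> x = c" "cyc b x d \<Longrightarrow> x = c" "cyc c x p2 \<Longrightarrow> x = d"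
    "cyc b x p2 \<Longrightarrow> x = c \<or> x = d" "cyc a x p2 \<Longrightarrow> x = b \<or> x = c \<or> x = d" "cyc p1 x b \<Longrightarrow> x = a"
    using * q by (smt (verit) cyc_ax)+
qed

text \<open>The new \<open>M\<close>-side d a shuts b and c off from the rest, and b c itself is
  forbidden. So \<open>X\<close> uses a b and c d, and what remains of it is a neighbour of
  \<open>M\<close> on \<open>V\<close>.\<close>

lemma step_only_nbr1:
  assumes "only_nbr V M N"
  shows "only_nbr W (M \<union> {{b, c}, {d, a}}) (N \<union> {{a, b}, {c, d}})"
  unfolding only_nbr_def
proof (intro allI impI)
  fix X assume X: "pm W X" and cX: "compat X (M \<union> {{b, c}, {d, a}})" and dX: "X \<inter> (M \<union> {{b, c}, {d, a}}) = {}"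
  have nbc: "{b, c} \<notin> X" using dX by blast
  obtain y where y: "{b, y} \<in> X" "y \<in> W" "y \<noteq> b" using pm_ex[OF X, of b] unfolding W_def by blast
  obtain z where z: "{c, z} \<in> X" "z \<in> W" "z \<noteq> c" using pm_ex[OF X, of c] unfolding W_def by blast
  have nda: "\<not> crosses {a, d} {b, y}" "\<not> crosses {a, d} {c, z}"
    using cX y(1) z(1) crosses_sym unfolding compat_def by (metis UnI2 insert_commute insertCI)+
  have abd: "cyc a b d" "cyc a c d" using new_quad_cyc cyc_trans by blast+
  have "y = a \<or> y = d \<or> y = b \<or> y = c"
    using nc_trap[OF nda(1) abd(1)] y new_quad_between(1)[OF y(2)] by blast
  moreover have "y \<noteq> c" using nbc y by blast
  moreover have "y \<noteq> d"
  proof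
    assume "y = d"
    then have "cyc b z d" using pm_trap[OF X _ z(1) new_quad_cyc(3)] y by blast
    then show False using new_quad_between(2)[OF z(2)] z(3) by blast
  qed
  ultimately have ya: "{b, a} \<in> X" using y by blast
  have "z = a \<or> z = d \<or> z = b \<or> z = c"
    using nc_trap[OF nda(2) abd(2)] z new_quad_between(1)[OF z(2)] by blast
  moreover have "z \<noteq> b" using nbc z by (metis insert_commute)
  moreover have "z \<noteq> a" using pm_uniq[OF X, of a b c] ya z new_quad_neq by (metis insert_commute)
  ultimately have zd: "{c, d} \<in> X" using z by blast
  have sub: "{{a, b}, {c, d}} \<subseteq> X" using ya zd by (simp add: insert_commute)
  note sp = pm_split[OF X[unfolded W_def] pm_quad[OF new_quad_cyc(1,2)] sub new_quad_disj]
  have "compat {e \<in> X. e \<subseteq> V} M" by (rule compat_sub[OF cX]) auto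
  moreover have "{e \<in> X. e \<subseteq> V} \<inter> M = {}" using dX by blast
  ultimately have "{e \<in> X. e \<subseteq> V} = N" using assms sp(1) unfolding only_nbr_def by blast
  then show "X = N \<union> {{a, b}, {c, d}}" using sp(2) by simp
qed

text \<open>A detour undone: \<open>X\<close> leaves the new quadrilateral by edges to p1 and p2.
  Exchanging these for z1 z2 and the \<open>N\<close>-side p1 p2 splits \<open>X\<close> into a
  matching of the quadrilateral and a matching of \<open>V\<close> that shares exactly p1 p2 with
  \<open>N\<close>, against \<open>no_single\<close>.\<close>

lemma unsplice:
  assumes ns: "no_single V N {p1, p2}" and X: "pm W X" and cX: "compat X N" and dX: "X \<inter> N = {}"
    and z: "{z1, p1} \<in> X" "{z2, p2} \<in> X" "z1 \<in> {a, b, c, d}" "z2 \<in> {a, b, c, d}" "cyc p1 z1 z2"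
    and nc: "\<And>e. e \<in> X \<Longrightarrow> \<not> crosses {z1, z2} e"
    and Y: "pm {a, b, c, d} Y" "Y \<subseteq> X \<union> {{z1, z2}}"
  shows False
proof -
  have p12: "{p1, p2} \<in> N" "{p2, p1} \<in> N" using g unfolding ladder_inv_def by (simp_all add: insert_commute)
  have V: "p1 \<in> V" "p2 \<in> V" using ladder_inv_mem[OF g] by auto
  have zV: "z1 \<notin> V" "z2 \<notin> V" using z new_quad_disj by blast+
  have "cyc p1 z2 p2" using z(4) q new_quad_cyc by blast
  then have cy: "cyc z1 z2 p2" "cyc z1 p2 p1" using z(5) by (smt (verit) cyc_ax)+
  let ?X = "X - {{z1, p1}, {z2, p2}} \<union> {{z1, z2}, {p2, p1}}"
  have 1: "pm W ?X"
  proof (rule switch[OF X z(1,2) cy])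
    fix e assume "e \<in> X"
    then show "\<not> crosses {z1, z2} e \<and> \<not> crosses {p2, p1} e"
      using nc[of e] cX p12 crosses_sym unfolding compat_def by blast
  qed
  have YQ: "f \<subseteq> {a, b, c, d}" if "f \<in> Y" for f using pm_edge[OF Y(1) that] by auto
  have "{z1, p1} \<notin> Y" "{z2, p2} \<notin> Y" using YQ[of "{z1, p1}"] YQ[of "{z2, p2}"] V new_quad_disj by auto
  then have Y': "Y \<subseteq> ?X" using Y(2) by blast
  note sp = pm_split(1)[OF 1[unfolded W_def] Y(1) Y' new_quad_disj]
  have pp: "{p1, p2} = {p2, p1}" by (simp add: insert_commute)
  have "?X \<inter> {e. e \<subseteq> V} = {e \<in> ?X. e \<subseteq> V}" by blast
  have NN: "\<not> crosses e f" if "e \<in> N" "f \<in> N" for e f using g that unfolding ladder_inv_def pm_def compat_def by blast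
  have in_old: "e \<in> X \<or> e = {p2, p1}" if "e \<in> ?X" "e \<subseteq> V" for e using that zV by auto
  have "compat {e \<in> ?X. e \<subseteq> V} N"
    unfolding compat_def
  proof (intro ballI)
    fix e f assume "e \<in> {e \<in> ?X. e \<subseteq> V}" and f: "f \<in> N"
    then have "e \<in> X \<or> e = {p2, p1}" using in_old by blast
    then show "\<not> crosses e f" using f cX NN[OF p12(2) f] unfolding compat_def by metis
  qed
  moreover have "{e \<in> ?X. e \<subseteq> V} \<inter> N = {{p1, p2}}"
  proof
    show "{e \<in> ?X. e \<subseteq> V} \<inter> N \<subseteq> {{p1, p2}}" using in_old dX pp by blast
    show "{{p1, p2}} \<subseteq> {e \<in> ?X. e \<subseteq> V} \<inter> N" using p12 V pp by simp
  qed
  ultimately show False using ns sp unfolding no_single_def by blast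
qed

text \<open>The \<open>N\<close>-side p1 p2 has the new quadrilateral alone on one side, and
  \<open>X\<close> does not cross it.\<close>

lemma gap_partner:
  assumes X: "pm W X" and cX: "compat X N" and xy: "{x, y} \<in> X" "x \<in> {a, b, c, d}"
  shows "y \<in> {p1, p2, a, b, c, d}"
proof -
  have "{p1, p2} \<in> N" using g unfolding ladder_inv_def by blast
  then have "\<not> crosses {p1, p2} {x, y}" using cX xy crosses_sym unfolding compat_def by blast
  moreover have "cyc p1 x p2" using xy(2) q new_quad_cyc by blast
  ultimately have "y = p1 \<or> y = p2 \<or> cyc p1 y p2" using nc_trap pm_edgeD[OF X xy(1)] by blast
  then show ?thesis using new_quad_gap pm_edgeD[OF X xy(1)] by blast
qed

text \<open>If \<open>X\<close> uses a b but not c d, then c and d must leave the gap, and planarity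
  sends c to p1 and d to p2; this detour is excluded by \<open>unsplice\<close>. For c d the points
  a and b take the same part.\<close>

lemma step_no_single:
  assumes ns: "no_single V N {p1, p2}"
  shows "no_single W (N \<union> {{a, b}, {c, d}}) {a, b}" "no_single W (N \<union> {{a, b}, {c, d}}) {c, d}"
proof -
  have abcd: "{a, b} \<noteq> {c, d}" using new_quad_neq by (simp add: doubleton_eq_iff)
  have QN: "{a, b} \<notin> N" "{c, d} \<notin> N" using g new_quad_disj pm_edgeD unfolding ladder_inv_def by blast+
  show "no_single W (N \<union> {{a, b}, {c, d}}) {a, b}" unfolding no_single_def
  proof (intro allI impI notI)
    fix X assume X: "pm W X" and cX: "compat X (N \<union> {{a, b}, {c, d}})"
      and iX: "X \<inter> (N \<union> {{a, b}, {c, d}}) = {{a, b}}"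
    have cN: "compat X N" by (rule compat_sub[OF cX]) auto
    have ab: "{a, b} \<in> X" "{b, a} \<in> X" and ncd: "{c, d} \<notin> X" "{d, c} \<notin> X" and dN: "X \<inter> N = {}"
      using Int_doubleton_eq_single[OF iX] abcd QN by (simp_all add: insert_commute)
    obtain y where y: "{c, y} \<in> X" "y \<in> W" "y \<noteq> c" using pm_ex[OF X, of c] unfolding W_def by blast
    obtain z where z: "{d, z} \<in> X" "z \<in> W" "z \<noteq> d" using pm_ex[OF X, of d] unfolding W_def by blast
    have yab: "y \<noteq> a" "y \<noteq> b" using pm_uniq[OF X, of a b c] pm_uniq[OF X, of b a c] ab y new_quad_neq
      by (metis insert_commute)+
    have zab: "z \<noteq> a" "z \<noteq> b" using pm_uniq[OF X, of a b d] pm_uniq[OF X, of b a d] ab z new_quad_neq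
      by (metis insert_commute)+
    have yd: "y \<noteq> d" using y ncd by blast
    have zc: "z \<noteq> c" using z ncd by blast
    \<comment> \<open>An edge c p2 would shut in d, the only point between them.\<close>
    have y2: "y \<noteq> p2"
    proof
      assume "y = p2"
      then have "cyc c z p2" using pm_trap[OF X _ z(1) new_quad_cyc(7)] y by blast
      then show False using new_quad_between(3)[OF z(2)] z(3) by blast
    qed
    then have yp: "y = p1" using gap_partner[OF X cN y(1)] yab yd y(3) by blast
    have "z \<noteq> p1" using pm_uniq[OF X, of p1 c d] y z yp new_quad_neq by (metis insert_commute)
    then have zp: "z = p2" using gap_partner[OF X cN z(1)] zab zc z(3) by blast
    have cdN: "\<not> crosses {c, d} e" if "e \<in> X" for e
      using cX that crosses_sym unfolding compat_def by (metis UnI2 insertCI)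
    show False
      by (rule unsplice[OF ns X cN dN y(1)[unfolded yp] z(1)[unfolded zp] _ _ q(3) cdN pm_quad[OF new_quad_cyc(1,2)]])
        (use ab in auto)
  qed
  show "no_single W (N \<union> {{a, b}, {c, d}}) {c, d}" unfolding no_single_def
  proof (intro allI impI notI)
    fix X assume X: "pm W X" and cX: "compat X (N \<union> {{a, b}, {c, d}})"
      and iX: "X \<inter> (N \<union> {{a, b}, {c, d}}) = {{c, d}}"
    have cN: "compat X N" by (rule compat_sub[OF cX]) auto
    have cd: "{c, d} \<in> X" "{d, c} \<in> X" and nab: "{a, b} \<notin> X" "{b, a} \<notin> X" and dN: "X \<inter> N = {}"
      using Int_doubleton_eq_single[OF iX[unfolded insert_commute[of "{a, b}"]]] abcd QN by (simp_all add: insert_commute)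
    obtain y where y: "{b, y} \<in> X" "y \<in> W" "y \<noteq> b" using pm_ex[OF X, of b] unfolding W_def by blast
    obtain z where z: "{a, z} \<in> X" "z \<in> W" "z \<noteq> a" using pm_ex[OF X, of a] unfolding W_def by blast
    have ycd: "y \<noteq> c" "y \<noteq> d" using pm_uniq[OF X, of c d b] pm_uniq[OF X, of d c b] cd y new_quad_neq
      by (metis insert_commute)+
    have zcd: "z \<noteq> c" "z \<noteq> d" using pm_uniq[OF X, of c d a] pm_uniq[OF X, of d c a] cd z new_quad_neq
      by (metis insert_commute)+
    have ya: "y \<noteq> a" using y nab by blast
    have zb: "z \<noteq> b" using z nab by blast
    have y1: "y \<noteq> p1"
    proof
      assume "y = p1"
      then have "{p1, b} \<in> X" using y by (simp add: insert_commute)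
      then have "cyc p1 z b" using pm_trap[OF X _ z(1) q(1)] by blast
      then show False using new_quad_between(6)[OF z(2)] z(3) by blast
    qed
    then have yp: "y = p2" using gap_partner[OF X cN y(1)] ycd ya y(3) by blast
    have "z \<noteq> p2" using pm_uniq[OF X, of p2 b a] y z yp new_quad_neq by (metis insert_commute)
    then have zp: "z = p1" using gap_partner[OF X cN z(1)] zcd zb z(3) by blast
    have abN: "\<not> crosses {a, b} e" if "e \<in> X" for e
      using cX that crosses_sym unfolding compat_def by (metis UnI2 insertCI)
    show False
      by (rule unsplice[OF ns X cN dN z(1)[unfolded zp] y(1)[unfolded yp] _ _ q(1) abN pm_quad[OF new_quad_cyc(1,2)]])
        (use cd in auto)
  qed
qed

text \<open>The edge b c is forced: b d and b p2 would leave c without an admissible partner, b p1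
  would shut in a, and a b is excluded. Then either d a is present and uniqueness on
  \<open>V\<close> applies, or a goes to p1 and d to p2, and \<open>no_single\<close> is what
  excludes this detour.\<close>

lemma step_only_nbr2:
  assumes ns: "no_single V N {p1, p2}" and on: "only_nbr V N M"
  shows "only_nbr W (N \<union> {{a, b}, {c, d}}) (M \<union> {{b, c}, {d, a}})"
  unfolding only_nbr_def
proof (intro allI impI)
  fix X assume X: "pm W X" and cX: "compat X (N \<union> {{a, b}, {c, d}})"
    and iX: "X \<inter> (N \<union> {{a, b}, {c, d}}) = {}"
  have cN: "compat X N" by (rule compat_sub[OF cX]) auto
  have nX: "{a, b} \<notin> X" "{b, a} \<notin> X" "{c, d} \<notin> X" "{d, c} \<notin> X" and dN: "X \<inter> N = {}"
    using iX by (auto simp: insert_commute)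
  obtain z where z: "{a, z} \<in> X" "z \<in> W" "z \<noteq> a" using pm_ex[OF X, of a] unfolding W_def by blast
  obtain y where y: "{b, y} \<in> X" "y \<in> W" "y \<noteq> b" using pm_ex[OF X, of b] unfolding W_def by blast
  obtain u where u: "{c, u} \<in> X" "u \<in> W" "u \<noteq> c" using pm_ex[OF X, of c] unfolding W_def by blast
  obtain v where v: "{d, v} \<in> X" "v \<in> W" "v \<noteq> d" using pm_ex[OF X, of d] unfolding W_def by blast
  have "y \<noteq> a" "u \<noteq> d" using y u nX by blast+
  have "y \<noteq> d"
  proof
    assume "y = d"
    then have "cyc b u d" using pm_trap[OF X _ u(1) new_quad_cyc(3)] y by blast
    then show False using new_quad_between(2)[OF u(2)] u(3) by blast
  qed
  moreover have "y \<noteq> p2"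
  proof
    assume "y = p2"
    then have "cyc b u p2" using pm_trap[OF X _ u(1) new_quad_cyc(6)] y by blast
    then show False using new_quad_between(4)[OF u(2)] u(3) \<open>u \<noteq> d\<close> by blast
  qed
  moreover have "y \<noteq> p1"
  proof
    assume "y = p1"
    then have "{p1, b} \<in> X" using y by (simp add: insert_commute)
    then have "cyc p1 z b" using pm_trap[OF X _ z(1) q(1)] by blast
    then show False using new_quad_between(6)[OF z(2)] z(3) by blast
  qed
  ultimately have bc: "{b, c} \<in> X" using gap_partner[OF X cN y(1)] y \<open>y \<noteq> a\<close> by blast
  have cb: "{c, b} \<in> X" using bc by (simp add: insert_commute)
  have zbc: "z \<noteq> b" "z \<noteq> c" and vbc: "v \<noteq> b" "v \<noteq> c"
    using pm_uniq[OF X, of b c a] pm_uniq[OF X, of c b a] pm_uniq[OF X, of b c d] pm_uniq[OF X, of c b d]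
      bc cb z(1) v(1) new_quad_neq by (metis insert_commute)+
  have zp2: "z \<noteq> p2"
  proof
    assume z2: "z = p2"
    have "cyc a d p2" using q by (smt (verit) cyc_ax)
    then have "cyc a v p2" using pm_trap[OF X _ v(1)] z(1) z2 by blast
    then show False using new_quad_between(5)[OF v(2)] v(3) vbc by blast
  qed
  then consider "z = d" | "z = p1" using gap_partner[OF X cN z(1)] z(3) zbc by blast
  then show "X = M \<union> {{b, c}, {d, a}}"
  proof cases
    case 1
    have sub: "{{b, c}, {d, a}} \<subseteq> X" using bc z 1 by (simp add: insert_commute)
    have "pm {a, b, c, d} {{b, c}, {d, a}}" using pm_quad[OF new_quad_cyc(3,4)] by (simp add: insert_commute)
    note sp = pm_split[OF X[unfolded W_def] this sub new_quad_disj]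
    have "compat {e \<in> X. e \<subseteq> V} N" by (rule compat_sub[OF cN]) auto
    moreover have "{e \<in> X. e \<subseteq> V} \<inter> N = {}" using dN by blast
    ultimately have "{e \<in> X. e \<subseteq> V} = M" using on sp(1) unfolding only_nbr_def by blast
    then show ?thesis using sp(2) by simp
  next
    case 2
    have "v \<noteq> a" using pm_uniq[OF X, of a p1 d] z 2 v new_quad_neq by (metis insert_commute)
    moreover have "v \<noteq> p1" using pm_uniq[OF X, of p1 a d] z 2 v new_quad_neq by (metis insert_commute)
    ultimately have vp: "v = p2" using gap_partner[OF X cN v(1)] v(3) vbc by blast
    have nc: "\<not> crosses {a, d} e" if e: "e \<in> X" for e
    proof
      assume c: "crosses {a, d} e"
      obtain x w where xw: "e = {x, w}" "x \<in> W" "w \<in> W" using pm_edge[OF X e] by blast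
      have "cyc a x d \<or> cyc a w d" using c unfolding xw(1) crosses_iff by (metis cyc_rot)
      then have "x = b \<or> x = c \<or> w = b \<or> w = c" using new_quad_between(1) xw by blast
      then have "e = {b, c}" using e pm_uniq[OF X, of b c] pm_uniq[OF X, of c b] bc cb unfolding xw(1)
        by (metis insert_commute)
      then have "crosses {a, d} {b, c}" using c by simp
      then show False using new_quad_cyc(1-4) unfolding crosses_iff by (smt (verit) cyc_ax)
    qed
    have sub: "{{b, c}, {d, a}} \<subseteq> X \<union> {{a, d}}" using bc by (simp add: insert_commute)
    have pmq: "pm {a, b, c, d} {{b, c}, {d, a}}" using pm_quad[OF new_quad_cyc(3,4)] by (simp add: insert_commute)
    show ?thesis
      by (rule FalseE, rule unsplice[OF ns X cN dN z(1)[unfolded 2] v(1)[unfolded vp] _ _ new_quad_cyc(10) nc pmq sub]) auto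
  qed
qed

end

lemma ladder_unique:
  "ladder V M N f p1 p2 p3 p4 \<Longrightarrow>
    only_nbr V M N \<and> only_nbr V N M \<and> no_single V N {p1, p2} \<and> no_single V N {p3, p4}"
proof (induction rule: ladder.induct)
  case (base a b c d)
  have "a \<noteq> b" "a \<noteq> c" "a \<noteq> d" "b \<noteq> c" "b \<noteq> d" "c \<noteq> d" using base by (smt (verit) cyc_ax)+
  then have d: "{a, b} \<noteq> {c, d}" "{a, b} \<noteq> {b, c}" "{a, b} \<noteq> {d, a}" "{c, d} \<noteq> {b, c}" "{c, d} \<noteq> {d, a}"
    by (auto simp: doubleton_eq_iff)
  show ?case unfolding only_nbr_def no_single_def
  proof (intro conjI allI impI)
    fix X assume X: "pm {a, b, c, d} X"
    note q = quad_cases[OF base X]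
    show "X = {{a, b}, {c, d}}" if "X \<inter> {{b, c}, {d, a}} = {}" using q that by auto
    show "X = {{b, c}, {d, a}}" if "X \<inter> {{a, b}, {c, d}} = {}" using q that by auto
    \<comment> \<open>On four points \<open>X\<close> consists of both \<open>N\<close>-sides or of
      both \<open>M\<close>-sides, so it never has exactly one \<open>N\<close>-side.\<close>
    from q have "X \<inter> {{a, b}, {c, d}} = {{a, b}, {c, d}} \<or> X \<inter> {{a, b}, {c, d}} = {}"
    proof
      assume "X = {{b, c}, {d, a}}"
      then show ?thesis using quad_ladder_inv[OF base] unfolding ladder_inv_def by metis
    qed simp
    moreover have "{P, Q} \<noteq> {P} \<and> {P, Q} \<noteq> {Q}" if "P \<noteq> Q" for P Q :: "nat set"
      using that by auto
    note this[OF d(1)]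
    ultimately show "X \<inter> {{a, b}, {c, d}} \<noteq> {{a, b}}" "X \<inter> {{a, b}, {c, d}} \<noteq> {{c, d}}"
      by (metis insert_not_empty)+
  qed
next
  case (step V M N f p1 p2 p3 p4 a b c d)
  note g = ladder_imp_inv[OF step.hyps(1)] and q = step.hyps(3-6)
  show ?case
    using step_only_nbr1[OF g q] step_only_nbr2[OF g q] step_no_single[OF g q] step.IH by simp
qed auto

section \<open>Gaps of a ladder\<close>

text \<open>If a quadrilateral facing this gap with an \<open>M\<close>-side is placed at \<open>w\<close>, then exchanging that side and
the visible edge \<open>s t\<close> yields a second neighbour of the extended \<open>N\<close>.\<close>

definition spliceable :: "nat set \<Rightarrow> nat set set \<Rightarrow> nat \<Rightarrow> bool" where
  "spliceable V N w \<longleftrightarrow> (\<exists>X s t. pm V X \<and> compat X N \<and> {s, t} \<in> X \<and> X \<inter> N \<subseteq> {{s, t}} \<and>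
     (\<forall>e\<in>X \<union> N. \<not> crosses {s, w} e \<and> \<not> crosses {w, t} e))"

lemma spliceableI:
  assumes "pm V X" "compat X N" "{s, t} \<in> X" "X \<inter> N \<subseteq> {{s, t}}"
    and "\<And>e. e \<in> X \<union> N \<Longrightarrow> \<not> crosses {s, w} e \<and> \<not> crosses {w, t} e"
  shows "spliceable V N w"
proof -
  have "\<forall>e\<in>X \<union> N. \<not> crosses {s, w} e \<and> \<not> crosses {w, t} e" using assms(5) by (rule ballI)
  with assms(1-4) show ?thesis unfolding spliceable_def by (intro exI conjI)
qed

lemma ladder_inv_basic:
  assumes "ladder_inv V M N p1 p2 p3 p4"
  shows "pm V M" "pm V N" "compat M N" "M \<inter> N = {}"
  using assms unfolding ladder_inv_def by blast+

lemma pm_edge2: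
  assumes "pm V X" "pm V Y" "e \<in> X \<union> Y"
  obtains x y where "x \<in> V" "y \<in> V" "e = {x, y}"
proof -
  have "\<exists>a\<in>V. \<exists>b\<in>V. a \<noteq> b \<and> e = {a, b}"
    using assms(3) pm_edge[OF assms(1)] pm_edge[OF assms(2)] by (elim UnE)
  then show thesis using that by blast
qed

lemma gap_visible:
  assumes "\<And>x. x \<in> V \<Longrightarrow> \<not> cyc s x t" "cyc s w t" "x \<in> V" "y \<in> V"
  shows "\<not> crosses {s, w} {x, y} \<and> \<not> crosses {w, t} {x, y}"
  using assms(1)[OF assms(3)] assms(1)[OF assms(4)] assms(2) unfolding crosses_iff by (smt (verit) cyc_ax)

lemma spliceable_gap:
  assumes X: "pm V X" and N: "pm V N" and c: "compat X N" and st: "{s, t} \<in> X" and XN: "X \<inter> N \<subseteq> {{s, t}}"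
    and gap: "\<And>x. x \<in> V \<Longrightarrow> \<not> cyc s x t" and w: "cyc s w t"
  shows "spliceable V N w"
proof -
  have "\<not> crosses {s, w} e \<and> \<not> crosses {w, t} e" if e: "e \<in> X \<union> N" for e
  proof -
    obtain x y where "x \<in> V" "y \<in> V" "e = {x, y}" by (rule pm_edge2[OF X N e])
    then show ?thesis using gap_visible[OF gap w] by blast
  qed
  then show ?thesis by (rule spliceableI[OF X c st XN])
qed

lemma quad_split:
  assumes g: "ladder_inv V M N p1 p2 p3 p4" and q: "cyc p1 a b" "cyc p1 b c" "cyc p1 c d" "cyc p1 d p2"
    and e: "e \<in> (M \<union> {{b, c}, {d, a}}) \<union> (N \<union> {{a, b}, {c, d}})"
  obtains x y where "e = {x, y}" "x \<in> V" "y \<in> V" | x y where "e = {x, y}" "x \<in> {a, b, c, d}" "y \<in> {a, b, c, d}"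
proof -
  have "pm V M" "pm V N" using g unfolding ladder_inv_def by blast+
  then show thesis using e that pm_edge[of V M e] pm_edge[of V N e] by blast
qed

text \<open>A quadrilateral at w would occupy the second \<open>N\<close>-side of p1 p2 p3 p4.
  Exchanging the \<open>M\<close>-sides of the latter for its \<open>N\<close>-sides creates two
  common edges with \<open>N\<close>. Splicing p1 p2 with the side d a of the attached quadrilateral
  removes one of them; the other, p3 p4, is visible from w.\<close>

lemma spliceable_double:
  assumes g: "ladder_inv V M N p1 p2 p3 p4" and q: "cyc p1 a b" "cyc p1 b c" "cyc p1 c d" "cyc p1 d p2"
    and w: "cyc p3 w p4"
  shows "spliceable (V \<union> {a, b, c, d}) (N \<union> {{a, b}, {c, d}}) w"
proof -
  have M: "pm V M" and N: "pm V N" and MN: "compat M N" and dMN: "M \<inter> N = {}" and cp: "cyc p1 p2 p3" "cyc p1 p3 p4"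
    and pe: "{p1, p4} \<in> M" "{p2, p3} \<in> M" "{p1, p2} \<in> N" "{p3, p4} \<in> N"
    and gap: "\<And>x. x \<in> V \<Longrightarrow> \<not> cyc p1 x p2" "\<And>x. x \<in> V \<Longrightarrow> \<not> cyc p3 x p4"
    using g unfolding ladder_inv_def by (simp_all add: insert_commute)
  have B: "block V {a, b, c, d} a d" by (rule ladder_inv_block[OF g q])
  have qc: "cyc a b c" "cyc a c d" using q by (smt (verit) cyc_ax)+
  have Y: "pm {a, b, c, d} {{b, c}, {d, a}}" and N1: "pm {a, b, c, d} {{a, b}, {c, d}}"
    and YN: "compat {{b, c}, {d, a}} {{a, b}, {c, d}}" and dYN: "{{b, c}, {d, a}} \<inter> {{a, b}, {c, d}} = {}"
    by (rule ladder_inv_basic[OF quad_ladder_inv[OF qc]])+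
  let ?X = "M - {{p1, p4}, {p2, p3}} \<union> {{p1, p2}, {p3, p4}}"
  have X: "pm V ?X"
  proof (rule switch[OF M pe(1,2) cp])
    fix e assume "e \<in> M"
    then show "\<not> crosses {p1, p2} e \<and> \<not> crosses {p3, p4} e"
      using MN pe(3,4) crosses_sym unfolding compat_def by blast
  qed
  have XN: "compat ?X N" unfolding compat_def
  proof (intro ballI)
    fix e f assume "e \<in> ?X" and f: "f \<in> N"
    then have "e \<in> M \<or> e = {p1, p2} \<or> e = {p3, p4}" by blast
    then show "\<not> crosses e f" using f MN pm_nc[OF N pe(3) f] pm_nc[OF N pe(4) f] unfolding compat_def by metis
  qed
  have vis: "\<not> crosses {p1, a} e \<and> \<not> crosses {a, p2} e" if e: "e \<in> ?X \<union> N" for e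
  proof -
    obtain x y where "x \<in> V" "y \<in> V" "e = {x, y}" by (rule pm_edge2[OF X N e])
    moreover have "cyc p1 a p2" using q by (smt (verit) cyc_ax)
    ultimately show ?thesis using gap_visible[OF gap(1)] by blast
  qed
  have ad: "{a, d} \<in> {{b, c}, {d, a}}" by (simp add: insert_commute)
  have p12: "{p1, p2} \<in> ?X" by blast
  obtain X' x where X': "pm (V \<union> {a, b, c, d}) X'" "compat X' (N \<union> {{a, b}, {c, d}})"
    "?X - {{p1, p2}} \<subseteq> X'"
    "X' \<inter> (N \<union> {{a, b}, {c, d}}) \<subseteq> (?X \<inter> N - {{p1, p2}}) \<union> ({{b, c}, {d, a}} \<inter> {{a, b}, {c, d}} - {{a, d}})"
    by (rule splice[OF B X Y ad N N1 XN YN p12 vis])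
  have "{p3, p4} \<noteq> {p1, p2}" using cp by (smt (verit) cyc_neq doubleton_eq_iff)
  then have p34: "{p3, p4} \<in> X'" using X'(3) by blast
  have "?X \<inter> N - {{p1, p2}} \<subseteq> {{p3, p4}}" using dMN by blast
  moreover have "X' \<inter> (N \<union> {{a, b}, {c, d}}) \<subseteq> ?X \<inter> N - {{p1, p2}}"
    using X'(4) unfolding dYN by (simp only: empty_Diff Un_empty_right)
  ultimately have sub: "X' \<inter> (N \<union> {{a, b}, {c, d}}) \<subseteq> {{p3, p4}}" by (meson order_trans)
  have N': "pm (V \<union> {a, b, c, d}) (N \<union> {{a, b}, {c, d}})"
    using ladder_inv_step[OF g q] unfolding ladder_inv_def by blast
  have gap': "\<not> cyc p3 x p4" if "x \<in> V \<union> {a, b, c, d}" for x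
  proof (cases "x \<in> V")
    case False
    then have "cyc p1 x p2" using that q by (elim UnE insertE emptyE) (smt (verit) cyc_ax)+
    then show ?thesis using cp by (smt (verit) cyc_ax)
  qed (use gap in blast)
  show ?thesis by (rule spliceable_gap[OF X'(1) N' X'(2) p34 sub gap' w])
qed

text \<open>Outside the two gaps where the chain may grow, w sees an \<open>M\<close>-side of the
  last quadrilateral, or it lies at the free \<open>N\<close>-side of the one before, or the visible
  edge comes from the shorter ladder and the last quadrilateral is covered by its own
  \<open>M\<close>-sides.\<close>

lemma ladder_spliceable:
  "ladder V M N f p1 p2 p3 p4 \<Longrightarrow> w \<notin> V \<Longrightarrow> \<not> cyc p1 w p2 \<Longrightarrow> \<not> cyc p3 w p4 \<Longrightarrow> spliceable V N w"
proof (induction rule: ladder.induct)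
  case (base a b c d)
  note g = ladder_inv_basic[OF quad_ladder_inv[OF base(1,2)]]
  have p: "pm {a, b, c, d} {{b, c}, {d, a}}" "pm {a, b, c, d} {{a, b}, {c, d}}"
    "compat {{b, c}, {d, a}} {{a, b}, {c, d}}" "{{b, c}, {d, a}} \<inter> {{a, b}, {c, d}} \<subseteq> {e}" for e
    by (rule g | (subst g, rule empty_subsetI))+
  have gap: "\<not> cyc b x c \<and> \<not> cyc d x a" if "x \<in> {a, b, c, d}" for x
    using that base(1,2) by (elim insertE emptyE) (smt (verit) cyc_ax)+
  have "w \<noteq> a" "w \<noteq> b" "w \<noteq> c" "w \<noteq> d" using base(3) by blast+
  then have "cyc b w c \<or> cyc d w a" using base(1,2,4,5) by (smt (verit) cyc_ax)
  then show ?case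
  proof
    assume w: "cyc b w c"
    show ?thesis by (rule spliceable_gap[OF p(1-3) _ p(4) _ w]) (use gap in auto)
  next
    assume w: "cyc d w a"
    show ?thesis by (rule spliceable_gap[OF p(1-3) _ p(4) _ w]) (use gap in auto)
  qed
next
  case (step V M N f p1 p2 p3 p4 a b c d)
  note g = ladder_imp_inv[OF step.hyps(1)] and q = step.hyps(3-6)
  let ?W = "V \<union> {a, b, c, d}" and ?M = "M \<union> {{b, c}, {d, a}}" and ?N = "N \<union> {{a, b}, {c, d}}"
  note g' = ladder_inv_step[OF g q]
  have p: "pm ?W ?M" "pm ?W ?N" "compat ?M ?N" "?M \<inter> ?N \<subseteq> {e}" for e
    by (rule ladder_inv_basic[OF g'] | (subst ladder_inv_basic(4)[OF g'], rule empty_subsetI))+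
  have qc: "cyc a b c" "cyc a c d" "cyc b c d" "cyc b d a" using q by (smt (verit) cyc_ax)+
  have B: "block V {a, b, c, d} a d" by (rule ladder_inv_block[OF g q])
  have ne: "w \<noteq> a" "w \<noteq> b" "w \<noteq> c" "w \<noteq> d" "w \<notin> V" using step.prems(1) by blast+
  have pV: "p1 \<in> V" "p2 \<in> V" using ladder_inv_mem[OF g] by auto
  have gap: "\<not> cyc p1 x p2" if "x \<in> V" for x using g that unfolding ladder_inv_def by blast
  consider "cyc b w c" | "cyc p1 w p2" "\<not> cyc b w c" | "\<not> cyc p1 w p2" "cyc p3 w p4"
    | "\<not> cyc p1 w p2" "\<not> cyc p3 w p4" by blast
  then show ?case
  proof cases
    case 1
    have "\<not> cyc b x c" if "x \<in> ?W" for x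
    proof (cases "x \<in> V")
      case True
      then have "cyc x b c" using block_first[OF B True, of b] block_last[OF B True, of c]
          block_first[OF B True, of c] block_last[OF B True, of b] qc by (smt (verit) cyc_ax insertCI)
      then show ?thesis using cyc_asym cyc_rot by blast
    next
      case False
      then have "x \<in> {a, b, c, d}" using that by blast
      then show ?thesis using qc by (elim insertE emptyE) (smt (verit) cyc_ax)+
    qed
    then show ?thesis by (intro spliceable_gap[OF p(1-3) _ p(4) _ 1]) auto
  next
    case 2
    \<comment> \<open>Here w lies between the last quadrilateral and the one before it, and sees the
      side a d.\<close>
    have w: "cyc p1 w a \<or> cyc d w p2" using 2 q ne step.prems by (smt (verit) cyc_ax)
    have "\<not> crosses {a, w} e \<and> \<not> crosses {w, d} e" if e: "e \<in> ?M \<union> ?N" for e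
      using g q e
    proof (cases rule: quad_split)
      case (1 x y)
      then show ?thesis using gap[of x] gap[of y] w q unfolding 1(1) crosses_iff by (smt (verit) cyc_ax)
    next
      case (2 x y)
      have *: "cyc a z d \<or> z = a \<or> z = d" if "z \<in> {a, b, c, d}" for z
        using that qc by (elim insertE emptyE) (smt (verit) cyc_ax)+
      have "cyc w a d" using w q by (smt (verit) cyc_ax)
      then show ?thesis using *[OF 2(2)] *[OF 2(3)] unfolding 2(1) crosses_iff by (smt (verit) cyc_ax)
    qed
    note vis = this
    have ad: "{a, d} \<in> ?M" by (simp add: insert_commute)
    show ?thesis by (rule spliceableI[OF p(1,3) ad p(4) vis])
  next
    case 3
    then show ?thesis using spliceable_double[OF g q] by blast
  next
    case 4
    then obtain X s t where X: "pm V X" "compat X N" "{s, t} \<in> X" "X \<inter> N \<subseteq> {{s, t}}"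
      and vis: "\<And>e. e \<in> X \<union> N \<Longrightarrow> \<not> crosses {s, w} e \<and> \<not> crosses {w, t} e"
      using step.IH ne(5) unfolding spliceable_def by blast
    have V: "s \<in> V" "t \<in> V" using pm_edgeD[OF X(1,3)] by auto
    have Y: "pm {a, b, c, d} {{b, c}, {d, a}}" and N1: "pm {a, b, c, d} {{a, b}, {c, d}}"
      and YN: "compat {{b, c}, {d, a}} {{a, b}, {c, d}}" and dYN: "{{b, c}, {d, a}} \<inter> {{a, b}, {c, d}} = {}"
      by (rule ladder_inv_basic[OF quad_ladder_inv[OF qc(1,2)]])+
    have N: "pm V N" using g unfolding ladder_inv_def by blast
    have dj: "V \<inter> {a, b, c, d} = {}" using B unfolding block_def by blast
    let ?X = "X \<union> {{b, c}, {d, a}}"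
    have X': "pm ?W ?X" by (rule pm_Un[OF X(1) Y dj block_compat[OF B X(1) Y]])
    have cX': "compat ?X ?N"
    proof -
      have "compat {{b, c}, {d, a}} N" using block_compat[OF B N Y] compat_sym by blast
      then show ?thesis using X(2) YN block_compat[OF B X(1) N1] unfolding compat_def by (metis UnE)
    qed
    have "e \<inter> {a, b, c, d} = {}" if "e \<in> X \<union> N" for e
      using that pm_edge[OF X(1), of e] pm_edge[OF N, of e] dj by blast
    then have "X \<inter> {{a, b}, {c, d}} = {}" "{{b, c}, {d, a}} \<inter> N = {}" by blast+
    then have i: "?X \<inter> ?N \<subseteq> {{s, t}}" using X(4) dYN by (simp only: Int_Un_distrib Int_Un_distrib2) simp
    \<comment> \<open>Counting w among the outer points puts the whole quadrilateral on one side of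
      each of the sight lines s w and w t.\<close>
    have B': "block (insert w V) {a, b, c, d} a d"
      by (rule gap_block[OF _ _ _ q]) (use pV gap 4 in auto)
    have vis': "\<not> crosses {s, w} e \<and> \<not> crosses {w, t} e" if "e \<in> ?X \<union> ?N" for e
    proof (cases "e \<in> X \<union> N")
      case True then show ?thesis by (rule vis)
    next
      case False
      then have "e \<in> {{b, c}, {d, a}} \<union> {{a, b}, {c, d}}" using that by blast
      then obtain i j where i: "i \<in> {a, b, c, d}" "j \<in> {a, b, c, d}" "e = {i, j}" by blast
      have "cyc x i w \<longleftrightarrow> cyc x j w" "cyc w i x \<longleftrightarrow> cyc w j x" if "x \<in> V" for x
        using block_clone[OF B', of x w] block_clone[OF B', of w x] that i by blast+
      then show ?thesis unfolding i(3) crosses_iff using V by (metis cyc_rot cyc_asym)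
    qed
    have st: "{s, t} \<in> ?X" using X(3) by blast
    show ?thesis by (rule spliceableI[OF X' cX' st i vis'])
  qed
qed auto

section \<open>Ears\<close>

definition closed_in :: "nat set set \<Rightarrow> nat set \<Rightarrow> bool" where
  "closed_in X I \<longleftrightarrow> (\<forall>x y. {x, y} \<in> X \<longrightarrow> x \<in> I \<longrightarrow> y \<in> I)"

lemma closed_inD: "closed_in X I \<Longrightarrow> {x, y} \<in> X \<Longrightarrow> x \<in> I \<Longrightarrow> y \<in> I"
  unfolding closed_in_def by blast

lemma pm_even:
  assumes fin: "finite V" and X: "pm V X"
  shows "even (card V)"
proof -
  have V: "\<Union>X = V"
  proof
    show "\<Union>X \<subseteq> V" using pm_edge[OF X] by blast
    show "V \<subseteq> \<Union>X" using pm_ex[OF X] by blast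
  qed
  have "2 dvd card (\<Union>X)"
  proof (rule dvd_partition)
    show "finite (\<Union>X)" using V fin by simp
    show "\<forall>e\<in>X. 2 dvd card e" using pm_edge[OF X] by fastforce
    show "\<forall>e\<in>X. \<forall>f\<in>X. e \<noteq> f \<longrightarrow> e \<inter> f = {}"
    proof (intro ballI impI)
      fix e f assume e: "e \<in> X" and f: "f \<in> X" and ne: "e \<noteq> f"
      show "e \<inter> f = {}"
      proof (rule ccontr)
        assume "e \<inter> f \<noteq> {}"
        then obtain x where x: "x \<in> e" "x \<in> f" by blast
        obtain y where y: "e = {x, y}" using pm_edge[OF X e] x by auto
        obtain z where z: "f = {x, z}" using pm_edge[OF X f] x by auto
        show False using pm_uniq[OF X, of x y z] e f ne y z by simp
      qed
    qed
  qed
  then show ?thesis using V by simp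
qed

lemma pm_closed:
  assumes X: "pm V X" and I: "I \<subseteq> V" and cl: "closed_in X I"
  shows "pm I {e \<in> X. e \<subseteq> I}" "pm (V - I) {e \<in> X. e \<subseteq> V - I}"
    "X = {e \<in> X. e \<subseteq> V - I} \<union> {e \<in> X. e \<subseteq> I}"
proof -
  show 1: "pm I {e \<in> X. e \<subseteq> I}" by (rule pm_restrict[OF X I closed_inD[OF cl]])
  have "(V - I) \<union> I = V" "(V - I) \<inter> I = {}" using I by blast+
  then show "pm (V - I) {e \<in> X. e \<subseteq> V - I}" "X = {e \<in> X. e \<subseteq> V - I} \<union> {e \<in> X. e \<subseteq> I}"
    using pm_split[of "V - I" I X "{e \<in> X. e \<subseteq> I}"] X 1 by auto
qed

lemma cyc_between: "x < y \<Longrightarrow> cyc x z y \<longleftrightarrow> x < z \<and> z < y"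
  unfolding cyc_def by linarith

text \<open>Let B consist of the points strictly between x and y. Since \<open>M\<close> matches B
  within itself, B is even, and \<open>N\<close>-edges leave B at most to x or y. If neither x nor y
  has its \<open>N\<close>-partner in B, then B is a smaller closed interval. If exactly one has,
  \<open>N\<close> matches an odd set. If both have, B with x and y is closed, and by minimality it
  is all of \<open>I\<close>.\<close>

lemma min_interval_edge:
  assumes fin: "finite V" and M: "pm V M" and N: "pm V N" and MN: "compat M N" and dj: "M \<inter> N = {}"
    and I: "I = {z \<in> V. lo \<le> z \<and> z \<le> hi}" and cM: "closed_in M I"
    and minI: "\<And>J l h. J \<noteq> {} \<Longrightarrow> J = {z \<in> V. l \<le> z \<and> z \<le> h} \<Longrightarrow> closed_in M J \<Longrightarrow> closed_in N J \<Longrightarrow>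
      card I \<le> card J"
    and xy: "{x, y} \<in> M" "x \<in> I" "x < y"
    and inner: "\<exists>z\<in>V. x < z \<and> z < y"
  shows "I = {z \<in> V. x \<le> z \<and> z \<le> y}"
proof -
  define B where "B = {z \<in> V. x < z \<and> z < y}"
  have B0: "B \<noteq> {}" using inner unfolding B_def by blast
  have yI: "y \<in> I" using closed_inD[OF cM xy(1,2)] .
  have finI: "finite I" using fin I by simp
  have BI: "B \<subseteq> I" "x \<in> I - B" using xy(2) yI unfolding B_def I by auto
  have finB: "finite B" using BI finI finite_subset by blast
  have BM: "z' \<in> B" if "{z, z'} \<in> M" "z \<in> B" for z z'
  proof -
    have "cyc x z y" using that(2) cyc_between[OF xy(3)] unfolding B_def by blast
    from pm_trap[OF M xy(1) that(1) this] show ?thesis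
      using cyc_between[OF xy(3)] pm_edgeD[OF M that(1)] unfolding B_def by blast
  qed
  have BN: "z' = x \<or> z' = y \<or> z' \<in> B" if "{z, z'} \<in> N" "z \<in> B" for z z'
  proof -
    have "cyc x z y" using that(2) cyc_between[OF xy(3)] unfolding B_def by blast
    moreover have "\<not> crosses {x, y} {z, z'}" using MN xy(1) that(1) unfolding compat_def by blast
    ultimately show ?thesis
      using nc_trap cyc_between[OF xy(3)] pm_edgeD[OF N that(1)] unfolding B_def by blast
  qed
  have V: "x \<in> V" "y \<in> V" using pm_edgeD[OF M xy(1)] by auto
  obtain x' where x': "{x, x'} \<in> N" "x' \<noteq> x" using pm_ex[OF N V(1)] by blast
  obtain y' where y': "{y, y'} \<in> N" "y' \<noteq> y" using pm_ex[OF N V(2)] by blast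
  have evB: "even (card B)"
  proof (rule pm_even[OF finB])
    show "pm B {e \<in> M. e \<subseteq> B}" by (rule pm_restrict[OF M _ BM]) (auto simp: B_def)
  qed
  have odd1: False if u: "u \<in> V" "u \<notin> B" and cl: "\<And>z z'. {z, z'} \<in> N \<Longrightarrow> z \<in> insert u B \<Longrightarrow> z' \<in> insert u B" for u
  proof -
    have "pm (insert u B) {e \<in> N. e \<subseteq> insert u B}"
      by (rule pm_restrict[OF N _ cl]) (use u in \<open>auto simp: B_def\<close>)
    from pm_even[OF _ this] have "even (card (insert u B))" using finB by simp
    then show False using evB u finB by simp
  qed
  have xN: "x' = z" if "{z, x} \<in> N" for z using that x'(1) pm_uniq[OF N] by (metis insert_commute)
  have yN: "y' = z" if "{z, y} \<in> N" for z using that y'(1) pm_uniq[OF N] by (metis insert_commute)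
  consider "x' \<notin> B" "y' \<notin> B" | "x' \<in> B" "y' \<notin> B" | "x' \<notin> B" "y' \<in> B" | "x' \<in> B" "y' \<in> B" by blast
  then show "I = {z \<in> V. x \<le> z \<and> z \<le> y}"
  proof cases
    case 1
    \<comment> \<open>The open interval is rewritten as a closed one, the form that
      \<open>minI\<close> accepts; x < y makes y - 1 a true predecessor.\<close>
    have "B = {z \<in> V. Suc x \<le> z \<and> z \<le> y - 1}" using xy(3) unfolding B_def by auto
    moreover have "closed_in M B" using BM unfolding closed_in_def by blast
    moreover have "closed_in N B" unfolding closed_in_def using BN xN yN 1 by blast
    ultimately have "card I \<le> card B" using minI[OF B0] by blast
    moreover have "card B < card I" using BI psubset_card_mono[OF finI, of B] by blast
    ultimately show ?thesis by simp
  next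
    case 2
    have False
    proof (rule odd1[of x])
      fix z z' assume z: "{z, z'} \<in> N" "z \<in> insert x B"
      show "z' \<in> insert x B"
      proof (cases "z = x")
        case True then show ?thesis using pm_uniq[OF N x'(1)] z(1) 2 by blast
      next
        case False then show ?thesis using BN[OF z(1)] z yN 2 by blast
      qed
    qed (use V BI in auto)
    then show ?thesis ..
  next
    case 3
    have False
    proof (rule odd1[of y])
      fix z z' assume z: "{z, z'} \<in> N" "z \<in> insert y B"
      show "z' \<in> insert y B"
      proof (cases "z = y")
        case True then show ?thesis using pm_uniq[OF N y'(1)] z(1) 3 by blast
      next
        case False then show ?thesis using BN[OF z(1)] z xN 3 by blast
      qed
    qed (use V in \<open>auto simp: B_def\<close>)
    then show ?thesis ..
  next
    case 4
    let ?J = "{z \<in> V. x \<le> z \<and> z \<le> y}"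
    have J: "z \<in> ?J \<longleftrightarrow> z = x \<or> z = y \<or> z \<in> B" for z using V xy(3) unfolding B_def by auto
    have 1: "closed_in M ?J" unfolding closed_in_def
    proof (intro allI impI)
      fix z z' assume z: "{z, z'} \<in> M" "z \<in> ?J"
      have "{y, x} \<in> M" using xy(1) by (simp add: insert_commute)
      then show "z' \<in> ?J" using z BM[OF z(1)] pm_uniq[OF M z(1)] xy(1) unfolding J by blast
    qed
    have 2: "closed_in N ?J" unfolding closed_in_def
    proof (intro allI impI)
      fix z z' assume z: "{z, z'} \<in> N" "z \<in> ?J"
      then show "z' \<in> ?J" using BN[OF z(1)] pm_uniq[OF N z(1)] x'(1) y'(1) 4 unfolding J by blast
    qed
    have "x \<in> ?J" using V xy by simp
    then have "card I \<le> card ?J" using minI[OF _ refl 1 2] by blast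
    moreover have "?J \<subseteq> I" using xy(2) yI unfolding I by auto
    ultimately show ?thesis using card_seteq[OF finI] by blast
  qed
qed

text \<open>The points \<open>c 0 < \<dots> < c (n - 1)\<close> are consecutive in \<open>V\<close>, and they are the corners of a
convex polygon whose sides belong alternately to \<open>N\<close> and \<open>M\<close>.\<close>

definition ear :: "nat set \<Rightarrow> nat set set \<Rightarrow> nat set set \<Rightarrow> (nat \<Rightarrow> nat) \<Rightarrow> nat \<Rightarrow> bool" where
  "ear V M N c n \<longleftrightarrow> 4 \<le> n \<and> even n \<and> (\<forall>i j. i < j \<longrightarrow> j < n \<longrightarrow> c i < c j) \<and> c ` {..<n} \<subseteq> V \<and>
     (\<forall>x\<in>V. c 0 \<le> x \<longrightarrow> x \<le> c (n - 1) \<longrightarrow> x \<in> c ` {..<n}) \<and> {c 0, c (n - 1)} \<in> M \<and>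
     (\<forall>i. Suc i < n \<longrightarrow> {c i, c (Suc i)} \<in> (if even i then N else M))"

text \<open>A smallest nonempty interval closed under both matchings works. Apart from the outermost
  pair its edges join neighbours in the order, so along the interval the two matchings alternate.
  The matching that contains the first side decides which of the two alternatives holds.\<close>

lemma ear_exists:
  assumes fin: "finite V" and ne: "V \<noteq> {}" and M: "pm V M" and N: "pm V N" and MN: "compat M N"
    and dj: "M \<inter> N = {}"
  obtains c n where "ear V M N c n \<or> ear V N M c n"
proof -
  define P where "P I \<longleftrightarrow> I \<noteq> {} \<and> (\<exists>l h. I = {z \<in> V. l \<le> z \<and> z \<le> h}) \<and> closed_in M I \<and> closed_in N I" for I
  have "P V" unfolding P_def
  proof (intro conjI exI)
    show "V = {z \<in> V. 0 \<le> z \<and> z \<le> Max V}" using fin by auto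
    show "closed_in M V" "closed_in N V" unfolding closed_in_def using pm_edgeD M N by blast+
  qed (rule ne)
  from ex_has_least_nat[of P, OF this, of card]
  obtain I where PI: "P I" and least: "\<And>J. P J \<Longrightarrow> card I \<le> card J" by blast
  obtain lo hi where I: "I = {z \<in> V. lo \<le> z \<and> z \<le> hi}" using PI unfolding P_def by blast
  have I0: "I \<noteq> {}" and cM: "closed_in M I" and cN: "closed_in N I" using PI unfolding P_def by blast+
  have finI: "finite I" and IV: "I \<subseteq> V" using fin I by auto
  have NM: "compat N M" "N \<inter> M = {}" using MN dj compat_sym by auto
  have edge: "(\<forall>z\<in>V. \<not> (x < z \<and> z < y)) \<or> I = {z \<in> V. x \<le> z \<and> z \<le> y}"
    if xy: "{x, y} \<in> M \<union> N" "x \<in> I" "x < y" for x y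
    using xy(1)
  proof
    assume e: "{x, y} \<in> M"
    have "I = {z \<in> V. x \<le> z \<and> z \<le> y}" if "\<exists>z\<in>V. x < z \<and> z < y"
      by (rule min_interval_edge[OF fin M N MN dj I cM _ e xy(2,3) that]) (rule least, auto simp: P_def)
    then show ?thesis by blast
  next
    assume e: "{x, y} \<in> N"
    have "I = {z \<in> V. x \<le> z \<and> z \<le> y}" if "\<exists>z\<in>V. x < z \<and> z < y"
      by (rule min_interval_edge[OF fin N M NM I cN _ e xy(2,3) that]) (rule least, auto simp: P_def)
    then show ?thesis by blast
  qed
  define n where "n = card I"
  define c where "c i = sorted_list_of_set I ! i" for i
  have len: "length (sorted_list_of_set I) = n" unfolding n_def by simp
  have mono: "c i < c j" if "i < j" "j < n" for i j
    using that len sorted_wrt_nth_less[OF strict_sorted_list_of_set, of i j I] unfolding c_def by simp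
  have "c ` {..<n} = set (take n (sorted_list_of_set I))"
    unfolding c_def lessThan_atLeast0 using len by (intro nth_image) simp
  then have cI: "c ` {..<n} = I" using len finI by simp
  have inj: "i = j" if "c i = c j" "i < n" "j < n" for i j
    using that mono by (metis nat_neq_iff)
  have ev: "even n"
    unfolding n_def using pm_even[OF finI pm_closed(1)[OF M IV cM]] .
  have n0: "0 < n" using I0 finI unfolding n_def by (simp add: card_gt_0_iff)
  have mono': "c i \<le> c j \<longleftrightarrow> i \<le> j" if "i < n" "j < n" for i j
    using mono that by (metis leD leI le_eq_less_or_eq)
  have adj: "j = Suc i \<or> i = 0 \<and> j = n - 1" if e: "{c i, c j} \<in> M \<union> N" "i < j" "j < n" for i j
  proof -
    have i: "c i \<in> I" "i < n" using cI e by auto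
    from edge[OF e(1) i(1) mono[OF e(2,3)]] show ?thesis
    proof
      assume *: "\<forall>z\<in>V. \<not> (c i < z \<and> z < c j)"
      show ?thesis
      proof (rule ccontr)
        assume "\<not> ?thesis"
        then have j: "Suc i < j" using e(2) by simp
        then have "c (Suc i) \<in> V" using cI IV e(3) by auto
        then show False using * mono[of i "Suc i"] mono[OF j e(3)] j e(3) by simp
      qed
    next
      assume *: "I = {z \<in> V. c i \<le> z \<and> z \<le> c j}"
      have "c 0 \<in> I" "c (n - 1) \<in> I" using cI n0 by auto
      then have "c i \<le> c 0" "c (n - 1) \<le> c j" using * by auto
      then have "i = 0" "n - 1 \<le> j" using mono'[of i 0] mono'[of "n - 1" j] n0 i(2) e(3) by simp_all
      then show ?thesis using e(3) by linarith
    qed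
  qed
  have partner: "\<exists>j<n. {c i, c j} \<in> X \<and> j \<noteq> i" if X: "pm V X" "closed_in X I" and i: "i < n" for X i
  proof -
    have ciI: "c i \<in> I" using cI i by auto
    obtain q where q: "{c i, q} \<in> X" "q \<noteq> c i" using pm_ex[OF X(1), of "c i"] ciI IV by blast
    then have "q \<in> I" using closed_inD[OF X(2)] ciI by blast
    then show ?thesis using q cI by blast
  qed
  have ear: "ear V A B c n" if A: "pm V A" "closed_in A I" and B: "pm V B" "closed_in B I"
    and AB: "A \<inter> B = {}" "A \<union> B = M \<union> N" and e01: "{c 0, c 1} \<in> B" and n2: "2 < n" for A B
  proof -
    have inA: "x \<in> M \<union> N" if "x \<in> A" for x using AB(2) that by blast
    have inB: "x \<in> M \<union> N" if "x \<in> B" for x using AB(2) that by blast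
    have n4: "4 \<le> n" using n2 ev by presburger
    have step: "{c (Suc i), c (Suc (Suc i))} \<in> Y"
      if XY: "pm V Y" "closed_in Y I" "X \<inter> Y = {}" "Y \<subseteq> M \<union> N" and e: "{c i, c (Suc i)} \<in> X"
        and i: "Suc (Suc i) < n" for X Y i
    proof -
      obtain j where j: "j < n" "{c (Suc i), c j} \<in> Y" "j \<noteq> Suc i" using partner[OF XY(1,2), of "Suc i"] i by auto
      have e': "{c j, c (Suc i)} \<in> Y" using j(2) by (simp add: insert_commute)
      have "j \<noteq> i" using e e' XY(3) by blast
      moreover have "j < Suc i \<Longrightarrow> Suc i = Suc j \<or> j = 0 \<and> Suc i = n - 1"
        using adj[OF subsetD[OF XY(4) e']] i by simp
      moreover have "Suc i < j \<Longrightarrow> j = Suc (Suc i)" using adj[OF subsetD[OF XY(4) j(2)]] j(1) by simp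
      ultimately have "j = Suc (Suc i)" using j(3) i by linarith
      then show ?thesis using j(2) by simp
    qed
    have alt: "Suc i < n \<Longrightarrow> {c i, c (Suc i)} \<in> (if even i then B else A)" for i
    proof (induction i)
      case 0 then show ?case using e01 by simp
    next
      case (Suc i)
      have BA: "B \<inter> A = {}" using AB(1) by blast
      show ?case
      proof (cases "even i")
        case True
        have "{c i, c (Suc i)} \<in> B" using Suc True by simp
        then show ?thesis using step[OF A BA _ _ Suc.prems] True inA by auto
      next
        case False
        have "{c i, c (Suc i)} \<in> A" using Suc False by simp
        then show ?thesis using step[OF B AB(1) _ _ Suc.prems] False inB by auto
      qed
    qed
    have "{c 0, c (n - 1)} \<in> A"
    proof -
      obtain j where j: "j < n" "{c 0, c j} \<in> A" "j \<noteq> 0" using partner[OF A n0] by blast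
      have "j \<noteq> Suc 0" using j(2) e01 AB(1) by auto
      then have "j = n - 1" using adj[of 0 j] j inA by blast
      then show ?thesis using j(2) by simp
    qed
    moreover have "x \<in> c ` {..<n}" if "x \<in> V" "c 0 \<le> x" "x \<le> c (n - 1)" for x
    proof -
      have "c 0 \<in> I" "c (n - 1) \<in> I" using cI n0 by auto
      then show ?thesis using that unfolding cI unfolding I by auto
    qed
    ultimately show ?thesis unfolding ear_def using n4 ev mono cI IV alt by simp
  qed
  \<comment> \<open>The two partners of the first point are distinct, hence they are its successor
    and the last point of the interval, and there are more than two points.\<close>
  obtain j where j: "j < n" "{c 0, c j} \<in> M" "j \<noteq> 0" using partner[OF M cM n0] by blast
  obtain k where k: "k < n" "{c 0, c k} \<in> N" "k \<noteq> 0" using partner[OF N cN n0] by blast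
  have jk: "j \<noteq> k" using j k dj by blast
  have "j = 1 \<or> j = n - 1" "k = 1 \<or> k = n - 1" using adj[of 0 j] adj[of 0 k] j k by auto
  moreover have "2 < n" using j k jk by linarith
  ultimately have "{c 0, c 1} \<in> N \<or> {c 0, c 1} \<in> M" using j k jk by auto
  then show thesis
  proof
    assume "{c 0, c 1} \<in> N"
    then show thesis using ear[OF M cM N cN dj refl] \<open>2 < n\<close> that by blast
  next
    assume "{c 0, c 1} \<in> M"
    then show thesis using ear[OF N cN M cM NM(2) Un_commute] \<open>2 < n\<close> that by blast
  qed
qed

section \<open>An edge visible from a point outside the matchings\<close>

lemma cyc_pred:
  assumes fin: "finite V" and ne: "V \<noteq> {}" and w: "w \<notin> V"
  obtains u where "u \<in> V" "\<forall>x\<in>V. \<not> cyc u x w"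
proof (cases "\<exists>x\<in>V. x < w")
  case True
  let ?S = "{x \<in> V. x < w}"
  have S: "finite ?S" "?S \<noteq> {}" using fin True by auto
  have u: "Max ?S \<in> ?S" by (rule Max_in[OF S])
  have "\<not> cyc (Max ?S) x w" if "x \<in> V" for x
  proof
    assume "cyc (Max ?S) x w"
    then have "Max ?S < x" "x < w" using u unfolding cyc_def by auto
    moreover from this have "x \<le> Max ?S" using Max_ge[OF S(1), of x] that by blast
    ultimately show False by linarith
  qed
  then show thesis using that u by blast
next
  case False
  have u: "Max V \<in> V" by (rule Max_in[OF fin ne])
  have "\<not> cyc (Max V) x w" if x: "x \<in> V" for x
    using Max_ge[OF fin x] False x u w unfolding cyc_def by (metis leD not_less_iff_gr_or_eq less_trans)
  then show thesis using that u by blast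
qed

text \<open>Take for u the last point before w, and for t the first of the partners of u met after
  it. An edge hiding t from w would cross u t or end at u, and in the second case it would give an
  earlier partner of u.\<close>

lemma visible_edge:
  assumes fin: "finite V" and ne: "V \<noteq> {}" and w: "w \<notin> V" and M: "pm V M" and N: "pm V N"
    and MN: "compat M N"
  obtains s t where "{s, t} \<in> M \<union> N" "\<forall>e\<in>M \<union> N. \<not> crosses {s, w} e \<and> \<not> crosses {w, t} e"
proof -
  obtain u where u: "u \<in> V" and pred': "\<forall>x\<in>V. \<not> cyc u x w" by (rule cyc_pred[OF fin ne w])
  note pred = pred'[rule_format]
  obtain x where x: "{u, x} \<in> M" "x \<in> V" "x \<noteq> u" using pm_ex[OF M u] .
  obtain y where y: "{u, y} \<in> N" "y \<in> V" "y \<noteq> u" using pm_ex[OF N u] .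
  obtain t where t: "{u, t} \<in> M \<union> N" "\<not> cyc u x t" "\<not> cyc u y t"
  proof (cases "cyc u x y")
    case True
    then have "\<not> cyc u x x" "\<not> cyc u y x" using cyc_ax by blast+
    then show thesis using that[of x] x by blast
  next
    case False
    have "\<not> cyc u y y" using cyc_neq by blast
    then show thesis using that[of y] y False by blast
  qed
  have first: "\<not> cyc u z t" if "{u, z} \<in> M \<union> N" for z
    using that t pm_uniq[OF M x(1), of z] pm_uniq[OF N y(1), of z] by blast
  have nc: "\<not> crosses e f" if "e \<in> M \<union> N" "f \<in> M \<union> N" for e f
    using that pm_nc[OF M, of e f] pm_nc[OF N, of e f] MN crosses_sym[of e f] unfolding compat_def by blast
  have tV: "t \<in> V" using t(1) pm_edgeD[OF M, of u t] pm_edgeD[OF N, of u t] by blast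
  have uw: "u \<noteq> w" "t \<noteq> w" using u w tV by auto
  have key: "\<not> (cyc w y t \<and> cyc t z w)" if yz: "{y, z} \<in> M \<union> N" "y \<in> V" "z \<in> V" for y z
  proof
    assume c: "cyc w y t \<and> cyc t z w"
    show False
    proof (cases "z = u")
      case True
      then have "cyc u y t" using c by (smt (verit) cyc_ax)
      then show False using first[of y] yz(1) True by (simp add: insert_commute)
    next
      case False
      have "cyc u y t" "cyc t z u" using c False pred[OF yz(3)] pred[OF tV] pred[OF yz(2)] uw
        by (smt (verit) cyc_ax)+
      then have "crosses {u, t} {y, z}" unfolding crosses_iff by blast
      then show False using nc[OF t(1) yz(1)] by blast
    qed
  qed
  have "\<not> crosses {u, w} e \<and> \<not> crosses {w, t} e" if e: "e \<in> M \<union> N" for e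
  proof -
    obtain y z where yz: "y \<in> V" "z \<in> V" "e = {y, z}" by (rule pm_edge2[OF M N e])
    have "\<not> (cyc w y t \<and> cyc t z w)" "\<not> (cyc w z t \<and> cyc t y w)"
      using key[of y z] key[of z y] e yz by (simp_all add: insert_commute)
    then show ?thesis using pred[OF yz(1)] pred[OF yz(2)] unfolding yz(3) crosses_iff by blast
  qed
  then show thesis using that t(1) by blast
qed

section \<open>Mutually unique neighbours form a ladder\<close>

definition mutual :: "nat set \<Rightarrow> nat set set \<Rightarrow> nat set set \<Rightarrow> bool" where
  "mutual V M N \<longleftrightarrow> pm V M \<and> pm V N \<and> compat M N \<and> M \<inter> N = {} \<and> only_nbr V M N \<and> only_nbr V N M"

lemma mutual_sym: "mutual V M N \<Longrightarrow> mutual V N M"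
  unfolding mutual_def using compat_sym by blast

lemma only_nbrD: "only_nbr V M N \<Longrightarrow> pm V X \<Longrightarrow> compat X M \<Longrightarrow> X \<inter> M = {} \<Longrightarrow> X = N"
  unfolding only_nbr_def by blast

lemma residue_empty: "Z \<subseteq> (A - P) \<union> (B - Q) \<Longrightarrow> A \<subseteq> P \<Longrightarrow> B \<subseteq> Q \<Longrightarrow> Z = {}"
  by blast

lemma Un_disj4:
  "A \<inter> C = {} \<Longrightarrow> A \<inter> D = {} \<Longrightarrow> B \<inter> C = {} \<Longrightarrow> B \<inter> D = {} \<Longrightarrow> (A \<union> B) \<inter> (C \<union> D) = {}"
  by (simp only: Int_Un_distrib Int_Un_distrib2 Un_empty_left)

lemma pm_disj: "pm V X \<Longrightarrow> pm I Y \<Longrightarrow> V \<inter> I = {} \<Longrightarrow> X \<inter> Y = {}"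
  using pm_edge[of V X] pm_edgeD[of I Y] by blast

lemma compat_Un: "compat A C \<Longrightarrow> compat A D \<Longrightarrow> compat B C \<Longrightarrow> compat B D \<Longrightarrow> compat (A \<union> B) (C \<union> D)"
  unfolding compat_def by (metis UnE)

text \<open>A neighbour of \<open>M0\<close> on the smaller set is completed by \<open>N1\<close> to
  a neighbour of \<open>M\<close>, and uniqueness there determines it.\<close>

lemma only_nbr_remove:
  assumes on: "only_nbr V M N" and split: "V = V0 \<union> I" "V0 \<inter> I = {}" "M = M0 \<union> M1" "N = N0 \<union> N1"
    and B: "block V0 I b c" and M: "pm V0 M0" "pm I M1" and N: "pm V0 N0" "pm I N1"
    and c1: "compat N1 M1" "N1 \<inter> M1 = {}"
  shows "only_nbr V0 M0 N0"
  unfolding only_nbr_def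
proof (intro allI impI)
  fix X assume X: "pm V0 X" "compat X M0" "X \<inter> M0 = {}"
  have 1: "pm V (X \<union> N1)" unfolding split(1) by (rule pm_Un[OF X(1) N(2) split(2) block_compat[OF B X(1) N(2)]])
  have "compat N1 M0" using block_compat[OF B M(1) N(2)] compat_sym by blast
  then have 2: "compat (X \<union> N1) M" unfolding split(3)
    by (intro compat_Un X(2) c1(1) block_compat[OF B X(1) M(2)])
  have "N1 \<inter> M0 = {}" using pm_disj[OF M(1) N(2) split(2)] by blast
  then have "(X \<union> N1) \<inter> M = {}" unfolding split(3)
    by (intro Un_disj4 X(3) c1(2) pm_disj[OF X(1) M(2) split(2)])
  from only_nbrD[OF on 1 2 this] have e: "X \<union> N1 = N0 \<union> N1" using split(4) by simp
  have "X \<inter> N1 = {}" "N0 \<inter> N1 = {}" using pm_disj[OF X(1) N(2) split(2)] pm_disj[OF N split(2)] by blast+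
  then show "X = N0" using e by blast
qed

section \<open>An ear in a pair of mutually unique neighbours\<close>

context
  fixes V :: "nat set" and M N :: "nat set set" and c :: "nat \<Rightarrow> nat" and n :: nat
  assumes fin: "finite V" and mut: "mutual V M N" and ear: "ear V M N c n"
begin

lemma ear_mutual: "pm V M" "pm V N" "compat M N" "M \<inter> N = {}" "only_nbr V M N" "only_nbr V N M"
  using mut unfolding mutual_def by blast+

lemma ear_facts: "4 \<le> n" "even n" "\<And>i j. i < j \<Longrightarrow> j < n \<Longrightarrow> c i < c j" "c ` {..<n} \<subseteq> V"
  "\<And>x. x \<in> V \<Longrightarrow> c 0 \<le> x \<Longrightarrow> x \<le> c (n - 1) \<Longrightarrow> x \<in> c ` {..<n}" "{c 0, c (n - 1)} \<in> M"
  "\<And>i. Suc i < n \<Longrightarrow> even i \<Longrightarrow> {c i, c (Suc i)} \<in> N" "\<And>i. Suc i < n \<Longrightarrow> odd i \<Longrightarrow> {c i, c (Suc i)} \<in> M"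
proof -
  have *: "Suc i < n \<Longrightarrow> {c i, c (Suc i)} \<in> (if even i then N else M)" for i
    using ear unfolding ear_def by blast
  show "Suc i < n \<Longrightarrow> even i \<Longrightarrow> {c i, c (Suc i)} \<in> N" "Suc i < n \<Longrightarrow> odd i \<Longrightarrow> {c i, c (Suc i)} \<in> M" for i
    using *[of i] by simp_all
qed (use ear in \<open>unfold ear_def, blast\<close>)+

lemma ear_le: "i \<le> j \<Longrightarrow> j < n \<Longrightarrow> c i \<le> c j"
  using ear_facts(3)[of i j] by (cases "i = j") auto

lemma ear_inj: "c i = c j \<Longrightarrow> i < n \<Longrightarrow> j < n \<Longrightarrow> i = j"
  using ear_facts(3)[of i j] ear_facts(3)[of j i] by (metis nat_neq_iff less_irrefl)

text \<open>Both edges at a corner are sides of the polygon already, so the ear is a whole component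
  of the union of \<open>M\<close> and \<open>N\<close>.\<close>

lemma ear_edge:
  assumes e: "{c k, y} \<in> M \<union> N" and k: "k < n"
  shows "\<exists>j<n. y = c j \<and> (j = Suc k \<or> k = Suc j \<or> k = 0 \<and> j = n - 1 \<or> k = n - 1 \<and> j = 0)"
proof -
  have pred: "{c (Suc i), c i} \<in> N \<or> odd i" "{c (Suc i), c i} \<in> M \<or> even i" if "Suc i < n" for i
    using ear_facts(7,8)[OF that] by (auto simp: insert_commute)
  have last: "{c (n - 1), c 0} \<in> M" using ear_facts(6) by (simp add: insert_commute)
  from e show ?thesis
  proof
    assume e: "{c k, y} \<in> M"
    consider "k = 0" | i where "k = Suc i" "odd i" | "odd k" "Suc k < n" | "odd k" "k = n - 1"
      using k by (cases k) (auto, fastforce)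
    then show ?thesis
    proof cases
      case 1
      then have "y = c (n - 1)" using pm_uniq[OF ear_mutual(1) e, of "c (n - 1)"] ear_facts(6) by simp
      then show ?thesis using 1 k by (intro exI[of _ "n - 1"]) simp
    next
      case 2
      then have "y = c i" using pm_uniq[OF ear_mutual(1) e, of "c i"] pred(2)[of i] k by simp
      then show ?thesis using 2 k by (intro exI[of _ i]) simp
    next
      case 3
      then have "y = c (Suc k)" using pm_uniq[OF ear_mutual(1) e, of "c (Suc k)"] ear_facts(8)[of k] by simp
      then show ?thesis using 3 by (intro exI[of _ "Suc k"]) simp
    next
      case 4
      then have "y = c 0" using pm_uniq[OF ear_mutual(1) e, of "c 0"] last by simp
      then show ?thesis using 4 k by (intro exI[of _ 0]) simp
    qed
  next
    assume e: "{c k, y} \<in> N"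
    have "even k \<Longrightarrow> Suc k < n" using k ear_facts(2) by presburger
    then consider i where "k = Suc i" "even i" | "even k" "Suc k < n" by (metis even_Suc oddE Suc_eq_plus1)
    then show ?thesis
    proof cases
      case 1
      then have "y = c i" using pm_uniq[OF ear_mutual(2) e, of "c i"] pred(1)[of i] k by simp
      then show ?thesis using 1 k by (intro exI[of _ i]) simp
    next
      case 2
      then have "y = c (Suc k)" using pm_uniq[OF ear_mutual(2) e, of "c (Suc k)"] ear_facts(7)[of k] by simp
      then show ?thesis using 2 by (intro exI[of _ "Suc k"]) simp
    qed
  qed
qed

text \<open>A point strictly between two corners is itself a corner, and its edges lead to adjacent
  corners, hence not beyond the given two. So all diagonals of the ear are available for
  exchanges.\<close>

lemma ear_nc_less:
  assumes e: "{x, y} \<in> M \<union> N" and ij: "i < j" "j < n"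
  shows "\<not> (cyc (c i) x (c j) \<and> cyc (c j) y (c i))"
proof
  assume a: "cyc (c i) x (c j) \<and> cyc (c j) y (c i)"
  have lt: "c i < c j" using ear_facts(3) ij by blast
  have x: "c i < x" "x < c j" using a cyc_between[OF lt] by blast+
  have "x \<in> V" using e pm_edgeD[OF ear_mutual(1), of x y] pm_edgeD[OF ear_mutual(2), of x y] by blast
  moreover have "c 0 \<le> x" "x \<le> c (n - 1)" using x ear_le[of 0 i] ear_le[of j "n - 1"] ij by linarith+
  ultimately obtain k where k: "k < n" "x = c k" using ear_facts(5) by blast
  have ik: "i < k" "k < j" using x k ear_le[of k i] ear_le[of j k] ij by (metis leD leI less_trans)+
  obtain l where l: "l < n" "y = c l" "l = Suc k \<or> k = Suc l"
    using ear_edge[of k y] e k ik ij by auto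
  have "c i \<le> y" "y \<le> c j" using l ik ear_le[of i l] ear_le[of l j] ij by auto
  then show False using a lt unfolding cyc_def by linarith
qed

lemma ear_nc:
  assumes e: "e \<in> M \<union> N" and ij: "i < n" "j < n"
  shows "\<not> crosses {c i, c j} e"
proof -
  obtain x y where xy: "e = {x, y}" by (rule pm_edge2[OF ear_mutual(1,2) e])
  have e': "{x, y} \<in> M \<union> N" "{y, x} \<in> M \<union> N" using e xy by (simp_all add: insert_commute)
  consider "i < j" | "i = j" | "j < i" by linarith
  then show ?thesis
  proof cases
    case 1
    then show ?thesis using ear_nc_less[OF e'(1) 1 ij(2)] ear_nc_less[OF e'(2) 1 ij(2)]
      unfolding xy crosses_iff by blast
  next
    case 2
    then show ?thesis unfolding xy crosses_iff using cyc_neq by blast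
  next
    case 3
    then show ?thesis using ear_nc_less[OF e'(1) 3 ij(1)] ear_nc_less[OF e'(2) 3 ij(1)]
      unfolding xy crosses_iff by blast
  qed
qed

lemma ear_cyc: "i < j \<Longrightarrow> j < k \<Longrightarrow> k < n \<Longrightarrow> cyc (c i) (c j) (c k)"
  using ear_facts(3)[of i j] ear_facts(3)[of j k] unfolding cyc_def by auto

text \<open>Exchanging two \<open>M\<close>-sides for c 0 c 3 and c 4 c (n - 1) gives
  \<open>N\<close> a second neighbour, provided that neither new edge is in \<open>N\<close>. This
  is where eight corners come from: for six, c 4 c (n - 1) would be the \<open>N\<close>-side c 4 c
  5.\<close>

lemma ear_small: "n < 8"
proof (rule ccontr)
  assume "\<not> n < 8"
  then have n: "8 \<le> n" by simp
  let ?X = "M - {{c 0, c (n - 1)}, {c 3, c 4}} \<union> {{c 0, c 3}, {c 4, c (n - 1)}}"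
  have e34: "{c 3, c 4} \<in> M" using ear_facts(8)[of 3] n by simp
  have nc: "\<not> crosses {c 0, c 3} e \<and> \<not> crosses {c 4, c (n - 1)} e" if "e \<in> M \<union> N" for e
    using ear_nc[OF that] n by simp
  have X: "pm V ?X"
    by (rule switch[OF ear_mutual(1) ear_facts(6) e34 ear_cyc ear_cyc nc]) (use n in auto)
  have "compat ?X N" unfolding compat_def
  proof (intro ballI)
    fix e f assume "e \<in> ?X" and f: "f \<in> N"
    then have "e \<in> M \<or> e = {c 0, c 3} \<or> e = {c 4, c (n - 1)}" by blast
    then show "\<not> crosses e f" using ear_mutual(3) f nc[of f] unfolding compat_def by (metis UnI2)
  qed
  moreover have "{c 0, c 3} \<notin> N" "{c 4, c (n - 1)} \<notin> N"
    using pm_uniq[OF ear_mutual(2), of "c 0" "c 3" "c (Suc 0)"] pm_uniq[OF ear_mutual(2), of "c 4" "c (n - 1)" "c (Suc 4)"]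
      ear_facts(7)[of 0] ear_facts(7)[of 4] ear_inj[of 3 "Suc 0"] ear_inj[of "n - 1" "Suc 4"] n by auto
  then have "?X \<inter> N = {}" using ear_mutual(4) by blast
  ultimately have "?X = M" using only_nbrD[OF ear_mutual(6) X] by blast
  then have "{c 0, c 3} \<in> M" by blast
  then have "c 3 = c (n - 1)" using pm_uniq[OF ear_mutual(1)] ear_facts(6) by blast
  then show False using ear_inj[of 3 "n - 1"] n by simp
qed

abbreviation "I \<equiv> c ` {..<n}"
abbreviation "V0 \<equiv> V - I"
abbreviation "rest X \<equiv> {e \<in> X. e \<subseteq> V0}"
abbreviation "inner X \<equiv> {e \<in> X. e \<subseteq> I}"

lemma ear_closed: "closed_in M I" "closed_in N I"
  unfolding closed_in_def using ear_edge by blast+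

lemmas split_M = pm_closed[OF ear_mutual(1) ear_facts(4) ear_closed(1)]
lemmas split_N = pm_closed[OF ear_mutual(2) ear_facts(4) ear_closed(2)]

lemma V_split: "V = V0 \<union> I" "V0 \<inter> I = {}" using ear_facts(4) by blast+

lemma ear_block: "block V0 I (c 0) (c (n - 1))"
proof -
  have I: "c 0 \<le> i \<and> i \<le> c (n - 1)" if "i \<in> I" for i
    using that ear_le[of 0] ear_le[of _ "n - 1"] by fastforce
  have V0: "x < c 0 \<or> c (n - 1) < x" if "x \<in> V0" for x using that ear_facts(5)[of x] by force
  have 1: "cyc x j y" if "x \<in> V0" "y \<in> V0" "i \<in> I" "j \<in> I" "cyc x i y" for x y i j
    using I[OF that(3)] I[OF that(4)] V0[OF that(1)] V0[OF that(2)] that(5) unfolding cyc_def by linarith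
  have 2: "cyc x (c 0) i" if "x \<in> V0" "i \<in> I" "i \<noteq> c 0" for x i
    using I[OF that(2)] V0[OF that(1)] that(3) unfolding cyc_def by linarith
  have 3: "cyc x i (c (n - 1))" if "x \<in> V0" "i \<in> I" "i \<noteq> c (n - 1)" for x i
    using I[OF that(2)] V0[OF that(1)] that(3) unfolding cyc_def by linarith
  have "c 0 \<in> I" "c (n - 1) \<in> I" using ear_facts(1) by auto
  then show ?thesis unfolding block_def using V_split(2) 1 2 3 by (intro conjI ballI impI)
qed

text \<open>The ear is opened at its \<open>M\<close>-side facing the rest, and the possible common
  edge s t is opened with it. The result shares nothing with \<open>N\<close> but joins the ear to
  the rest, unlike \<open>M\<close>. The lemma serves twice: with \<open>X\<close> the rest of
  \<open>M\<close>, and with \<open>X\<close> from \<open>spliceable\<close>.\<close>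

lemma no_splice_M:
  assumes X: "pm V0 X" "compat X (rest N)" and st: "{s, t} \<in> X" "X \<inter> rest N \<subseteq> {{s, t}}"
    and vis: "\<And>e. e \<in> X \<union> rest N \<Longrightarrow> \<not> crosses {s, c 0} e \<and> \<not> crosses {c 0, t} e"
  shows False
proof -
  have in1: "{c 0, c (n - 1)} \<in> inner M" using ear_facts(1,6) by auto
  have cYN: "compat (inner M) (inner N)" by (rule compat_sub[OF ear_mutual(3)]) auto
  obtain X' x where X': "pm (V0 \<union> I) X'" "compat X' (rest N \<union> inner N)" "x \<in> V0" "{x, c 0} \<in> X'"
    "X' \<inter> (rest N \<union> inner N) \<subseteq> (X \<inter> rest N - {{s, t}}) \<union> (inner M \<inter> inner N - {{c 0, c (n - 1)}})"
    by (rule splice[OF ear_block X(1) split_M(1) in1 split_N(2,1) X(2) cYN st(1) vis])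
  have "inner M \<inter> inner N = {}" using ear_mutual(4) by blast
  then have "inner M \<inter> inner N \<subseteq> {{c 0, c (n - 1)}}" by (simp only: empty_subsetI)
  from residue_empty[OF X'(5) st(2) this] have "X' \<inter> (rest N \<union> inner N) = {}" .
  then have "X' = M" using only_nbrD[OF ear_mutual(6), of X'] X'(1,2) V_split(1) split_N(3) by metis
  then have "{c 0, x} \<in> M" using X'(4) by (simp add: insert_commute)
  then have "x \<in> I" using closed_inD[OF ear_closed(1)] ear_facts(1) by auto
  then show False using X'(3) by blast
qed

text \<open>As s t is in \<open>N\<close>, a second neighbour of \<open>M\<close> is built, and the
  ear has to be opened at its \<open>M\<close>-side c 5 c 0. An exchange of two
  \<open>N\<close>-sides produces this side together with the diagonal c 1 c 4, which is not in
  \<open>M\<close>; the splice then removes the only common edge. In a quadrilateral the same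
  exchange would produce two \<open>M\<close>-sides.\<close>

lemma no_splice_hexagon:
  assumes n: "n = 6" and st: "{s, t} \<in> rest N"
    and vis: "\<And>e. e \<in> rest N \<union> rest M \<Longrightarrow> \<not> crosses {s, c 0} e \<and> \<not> crosses {c 0, t} e"
  shows False
proof -
  let ?Y = "inner N - {{c 1, c 0}, {c 4, c 5}} \<union> {{c 1, c 4}, {c 5, c 0}}"
  have ci: "c i \<in> I" if "i < n" for i using that by blast
  have e10: "{c 1, c 0} \<in> inner N" using ear_facts(7)[of 0] ci[of 0] ci[of 1] n by (simp add: insert_commute)
  have e45: "{c 4, c 5} \<in> inner N" using ear_facts(7)[of 4] ci[of 4] ci[of 5] n by simp
  have nc: "\<not> crosses {c 1, c 4} e \<and> \<not> crosses {c 5, c 0} e" if "e \<in> M \<union> N" for e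
    using ear_nc[OF that] n by simp
  have nc': "\<not> crosses {c 1, c 4} e \<and> \<not> crosses {c 5, c 0} e" if "e \<in> inner N" for e
    using nc[of e] that by blast
  have cy: "cyc (c 1) (c 4) (c 5)" "cyc (c 1) (c 5) (c 0)"
    using ear_cyc[of 1 4 5] ear_cyc[of 0 1 5] n cyc_rot by auto
  have Y: "pm I ?Y" by (rule switch[OF split_N(1) e10 e45 cy nc'])
  have in1: "{c 0, c (n - 1)} \<in> ?Y" using n by (simp add: insert_commute)
  have cY: "compat ?Y (inner M)" unfolding compat_def
  proof (intro ballI)
    fix e f assume "e \<in> ?Y" and f: "f \<in> inner M"
    then have e: "e \<in> N \<or> e = {c 1, c 4} \<or> e = {c 5, c 0}" by blast
    have fM: "f \<in> M" using f by blast
    show "\<not> crosses e f" using e ear_mutual(3) fM crosses_sym nc[of f] unfolding compat_def by (metis UnI1)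
  qed
  have cX: "compat (rest N) (rest M)" by (rule compat_sub[OF compat_sym[THEN iffD1, OF ear_mutual(3)]]) auto
  obtain X' x where X': "pm (V0 \<union> I) X'" "compat X' (rest M \<union> inner M)" "x \<in> V0" "{x, c 0} \<in> X'"
    "X' \<inter> (rest M \<union> inner M) \<subseteq> (rest N \<inter> rest M - {{s, t}}) \<union> (?Y \<inter> inner M - {{c 0, c (n - 1)}})"
    by (rule splice[OF ear_block split_N(2) Y in1 split_M(2,1) cX cY st vis])
  have "{c 1, c 4} \<notin> M"
    using pm_uniq[OF ear_mutual(1), of "c 1" "c 4" "c 2"] ear_facts(8)[of 1] ear_inj[of 4 2] n by (auto simp: numeral_2_eq_2)
  moreover have "{c 5, c 0} = {c 0, c (n - 1)}" using n by (simp add: insert_commute)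
  ultimately have 1: "?Y \<inter> inner M \<subseteq> {{c 0, c (n - 1)}}" using ear_mutual(4) by blast
  have 2: "rest N \<inter> rest M \<subseteq> {{s, t}}" using ear_mutual(4) by blast
  from residue_empty[OF X'(5) 2 1] have "X' \<inter> (rest M \<union> inner M) = {}" .
  then have "X' = N" using only_nbrD[OF ear_mutual(5), of X'] X'(1,2) V_split(1) split_M(3) by metis
  then have "{c 0, x} \<in> N" using X'(4) by (simp add: insert_commute)
  then have "x \<in> I" using closed_inD[OF ear_closed(2)] ear_facts(1) by auto
  then show False using X'(3) by blast
qed

text \<open>Since 4 divides \<open>card V\<close>, a hexagon cannot be everything. So some edge of
  the rest is visible from c 0, and it leads to a contradiction whichever matching it belongs
  to.\<close>

lemma ear_quad: assumes dvd: "4 dvd card V" shows "n = 4"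
proof (rule ccontr)
  assume "n \<noteq> 4"
  then have n: "n = 6" using ear_small ear_facts(1,2) by presburger
  have "card I = 6" using n ear_inj by (subst card_image) (auto simp: inj_on_def)
  then have "V \<noteq> I" using dvd by auto
  then have ne: "V0 \<noteq> {}" using V_split by blast
  have fin0: "finite V0" using fin by blast
  have c0: "c 0 \<notin> V0" using n by simp
  have cp: "compat (rest M) (rest N)" by (rule compat_sub[OF ear_mutual(3)]) auto
  obtain s t where st: "{s, t} \<in> rest M \<union> rest N"
    and vis': "\<forall>e\<in>rest M \<union> rest N. \<not> crosses {s, c 0} e \<and> \<not> crosses {c 0, t} e"
    by (rule visible_edge[OF fin0 ne c0 split_M(2) split_N(2) cp])
  note vis = vis'[rule_format]
  from st show False
  proof
    assume 1: "{s, t} \<in> rest M"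
    have "rest M \<inter> rest N \<subseteq> {{s, t}}" using ear_mutual(4) by blast
    then show False using no_splice_M[OF split_M(2) cp 1 _ vis] by blast
  next
    assume 1: "{s, t} \<in> rest N"
    show False by (rule no_splice_hexagon[OF n 1 vis]) blast
  qed
qed

text \<open>Without the ear the two matchings are again unique neighbours of each other, hence form
  a ladder. The ear faces it with an \<open>M\<close>-side and extends it if it lies in an end gap;
  at any other position \<open>ladder_spliceable\<close> provides the matching that
  \<open>no_splice_M\<close> refutes.\<close>

lemma ear_ladder:
  assumes dvd: "4 dvd card V"
    and IH: "\<And>A B. V0 \<noteq> {} \<Longrightarrow> 4 dvd card V0 \<Longrightarrow> card V0 < card V \<Longrightarrow> mutual V0 A B \<Longrightarrow>
      \<exists>f p1 p2 p3 p4. ladder V0 A B f p1 p2 p3 p4"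
  shows "\<exists>f p1 p2 p3 p4. ladder V M N f p1 p2 p3 p4"
proof -
  have n: "n = 4" by (rule ear_quad[OF dvd])
  have In: "I = {c 0, c 1, c 2, c 3}" unfolding n by (auto simp: numeral_eq_Suc lessThan_Suc)
  have cy: "cyc (c 0) (c 1) (c 2)" "cyc (c 0) (c 2) (c 3)" using ear_cyc n by auto
  have M1: "{c 1, c 2} \<in> M" "{c 3, c 0} \<in> M" using ear_facts(6) ear_facts(8)[of 1] n
    by (simp_all add: insert_commute numeral_2_eq_2)
  have N1: "{c 0, c 1} \<in> N" "{c 2, c 3} \<in> N" using ear_facts(7)[of 0] ear_facts(7)[of 2] n
    by (simp_all add: numeral_3_eq_3)
  note Q = ladder_inv_basic[OF quad_ladder_inv[OF cy]]
  have eM: "inner M = {{c 1, c 2}, {c 3, c 0}}"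
    by (rule pm_sub_eq[OF split_M(1)]) (use Q(1) In M1 in auto)
  have eN: "inner N = {{c 0, c 1}, {c 2, c 3}}"
    by (rule pm_sub_eq[OF split_N(1)]) (use Q(2) In N1 in auto)
  show ?thesis
  proof (cases "V0 = {}")
    case True
    then have "V = I" using ear_facts(4) by blast
    then have V: "V = {c 0, c 1, c 2, c 3}" using In by (rule trans)
    have R: "rest M = {}" "rest N = {}"
      using pm_edge[OF split_M(2)] pm_edge[OF split_N(2)] unfolding True by blast+
    have "rest M \<union> inner M = {{c 1, c 2}, {c 3, c 0}}" "rest N \<union> inner N = {{c 0, c 1}, {c 2, c 3}}"
      by (simp_all only: R eM eN Un_empty_left)
    with split_M(3) split_N(3) have "M = {{c 1, c 2}, {c 3, c 0}}" "N = {{c 0, c 1}, {c 2, c 3}}"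
      by (metis (no_types, lifting))+
    with V show ?thesis using ladder.base[OF cy] by metis
  next
    case False
    have cN: "compat (rest M) (rest N)" "compat (inner N) (inner M)" "compat (inner M) (inner N)"
      by (rule compat_sub[OF ear_mutual(3)] compat_sub[OF compat_sym[THEN iffD1, OF ear_mutual(3)]]; blast)+
    have dN: "rest M \<inter> rest N = {}" "inner N \<inter> inner M = {}" "inner M \<inter> inner N = {}" using ear_mutual(4) by blast+
    have on1: "only_nbr V0 (rest M) (rest N)"
      by (rule only_nbr_remove[OF ear_mutual(5) V_split split_M(3) split_N(3) ear_block split_M(2,1) split_N(2,1) cN(2) dN(2)])
    have on2: "only_nbr V0 (rest N) (rest M)"
      by (rule only_nbr_remove[OF ear_mutual(6) V_split split_N(3) split_M(3) ear_block split_N(2,1) split_M(2,1) cN(3) dN(3)])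
    have mut0: "mutual V0 (rest M) (rest N)"
      unfolding mutual_def using split_M(2) split_N(2) cN(1) dN(1) on1 on2 by blast
    have "card I = 4" using n ear_inj by (subst card_image) (auto simp: inj_on_def)
    then have cV: "card V = card V0 + 4"
      using card_Un_disjoint[of V0 I] V_split fin by (metis finite_Diff finite_imageI finite_lessThan)
    then have "4 dvd card V0" "card V0 < card V" using dvd by auto
    from IH[OF False this mut0] obtain f p1 p2 p3 p4
      where L: "ladder V0 (rest M) (rest N) f p1 p2 p3 p4" by blast
    have c0: "c 0 \<notin> V0" using n by simp
    have VM: "V = V0 \<union> {c 0, c 1, c 2, c 3}" "M = rest M \<union> {{c 1, c 2}, {c 3, c 0}}"
      "N = rest N \<union> {{c 0, c 1}, {c 2, c 3}}"
      using V_split(1) In split_M(3) split_N(3) eM eN by simp_all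
    \<comment> \<open>The whole ear lies in the gap as soon as c 0 does, because it is a
      block.\<close>
    have ins: "\<exists>f p1 p2 p3 p4. ladder V M N f p1 p2 p3 p4"
      if L: "ladder V0 (rest M) (rest N) f p1 p2 p3 p4" and w: "cyc p1 (c 0) p2" for p1 p2 p3 p4
    proof -
      have p: "p1 \<in> V0" "p2 \<in> V0" using ladder_inv_mem[OF ladder_imp_inv[OF L]] by auto
      have "cyc p1 (c 3) p2" using block_clone[OF ear_block p _ _ w] In by blast
      moreover have "cyc p1 (c 0) (c 1)" using block_first[OF ear_block p(1), of "c 1"] In ear_inj[of 1 0] n by auto
      ultimately have "cyc p1 (c 0) (c 1)" "cyc p1 (c 1) (c 2)" "cyc p1 (c 2) (c 3)" "cyc p1 (c 3) p2"
        using cy block_last[OF ear_block p(1), of "c 2"] block_last[OF ear_block p(1), of "c 1"] In ear_inj[of 2 3] ear_inj[of 1 3] n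
          block_first[OF ear_block p(1), of "c 2"]
        by (auto, smt (verit) cyc_ax)
      from ladder.step[OF L _ this] show ?thesis using VM V_split(2) In by metis
    qed
    consider "cyc p1 (c 0) p2" | "cyc p3 (c 0) p4" | "\<not> cyc p1 (c 0) p2" "\<not> cyc p3 (c 0) p4" by blast
    then show ?thesis
    proof cases
      case 1 then show ?thesis by (rule ins[OF L])
    next
      case 2 then show ?thesis by (rule ins[OF ladder.swap_end[OF L]])
    next
      case 3
      from ladder_spliceable[OF L c0 this] obtain X s t where X: "pm V0 X" "compat X (rest N)" "{s, t} \<in> X"
        "X \<inter> rest N \<subseteq> {{s, t}}"
        and vis: "\<And>e. e \<in> X \<union> rest N \<Longrightarrow> \<not> crosses {s, c 0} e \<and> \<not> crosses {c 0, t} e"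
        unfolding spliceable_def by meson
      show ?thesis using no_splice_M[OF X vis] by blast
    qed
  qed
qed

end

text \<open>If the ear faces the rest with an \<open>N\<close>-side, the ladder is found for the
  exchanged pair and then reversed.\<close>

lemma mutual_ladder:
  "finite V \<Longrightarrow> V \<noteq> {} \<Longrightarrow> 4 dvd card V \<Longrightarrow> mutual V M N \<Longrightarrow> \<exists>f p1 p2 p3 p4. ladder V M N f p1 p2 p3 p4"
proof (induction "card V" arbitrary: V M N rule: less_induct)
  case less
  have fin0: "finite (V - J)" for J using less.prems(1) by blast
  have m: "pm V M" "pm V N" "compat M N" "M \<inter> N = {}" using less.prems(4) unfolding mutual_def by blast+
  obtain c n where "ear V M N c n \<or> ear V N M c n" by (rule ear_exists[OF less.prems(1,2) m])
  then show ?case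
  proof
    assume e: "ear V M N c n"
    show ?thesis
      by (rule ear_ladder[OF less.prems(1,4) e less.prems(3)]) (use less.hyps fin0 in blast)
  next
    assume e: "ear V N M c n"
    have "\<exists>f p1 p2 p3 p4. ladder V N M f p1 p2 p3 p4"
      by (rule ear_ladder[OF less.prems(1) mutual_sym[OF less.prems(4)] e less.prems(3)])
        (use less.hyps fin0 in blast)
    then obtain f p1 p2 p3 p4 where "ladder V N M f p1 p2 p3 p4" by blast
    moreover obtain f1 f2 f3 f4 where "f = (f1, f2, f3, f4)" by (cases f)
    ultimately have "ladder V M N (p2, p3, p4, p1) f2 f3 f4 f1" using ladder_reverse by fastforce
    then show ?thesis by blast
  qed
qed

section \<open>Dual trees\<close>

text \<open>An arc is named by the point where it starts, so a counts and b does not. This is the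
  rotation-invariant substitute for \<open>chord_side\<close>, which depends on the order of the
  labels.\<close>

definition inarc :: "nat \<Rightarrow> nat \<Rightarrow> nat \<Rightarrow> bool" where
  "inarc a b i \<longleftrightarrow> i = a \<or> cyc a i b"

lemma separates_iff:
  assumes "a \<noteq> b"
  shows "separates {a, b} i j \<longleftrightarrow> inarc a b i \<noteq> inarc a b j"
proof -
  have "chord_side {a, b} x \<longleftrightarrow> inarc a b x" if "a < b" for x
    using that unfolding chord_side_def inarc_def cyc_def by auto
  moreover have "chord_side {a, b} x \<longleftrightarrow> \<not> inarc a b x" if "b < a" for x
    using that unfolding chord_side_def inarc_def cyc_def by auto
  ultimately show ?thesis using assms unfolding separates_def by (metis nat_neq_iff)
qed

text \<open>Its cardinality is the distance of the two regions in the dual tree.\<close>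

definition separators :: "nat set set \<Rightarrow> nat \<Rightarrow> nat \<Rightarrow> nat set set" where
  "separators M i j = {e \<in> M. separates e i j}"

lemma separators_sym: "separators M i j = separators M j i"
  unfolding separators_def separates_def by auto

lemma separators_same [simp]: "separators M i i = {}"
  unfolding separators_def separates_def by auto

lemma separators_Un: "separators (A \<union> B) i j = separators A i j \<union> separators B i j"
  unfolding separators_def by auto

lemma separators_empty_left: "separators M i i' = {} \<Longrightarrow> separators M i j = separators M i' j"
  unfolding separators_def separates_def by blast

lemma separators_empty_right: "separators M j j' = {} \<Longrightarrow> separators M i j = separators M i j'"
  using separators_empty_left separators_sym by metis

text \<open>A \<^term>\<open>g\<close> as below sends an arc to the vertex of its region: dual tree isomorphisms
are the same as such labellings of the arcs.\<close>

definition labelling :: "nat set \<Rightarrow> nat set set \<Rightarrow> nat \<Rightarrow> (nat \<Rightarrow> nat + nat) \<Rightarrow> bool" where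
  "labelling V M l g \<longleftrightarrow> g ` V = db_verts l \<and> (\<forall>i\<in>V. \<forall>j\<in>V. (separators M i j = {} \<longleftrightarrow> g i = g j) \<and>
     (card (separators M i j) = 1 \<longleftrightarrow> db_adj l (g i) (g j)))"

lemma labelling_eq: "labelling V M l g \<Longrightarrow> i \<in> V \<Longrightarrow> j \<in> V \<Longrightarrow> separators M i j = {} \<longleftrightarrow> g i = g j"
  unfolding labelling_def by blast

lemma labelling_adj: "labelling V M l g \<Longrightarrow> i \<in> V \<Longrightarrow> j \<in> V \<Longrightarrow> card (separators M i j) = 1 \<longleftrightarrow> db_adj l (g i) (g j)"
  unfolding labelling_def by blast

text \<open>In the direction from labellings, the image of a region is read off at an arc chosen in
  it; the choice does not matter, as labels agree exactly within regions.\<close>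

lemma graph_iso_labelling:
  "graph_iso (regions k M) (dual_adj M) (db_verts l) (db_adj l) \<longleftrightarrow> (\<exists>g. labelling {0..<2 * k} M l g)"
proof -
  let ?V = "{0..<2 * k}"
  define cl where "cl i = {j \<in> ?V. separators M i j = {}}" for i
  have R: "regions k M = cl ` ?V" unfolding regions_def cl_def separators_def by auto
  have self: "i \<in> cl i" if "i \<in> ?V" for i using that unfolding cl_def by simp
  have cl_eq: "cl i = cl j \<longleftrightarrow> separators M i j = {}" if "i \<in> ?V" "j \<in> ?V" for i j
  proof
    assume "cl i = cl j"
    then have "j \<in> cl i" using self[OF that(2)] by simp
    then show "separators M i j = {}" unfolding cl_def by simp
  next
    assume "separators M i j = {}"
    then show "cl i = cl j" using separators_empty_left unfolding cl_def by metis
  qed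
  have adj: "dual_adj M (cl i) (cl j) \<longleftrightarrow> card (separators M i j) = 1" if "i \<in> ?V" "j \<in> ?V" for i j
  proof
    assume "dual_adj M (cl i) (cl j)"
    then obtain i' j' where "separators M i i' = {}" "separators M j j' = {}" "card (separators M i' j') = 1"
      unfolding dual_adj_def separators_def[symmetric] unfolding cl_def by blast
    then show "card (separators M i j) = 1" using separators_empty_left separators_empty_right by metis
  next
    assume "card (separators M i j) = 1"
    then show "dual_adj M (cl i) (cl j)"
      unfolding dual_adj_def separators_def[symmetric] using self that by blast
  qed
  show ?thesis
  proof
    assume "graph_iso (regions k M) (dual_adj M) (db_verts l) (db_adj l)"
    then obtain f where f: "bij_betw f (cl ` ?V) (db_verts l)"
      "\<forall>x\<in>cl ` ?V. \<forall>y\<in>cl ` ?V. dual_adj M x y \<longleftrightarrow> db_adj l (f x) (f y)"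
      unfolding graph_iso_def R by blast
    have inj: "f (cl i) = f (cl j) \<longleftrightarrow> cl i = cl j" if "i \<in> ?V" "j \<in> ?V" for i j
      using inj_on_eq_iff[OF bij_betw_imp_inj_on[OF f(1)]] that by simp
    have "labelling ?V M l (\<lambda>i. f (cl i))"
      unfolding labelling_def
    proof (intro conjI ballI)
      show "(\<lambda>i. f (cl i)) ` ?V = db_verts l" using f(1) unfolding bij_betw_def image_image by blast
    next
      fix i j assume ij: "i \<in> ?V" "j \<in> ?V"
      show "separators M i j = {} \<longleftrightarrow> f (cl i) = f (cl j)" using inj[OF ij] cl_eq[OF ij] by blast
      show "card (separators M i j) = 1 \<longleftrightarrow> db_adj l (f (cl i)) (f (cl j))"
        using f(2)[rule_format, of "cl i" "cl j"] adj[OF ij] ij by simp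
    qed
    then show "\<exists>g. labelling ?V M l g" by blast
  next
    assume "\<exists>g. labelling ?V M l g"
    then obtain g where g: "labelling ?V M l g" by blast
    define f where "f S = g (SOME i. i \<in> S)" for S
    have f: "f (cl i) = g i" if "i \<in> ?V" for i
    proof -
      have "(SOME j. j \<in> cl i) \<in> cl i" using self[OF that] by (rule someI)
      then show ?thesis using labelling_eq[OF g that] unfolding f_def cl_def by auto
    qed
    have inj: "inj_on f (cl ` ?V)"
    proof (rule inj_onI)
      fix x y assume "x \<in> cl ` ?V" "y \<in> cl ` ?V" and e: "f x = f y"
      then obtain i j where ij: "i \<in> ?V" "j \<in> ?V" "x = cl i" "y = cl j" by blast
      then show "x = y" using e f labelling_eq[OF g ij(1,2)] cl_eq[OF ij(1,2)] by simp
    qed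
    have "f ` cl ` ?V = g ` ?V" unfolding image_image by (rule image_cong) (use f in auto)
    then have "f ` cl ` ?V = db_verts l" using g unfolding labelling_def by (elim conjE, simp only:)
    then have "bij_betw f (cl ` ?V) (db_verts l)" using inj unfolding bij_betw_def by blast
    moreover have "dual_adj M x y \<longleftrightarrow> db_adj l (f x) (f y)" if "x \<in> cl ` ?V" "y \<in> cl ` ?V" for x y
    proof -
      from that obtain i j where ij: "i \<in> ?V" "j \<in> ?V" "x = cl i" "y = cl j" by blast
      then show ?thesis using adj[OF ij(1,2)] labelling_adj[OF g ij(1,2)] f by simp
    qed
    ultimately show "graph_iso (regions k M) (dual_adj M) (db_verts l) (db_adj l)"
      unfolding graph_iso_def R by blast
  qed
qed

section \<open>Adjacency in the DB-tree\<close>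

lemma db_adj_sym: "db_adj l x y \<longleftrightarrow> db_adj l y x"
  unfolding db_adj_def by blast

lemma db_verts_Suc: "db_verts (Suc l) = insert (Inl (Suc l)) (insert (Inr (Suc l)) (db_verts l))"
  unfolding db_verts_def by (auto simp: atLeastAtMostSuc_conv)

lemma db_new: "Inl (Suc l) \<notin> db_verts l" "Inr (Suc l) \<notin> db_verts l"
  unfolding db_verts_def by auto

lemma db_adj_old: "x \<in> db_verts l \<Longrightarrow> y \<in> db_verts l \<Longrightarrow> db_adj (Suc l) x y \<longleftrightarrow> db_adj l x y"
  unfolding db_adj_def db_edge_def db_verts_def by auto

lemma db_adj_leaf: "1 \<le> l \<Longrightarrow> db_adj l x (Inl l) \<longleftrightarrow> x = Inr l"
  unfolding db_adj_def db_edge_def by auto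

lemma db_adj_end: "1 \<le> l \<Longrightarrow> db_adj (Suc l) x (Inr (Suc l)) \<longleftrightarrow> x = Inl (Suc l) \<or> x = Inr l"
  unfolding db_adj_def db_edge_def by auto

lemma db_adj_end1: "db_adj 1 x (Inr 1) \<longleftrightarrow> x = Inl 1 \<or> x = Inl 0"
  unfolding db_adj_def db_edge_def by auto

lemma db_adj_leaf0: "1 \<le> l \<Longrightarrow> db_adj l x (Inl 0) \<longleftrightarrow> x = Inr 1"
  unfolding db_adj_def db_edge_def by auto

section \<open>Neighbouring arcs\<close>

definition consecutive :: "nat set \<Rightarrow> nat \<Rightarrow> nat \<Rightarrow> bool" where
  "consecutive V u v \<longleftrightarrow> u \<in> V \<and> v \<in> V \<and> u \<noteq> v \<and> (\<forall>x\<in>V. \<not> cyc u x v)"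

lemma consecutiveD: "consecutive V u v \<Longrightarrow> u \<in> V \<and> v \<in> V \<and> u \<noteq> v" "consecutive V u v \<Longrightarrow> x \<in> V \<Longrightarrow> \<not> cyc u x v"
  unfolding consecutive_def by blast+

lemma consecutive_pred:
  assumes fin: "finite V" and v: "v \<in> V" "x \<in> V" "x \<noteq> v"
  obtains u where "consecutive V u v"
proof -
  have "finite (V - {v})" "V - {v} \<noteq> {}" "v \<notin> V - {v}" using assms by auto
  from cyc_pred[OF this] obtain u where u: "u \<in> V - {v}" "\<forall>x\<in>V - {v}. \<not> cyc u x v" .
  then have "consecutive V u v" unfolding consecutive_def using v cyc_neq by blast
  then show thesis by (rule that)
qed

text \<open>Taking predecessors is injective on the finite set \<open>V\<close>, hence onto, so v is
  the predecessor of some point.\<close>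

lemma consecutive_succ:
  assumes fin: "finite V" and v: "v \<in> V" "x \<in> V" "x \<noteq> v"
  obtains u where "consecutive V v u"
proof -
  have ex: "\<exists>u. consecutive V u w" if "w \<in> V" for w
    using consecutive_pred[OF fin that, of v] consecutive_pred[OF fin that, of x] v by metis
  define P where "P w = (SOME u. consecutive V u w)" for w
  have P: "consecutive V (P w) w" if "w \<in> V" for w unfolding P_def using someI_ex[OF ex[OF that]] .
  have "inj_on P V"
  proof (rule inj_onI)
    fix w w' assume w: "w \<in> V" "w' \<in> V" "P w = P w'"
    then show "w = w'" using consecutiveD[OF P[OF w(1)]] consecutiveD[OF P[OF w(2)]] by (smt (verit) cyc_ax)
  qed
  moreover have "P ` V \<subseteq> V" using P consecutiveD(1) by blast
  ultimately have "P ` V = V" using endo_inj_surj[OF fin] by blast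
  then have "v \<in> P ` V" using v(1) by simp
  then obtain w where "v = P w" "w \<in> V" by (rule imageE)
  then show thesis using that P by blast
qed

text \<open>The way from arc i to arc j passes the single point j, so a chord is crossed exactly if
  it ends there.\<close>

lemma consecutive_separates:
  assumes c: "consecutive V i j" and e: "x \<in> V" "y \<in> V" "x \<noteq> y"
  shows "separates {x, y} i j \<longleftrightarrow> j = x \<or> j = y"
  unfolding separates_iff[OF e(3)] inarc_def
  using consecutiveD(1)[OF c] consecutiveD(2)[OF c e(1)] consecutiveD(2)[OF c e(2)] e(3) by (smt (verit) cyc_ax)

lemma consecutive_separates_edge:
  assumes M: "pm V M" and e: "e \<in> M" and c: "consecutive V i j"
  shows "separates e i j \<longleftrightarrow> j \<in> e"
proof -
  obtain x y where "x \<in> V" "y \<in> V" "x \<noteq> y" "e = {x, y}" using pm_edge[OF M e] by blast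
  then show ?thesis using consecutive_separates[OF c] by simp
qed

lemma consecutive_card:
  assumes M: "pm V M" and c: "consecutive V i j"
  shows "card (separators M i j) = 1"
proof -
  have j: "j \<in> V" using consecutiveD[OF c] by blast
  obtain y where y: "{j, y} \<in> M" using pm_ex[OF M j] .
  have "separators M i j = {{j, y}}"
  proof
    show "{{j, y}} \<subseteq> separators M i j" using y consecutive_separates_edge[OF M y c] unfolding separators_def by simp
    show "separators M i j \<subseteq> {{j, y}}"
    proof
      fix e assume "e \<in> separators M i j"
      then have e: "e \<in> M" "j \<in> e" using consecutive_separates_edge[OF M _ c] unfolding separators_def by auto
      then obtain z where "e = {j, z}" using pm_edge[OF M e(1)] by auto
      then show "e \<in> {{j, y}}" using pm_uniq[OF M y] e by blast
    qed
  qed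
  then show ?thesis by simp
qed

text \<open>The chord at j is crossed between arcs i and j. Since i and k share a region it is
  crossed back between j and k, so its other end is k.\<close>

lemma consecutive2_edge:
  assumes M: "pm V M" and c: "consecutive V i j" "consecutive V j k" and s: "separators M i k = {}"
  shows "{j, k} \<in> M"
proof -
  have j: "j \<in> V" "j \<noteq> k" using consecutiveD[OF c(2)] by blast+
  obtain y where y: "{j, y} \<in> M" using pm_ex[OF M j(1)] .
  have "\<not> separates {j, y} i k" using s y unfolding separators_def by blast
  moreover have "separates {j, y} i j" "separates {j, y} j k \<longleftrightarrow> k = y"
    using consecutive_separates_edge[OF M y c(1)] consecutive_separates_edge[OF M y c(2)] j by auto
  ultimately have "k = y" unfolding separates_def by blast
  then show ?thesis using y by simp
qed

text \<open>The chord b c cuts off the arc b alone, and d a cuts off the arcs a, b, c; arc d already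
  counts as outside. The hypotheses on i and j admit corners and arcs off the stretch from p1 to
  d.\<close>

lemma separates_quad:
  assumes "cyc p1 a b" "cyc p1 b c" "cyc p1 c d" "i \<in> {a, b, c, d} \<or> \<not> cyc p1 i d \<and> i \<noteq> a"
    "j \<in> {a, b, c, d} \<or> \<not> cyc p1 j d \<and> j \<noteq> a"
  shows "separates {b, c} i j \<longleftrightarrow> (i = b) \<noteq> (j = b)"
    "separates {d, a} i j \<longleftrightarrow> (i \<in> {a, b, c}) \<noteq> (j \<in> {a, b, c})"
proof -
  have ne: "b \<noteq> c" "a \<noteq> d" using assms(1-3) by (smt (verit) cyc_ax)+
  have 1: "inarc b c x \<longleftrightarrow> x = b" if "x \<in> {a, b, c, d} \<or> \<not> cyc p1 x d \<and> x \<noteq> a" for x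
    using that assms(1-3) unfolding inarc_def by (smt (verit) cyc_ax insertE emptyE)
  have 2: "inarc a d x \<longleftrightarrow> x \<in> {a, b, c}" if "x \<in> {a, b, c, d} \<or> \<not> cyc p1 x d \<and> x \<noteq> a" for x
  proof -
    have "cyc a b d" "cyc a c d" "\<not> cyc a d d" "\<not> cyc a a d" "a \<noteq> d" using assms(1-3) by (smt (verit) cyc_ax)+
    moreover have "\<not> cyc a x d" if "\<not> cyc p1 x d" "x \<noteq> a"
      using that assms(1-3) by (smt (verit) cyc_ax)
    ultimately show ?thesis using that assms(1-3) unfolding inarc_def by (smt (verit) cyc_ax insert_iff empty_iff)
  qed
  show "separates {b, c} i j \<longleftrightarrow> (i = b) \<noteq> (j = b)"
    unfolding separates_iff[OF ne(1)] using 1[OF assms(4)] 1[OF assms(5)] by blast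
  have "{d, a} = {a, d}" by (simp add: insert_commute)
  then show "separates {d, a} i j \<longleftrightarrow> (i \<in> {a, b, c}) \<noteq> (j \<in> {a, b, c})"
    using separates_iff[OF ne(2)] 2[OF assms(4)] 2[OF assms(5)] by simp
qed

section \<open>The dual tree of a ladder\<close>

lemma pm_finite: assumes "finite V" "pm V M" shows "finite M"
proof -
  have "M \<subseteq> Pow V" using pm_edge[OF assms(2)] by blast
  then show ?thesis using assms(1) by (simp add: finite_subset)
qed

lemma labelling_base:
  assumes q: "cyc a b c" "cyc a c d"
  shows "labelling {a, b, c, d} {{b, c}, {d, a}} 1 (\<lambda>x. if x = b then Inl 1 else if x = d then Inl 0 else Inr 1)"
    (is "labelling ?V ?M 1 ?g")
proof -
  have ne: "a \<noteq> b" "a \<noteq> c" "a \<noteq> d" "b \<noteq> c" "b \<noteq> d" "c \<noteq> d" using q by (smt (verit) cyc_ax)+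
  have q': "cyc d a b" "cyc d b c" "cyc d a c" "cyc b c d" "cyc b d a" using q by (smt (verit) cyc_ax)+
  have 1: "inarc b c x \<longleftrightarrow> x = b" if "x \<in> ?V" for x
    using that q' q ne unfolding inarc_def by (elim insertE emptyE) (smt (verit) cyc_ax)+
  have 2: "inarc d a x \<longleftrightarrow> x = d" if "x \<in> ?V" for x
    using that q' q ne unfolding inarc_def by (elim insertE emptyE) (smt (verit) cyc_ax)+
  have da: "d \<noteq> a" using ne by blast
  have S: "separators ?M i j = (if (i = b) \<noteq> (j = b) then {{b, c}} else {}) \<union> (if (i = d) \<noteq> (j = d) then {{d, a}} else {})"
    if "i \<in> ?V" "j \<in> ?V" for i j
  proof -
    have "separates {b, c} i j \<longleftrightarrow> (i = b) \<noteq> (j = b)" "separates {d, a} i j \<longleftrightarrow> (i = d) \<noteq> (j = d)"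
      unfolding separates_iff[OF ne(4)] separates_iff[OF da] using 1 2 that by simp_all
    then show ?thesis unfolding separators_def by auto
  qed
  have dab: "{b, c} \<noteq> {d, a}" using ne by (simp add: doubleton_eq_iff)
  have adj: "db_adj 1 (Inr 1) (Inl 1)" "db_adj 1 (Inr 1) (Inl 0)" "db_adj 1 (Inl 1) (Inr 1)" "db_adj 1 (Inl 0) (Inr 1)"
    "\<not> db_adj 1 (Inr 1) (Inr 1)" "\<not> db_adj 1 (Inl 1) (Inl 1)" "\<not> db_adj 1 (Inl 0) (Inl 0)"
    "\<not> db_adj 1 (Inl 1) (Inl 0)" "\<not> db_adj 1 (Inl 0) (Inl 1)"
    unfolding db_adj_def db_edge_def by auto
  have "db_verts 1 = {Inl 0, Inl 1, Inr 1}" unfolding db_verts_def by auto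
  then have "?g ` ?V = db_verts 1" using ne by auto
  moreover have "(separators ?M i j = {} \<longleftrightarrow> ?g i = ?g j) \<and> (card (separators ?M i j) = 1 \<longleftrightarrow> db_adj 1 (?g i) (?g j))"
    if ij: "i \<in> ?V" "j \<in> ?V" for i j
  proof -
    obtain P Q where PQ: "{b, c} = P" "{d, a} = Q" by blast
    have "P \<noteq> Q" using dab PQ by simp
    then show ?thesis unfolding S[OF ij] unfolding PQ using ij
      by (elim insertE emptyE) (simp_all add: ne ne[symmetric] adj del: One_nat_def)
  qed
  ultimately show ?thesis unfolding labelling_def by blast
qed

text \<open>The new quadrilateral lies in the old arc p1, part of D_l. There a and c form the new
  region D_(l+1) and b the new leaf B_(l+1), while d stays in D_l. Apart from a, b, c the old labels
  carry over through \<open>r\<close>, which sends every arc to the old arc containing it.\<close>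

lemma labelling_step:
  assumes g: "ladder_inv V M N p1 p2 p3 p4" and q: "cyc p1 a b" "cyc p1 b c" "cyc p1 c d" "cyc p1 d p2"
    and L: "labelling V M l h" and l: "1 \<le> l" and hp: "h p1 = Inr l"
  shows "\<exists>h'. labelling (V \<union> {a, b, c, d}) (M \<union> {{b, c}, {d, a}}) (Suc l) h' \<and> h' a = Inr (Suc l) \<and> h' c = Inr (Suc l)"
proof -
  let ?W = "V \<union> {a, b, c, d}" and ?M = "M \<union> {{b, c}, {d, a}}"
  have ne: "a \<noteq> b" "a \<noteq> c" "a \<noteq> d" "b \<noteq> c" "b \<noteq> d" "c \<noteq> d" using q by (smt (verit) cyc_ax)+
  have dj: "V \<inter> {a, b, c, d} = {}" using ladder_inv_block[OF g q] unfolding block_def by blast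
  have gap: "\<not> cyc p1 x p2" if "x \<in> V" for x using g that unfolding ladder_inv_def by blast
  have p1: "p1 \<in> V" using ladder_inv_mem[OF g] by blast
  have M: "pm V M" using ladder_inv_basic[OF g] by blast
  have finM: "finite M" using g pm_finite M unfolding ladder_inv_def by blast
  define r where "r i = (if i \<in> {a, b, c, d} then p1 else i)" for i
  have rV: "r i \<in> V" if "i \<in> ?W" for i using that p1 unfolding r_def by auto
  have in_gap: "cyc p1 i p2" if "i \<in> {a, b, c, d}" for i
    using that q by (elim insertE emptyE) (smt (verit) cyc_ax)+
  have r0: "separators M i (r i) = {}" if "i \<in> ?W" for i
  proof (cases "i \<in> {a, b, c, d}")
    case True
    have "\<not> separates e i p1" if e: "e \<in> M" for e
    proof -
      obtain x y where xy: "x \<in> V" "y \<in> V" "x \<noteq> y" "e = {x, y}" using pm_edge[OF M e] by blast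
      have "i \<noteq> x" "i \<noteq> y" "i \<noteq> p1" using xy True dj p1 by blast+
      then have "inarc x y i \<longleftrightarrow> inarc x y p1"
        using in_gap[OF True] gap[OF xy(1)] gap[OF xy(2)] xy(3) unfolding inarc_def by (smt (verit) cyc_ax)
      then show ?thesis unfolding xy(4) separates_iff[OF xy(3)] by simp
    qed
    then show ?thesis using True unfolding separators_def r_def by auto
  next
    case False then show ?thesis unfolding r_def by (simp only: if_False separators_same)
  qed
  have outside: "i \<in> {a, b, c, d} \<or> \<not> cyc p1 i d \<and> i \<noteq> a" if "i \<in> ?W" for i
    using that gap[of i] q dj by (metis UnE cyc_trans disjoint_iff insertI1)
  have S: "separators ?M i j = separators M (r i) (r j) \<union> ((if (i = b) \<noteq> (j = b) then {{b, c}} else {}) \<union>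
      (if (i \<in> {a, b, c}) \<noteq> (j \<in> {a, b, c}) then {{d, a}} else {}))" if "i \<in> ?W" "j \<in> ?W" for i j
  proof -
    have "separators M i j = separators M (r i) (r j)"
      using separators_empty_left[OF r0[OF that(1)], of j] separators_empty_right[OF r0[OF that(2)], of "r i"] by simp
    moreover have "separators {{b, c}, {d, a}} i j = (if (i = b) \<noteq> (j = b) then {{b, c}} else {}) \<union>
      (if (i \<in> {a, b, c}) \<noteq> (j \<in> {a, b, c}) then {{d, a}} else {})"
      using separates_quad[OF q(1-3) outside[OF that(1)] outside[OF that(2)]] unfolding separators_def by auto
    ultimately show ?thesis by (simp only: separators_Un)
  qed
  define h' where "h' i = (if i = a \<or> i = c then Inr (Suc l) else if i = b then Inl (Suc l) else h (r i))" for i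
  have hr: "h (r i) \<in> db_verts l" if "i \<in> ?W" for i using rV[OF that] L unfolding labelling_def by blast
  have new: "{b, c} \<notin> M" "{d, a} \<notin> M" "{b, c} \<noteq> {d, a}"
    using pm_edgeD[OF M] dj ne by (blast, blast, simp add: doubleton_eq_iff)
  have finS: "finite (separators M x y)" for x y using finM unfolding separators_def by simp
  have newS: "{b, c} \<notin> separators M x y" "{d, a} \<notin> separators M x y" for x y using new unfolding separators_def by auto
  have ra: "r a = p1" "r b = p1" "r c = p1" unfolding r_def by simp_all
  \<comment> \<open>The two conditions of a labelling for one pair of arcs. They are checked by
    classes: a and c, then b, then all others, d among them.\<close>
  define C where "C i j \<longleftrightarrow> (separators ?M i j = {} \<longleftrightarrow> h' i = h' j) \<and> (card (separators ?M i j) = 1 \<longleftrightarrow> db_adj (Suc l) (h' i) (h' j))" for i j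
  have C_sym: "C i j \<Longrightarrow> C j i" for i j unfolding C_def by (metis separators_sym db_adj_sym)
  have W: "a \<in> ?W" "b \<in> ?W" "c \<in> ?W" by simp_all
  have adj_simps: "\<not> db_adj (Suc l) (Inr (Suc l)) (Inr (Suc l))" "db_adj (Suc l) (Inr (Suc l)) (Inl (Suc l))"
    "\<not> db_adj (Suc l) (Inl (Suc l)) (Inl (Suc l))"
    using db_adj_leaf[of "Suc l"] db_adj_end[OF l] by auto
  have C1: "C x y" if x: "x \<in> {a, c}" and y: "y \<in> {a, c}" for x y
  proof -
    have xy: "x \<in> ?W" "y \<in> ?W" "r x = p1" "r y = p1" "x \<noteq> b" "y \<noteq> b" "x \<in> {a, b, c}" "y \<in> {a, b, c}"
      using x y ra ne by auto
    have "separators ?M x y = {}" unfolding S[OF xy(1,2)] using xy by simp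
    moreover have "h' x = Inr (Suc l)" "h' y = Inr (Suc l)" using x y unfolding h'_def by auto
    ultimately show ?thesis unfolding C_def using adj_simps by simp
  qed
  have C2: "C x b" if x: "x \<in> {a, c}" for x
  proof -
    have xy: "x \<in> ?W" "r x = p1" "x \<noteq> b" "x \<in> {a, b, c}" using x ra ne by auto
    have "separators ?M x b = {{b, c}}" unfolding S[OF xy(1) W(2)] using xy ra by simp
    moreover have "h' x = Inr (Suc l)" "h' b = Inl (Suc l)" using x ne unfolding h'_def by auto
    ultimately show ?thesis unfolding C_def using adj_simps by simp
  qed
  have C3: "C b b" unfolding C_def using adj_simps ne by (simp add: h'_def)
  have out: "h' y = h (r y)" "y \<noteq> b" if "y \<in> ?W" "y \<notin> {a, b, c}" for y using that unfolding h'_def by auto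
  have C4: "C x y" if x: "x \<in> {a, c}" and y: "y \<in> ?W" "y \<notin> {a, b, c}" for x y
  proof -
    have xy: "x \<in> ?W" "r x = p1" "x \<noteq> b" "x \<in> {a, b, c}" using x ra ne by auto
    have S': "separators ?M x y = insert {d, a} (separators M p1 (r y))" unfolding S[OF xy(1) y(1)] using xy y by auto
    have hx: "h' x = Inr (Suc l)" using x unfolding h'_def by auto
    have "card (separators ?M x y) = 1 \<longleftrightarrow> separators M p1 (r y) = {}" unfolding S' using finS newS by simp
    also have "\<dots> \<longleftrightarrow> h (r y) = Inr l" using labelling_eq[OF L p1 rV[OF y(1)]] hp by auto
    also have "\<dots> \<longleftrightarrow> db_adj (Suc l) (h' x) (h' y)"
      using db_adj_end[OF l, of "h (r y)"] db_adj_sym hr[OF y(1)] db_new unfolding hx out(1)[OF y] by metis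
    finally have "card (separators ?M x y) = 1 \<longleftrightarrow> db_adj (Suc l) (h' x) (h' y)" .
    moreover have "separators ?M x y \<noteq> {}" unfolding S' by simp
    moreover have "h' x \<noteq> h' y" unfolding hx out(1)[OF y] using hr[OF y(1)] db_new by metis
    ultimately show ?thesis unfolding C_def by blast
  qed
  have C5: "C b y" if y: "y \<in> ?W" "y \<notin> {a, b, c}" for y
  proof -
    have S': "separators ?M b y = insert {b, c} (insert {d, a} (separators M p1 (r y)))"
      unfolding S[OF W(2) y(1)] using ra y by auto
    have hx: "h' b = Inl (Suc l)" using ne unfolding h'_def by simp
    have "card (separators ?M b y) \<noteq> 1" unfolding S' using finS newS new by simp
    moreover have "\<not> db_adj (Suc l) (h' b) (h' y)"
      using db_adj_leaf[of "Suc l" "h (r y)"] db_adj_sym hr[OF y(1)] db_new unfolding hx out(1)[OF y] by force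
    moreover have "separators ?M b y \<noteq> {}" unfolding S' by simp
    moreover have "h' b \<noteq> h' y" unfolding hx out(1)[OF y] using hr[OF y(1)] db_new by metis
    ultimately show ?thesis unfolding C_def by blast
  qed
  have C6: "C x y" if x: "x \<in> ?W" "x \<notin> {a, b, c}" and y: "y \<in> ?W" "y \<notin> {a, b, c}" for x y
  proof -
    have "separators ?M x y = separators M (r x) (r y)" unfolding S[OF x(1) y(1)] using x y by auto
    then show ?thesis unfolding C_def out(1)[OF x] out(1)[OF y]
      using labelling_eq[OF L rV[OF x(1)] rV[OF y(1)]] labelling_adj[OF L rV[OF x(1)] rV[OF y(1)]]
        db_adj_old[OF hr[OF x(1)] hr[OF y(1)]] by simp
  qed
  have C: "C x y" if xy: "x \<in> ?W" "y \<in> ?W" for x y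
  proof -
    have cls: "z \<in> {a, c} \<or> z = b \<or> z \<notin> {a, b, c}" for z by blast
    from cls[of x] show ?thesis
    proof (elim disjE)
      assume x: "x \<in> {a, c}"
      from cls[of y] show ?thesis by (elim disjE) (rule C1[OF x], assumption, simp only: C2[OF x], rule C4[OF x xy(2)])
    next
      assume x: "x = b"
      from cls[of y] show ?thesis unfolding x
        by (elim disjE) (rule C_sym[OF C2], assumption, simp only: C3, rule C5[OF xy(2)])
    next
      assume x: "x \<notin> {a, b, c}"
      from cls[of y] show ?thesis
        by (elim disjE) (rule C_sym[OF C4[OF _ xy(1) x]], assumption, simp only: C_sym[OF C5[OF xy(1) x]], rule C6[OF xy(1) x xy(2)])
    qed
  qed
  have "h' ` ?W = db_verts (Suc l)"
  proof
    show "h' ` ?W \<subseteq> db_verts (Suc l)" unfolding db_verts_Suc h'_def using hr by auto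
    have "h' v = h v" if "v \<in> V" for v using that dj unfolding h'_def r_def by auto
    then have "h' ` V = h ` V" by (intro image_cong) simp_all
    then have "db_verts l = h' ` V" using L unfolding labelling_def by (elim conjE, simp only:)
    then have "db_verts l \<subseteq> h' ` ?W" by (simp only: image_mono Un_upper1)
    moreover have "Inl (Suc l) = h' b" "Inr (Suc l) = h' a" using ne unfolding h'_def by auto
    ultimately show "db_verts (Suc l) \<subseteq> h' ` ?W" unfolding db_verts_Suc by auto
  qed
  then have "labelling ?W ?M (Suc l) h'"
    unfolding labelling_def by (intro conjI[OF _ ballI[OF ballI]] C[unfolded C_def])
  then show ?thesis unfolding h'_def by auto
qed

text \<open>Both p1 and p3 are tracked because the chain may go on at either \<open>N\<close>-side;
  they lie in the same region. The number of points fixes l.\<close>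

lemma ladder_labelling:
  "ladder V M N f p1 p2 p3 p4 \<Longrightarrow>
    \<exists>l h. 1 \<le> l \<and> card V = 4 * l \<and> labelling V M l h \<and> h p1 = Inr l \<and> h p3 = Inr l"
proof (induction rule: ladder.induct)
  case (base a b c d)
  have "a \<noteq> b" "a \<noteq> c" "a \<noteq> d" "b \<noteq> c" "b \<noteq> d" "c \<noteq> d" using base by (smt (verit) cyc_ax)+
  moreover from this obtain h where "labelling {a, b, c, d} {{b, c}, {d, a}} 1 h" "h a = Inr 1" "h c = Inr 1"
    using labelling_base[OF base] by fastforce
  ultimately show ?case by (intro exI[of _ 1] exI[of _ h]) simp
next
  case (step V M N f p1 p2 p3 p4 a b c d)
  note g = ladder_imp_inv[OF step.hyps(1)] and q = step.hyps(3-6)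
  from step.IH obtain l h where l: "1 \<le> l" "card V = 4 * l" "labelling V M l h" "h p1 = Inr l" by blast
  from labelling_step[OF g q l(3,1,4)] obtain h' where h': "labelling (V \<union> {a, b, c, d}) (M \<union> {{b, c}, {d, a}}) (Suc l) h'"
    "h' a = Inr (Suc l)" "h' c = Inr (Suc l)" by blast
  have "a \<noteq> b" "a \<noteq> c" "a \<noteq> d" "b \<noteq> c" "b \<noteq> d" "c \<noteq> d" using q by (smt (verit) cyc_ax)+
  then have "card {a, b, c, d} = 4" by simp
  moreover have "finite V" using g unfolding ladder_inv_def by blast
  ultimately have "card (V \<union> {a, b, c, d}) = 4 * Suc l"
    using card_Un_disjoint[OF _ _ step.hyps(2)] l(2) by simp
  then show ?case using h' by (intro exI[of _ "Suc l"] exI[of _ h']) simp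
qed auto

section \<open>Peeling off the end of the tree\<close>

text \<open>Besides its leaf, D_l has one further neighbour, which for l = 1 is B_0 instead of
  another D. Giving it a name allows both cases to be treated together.\<close>

lemma db_pred:
  assumes "1 \<le> l"
  obtains v where "v \<noteq> Inl l" "v \<noteq> Inr l"
    "\<And>x. db_adj l x (Inr l) \<longleftrightarrow> x = Inl l \<or> x = v" "l = 1 \<Longrightarrow> v = Inl 0" "l \<noteq> 1 \<Longrightarrow> v = Inr (l - 1)"
proof (cases "l = 1")
  case True
  show ?thesis by (rule that[of "Inl 0"]) (use True db_adj_end1 in \<open>auto simp: db_verts_def\<close>)
next
  case False
  then have "1 \<le> l - 1" "l = Suc (l - 1)" using assms by auto
  note e = db_adj_end[OF this(1), folded this(2)]
  show ?thesis
    by (rule that[of "Inr (l - 1)"]) (use False assms e in \<open>auto simp: db_verts_def\<close>)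
qed

text \<open>Arc \<open>b\<close> is the region \<open>B\<^sub>l\<close>, arcs \<open>a\<close> and \<open>c\<close> form \<open>D\<^sub>l\<close>, and \<open>u\<close>, \<open>d\<close> lie in the third neighbouring region.\<close>

lemma labelling_end:
  assumes fin: "finite V" and M: "pm V M" and L: "labelling V M l g" and l: "1 \<le> l"
  obtains u a b c d where "consecutive V u a" "consecutive V a b" "consecutive V b c" "consecutive V c d" "{b, c} \<in> M" "{d, a} \<in> M"
    "g a = Inr l" "g b = Inl l" "g c = Inr l" "a \<noteq> c" "a \<noteq> d" "b \<noteq> d"
    "g d = g u" "l = 1 \<Longrightarrow> g d = Inl 0" "l \<noteq> 1 \<Longrightarrow> g d = Inr (l - 1)"
proof -
  have gV: "g ` V = db_verts l" using L unfolding labelling_def by blast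
  have adj: "db_adj l (g i) (g j)" if "consecutive V i j" for i j
    using consecutive_card[OF M that] labelling_adj[OF L, of i j] consecutiveD(1)[OF that] by blast
  have "Inl l \<in> g ` V" "Inl 0 \<in> g ` V" unfolding gV db_verts_def by auto
  then obtain b z where b: "b \<in> V" "g b = Inl l" and z: "z \<in> V" "g z = Inl 0" by (metis imageE)
  have zb: "z \<noteq> b" using b z l by auto
  obtain a where ab: "consecutive V a b" by (rule consecutive_pred[OF fin b(1) z(1) zb])
  obtain c where bc: "consecutive V b c" by (rule consecutive_succ[OF fin b(1) z(1) zb])
  have a: "a \<in> V" "a \<noteq> b" and c: "c \<in> V" "c \<noteq> b" using consecutiveD[OF ab] consecutiveD[OF bc] by blast+
  obtain u where ua: "consecutive V u a" by (rule consecutive_pred[OF fin a(1) b(1)]) (use a in auto)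
  obtain d where cd: "consecutive V c d" by (rule consecutive_succ[OF fin c(1) b(1)]) (use c in auto)
  have u: "u \<in> V" and d: "d \<in> V" "c \<noteq> d" using consecutiveD[OF ua] consecutiveD[OF cd] by blast+
  \<comment> \<open>The only neighbour of the leaf B_l is D_l, so the arcs before and after b both
    lie in D_l.\<close>
  have ga: "g a = Inr l" using adj[OF ab] db_adj_leaf[OF l] b(2) by simp
  have gc: "g c = Inr l" using adj[OF bc] db_adj_leaf[OF l] db_adj_sym b(2) by metis
  have zac: "z \<noteq> a" "z \<noteq> c" using z ga gc by auto
  have ac: "a \<noteq> c" using consecutiveD(2)[OF ab z(1)] consecutiveD(2)[OF bc z(1)] zac zb a(2) by (smt (verit) cyc_ax)
  have eq: "g i = g j \<Longrightarrow> i \<in> V \<Longrightarrow> j \<in> V \<Longrightarrow> separators M i j = {}" for i j using labelling_eq[OF L] by blast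
  have ebc: "{b, c} \<in> M" by (rule consecutive2_edge[OF M ab bc eq]) (use ga gc a c in auto)
  obtain v where v: "v \<noteq> Inl l" "v \<noteq> Inr l" "\<forall>x. db_adj l x (Inr l) \<longleftrightarrow> x = Inl l \<or> x = v"
    "l = 1 \<Longrightarrow> v = Inl 0" "l \<noteq> 1 \<Longrightarrow> v = Inr (l - 1)" by (rule db_pred[OF l]) blast
  have "g u \<noteq> Inl l"
  proof
    assume "g u = Inl l"
    then have "{a, b} \<in> M" using consecutive2_edge[OF M ua ab eq] b u by simp
    then have "{b, a} \<in> M" by (simp add: insert_commute)
    then show False using pm_uniq[OF M ebc] ac by blast
  qed
  then have gu: "g u = v" using adj[OF ua] ga v(3) by simp
  have "g d \<noteq> Inl l"
  proof
    assume g: "g d = Inl l"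
    then have "{c, d} \<in> M" using consecutive2_edge[OF M bc cd eq] b d by simp
    moreover have "{c, b} \<in> M" using ebc by (simp add: insert_commute)
    ultimately have "d = b" using pm_uniq[OF M] by blast
    then show False using consecutiveD(2)[OF bc z(1)] consecutiveD(2)[OF cd z(1)] zac zb c(2) by (smt (verit) cyc_ax)
  qed
  then have gd: "g d = v" using adj[OF cd] gc v(3) db_adj_sym by metis
  have ad: "a \<noteq> d" "b \<noteq> d" using ga gd v b by auto
  have sud: "separators M u d = {}" using eq gu gd u d by simp
  \<comment> \<open>The chord at a is crossed between u and a and has to be crossed back by d, which
    shares the region of u. As b and c are matched with each other, it ends at d.\<close>
  obtain y where y: "{a, y} \<in> M" "y \<noteq> a" using pm_ex[OF M a(1)] by blast
  have "y \<noteq> b" "y \<noteq> c" using pm_uniq[OF M ebc, of a] pm_uniq[OF M, of c b a] y ebc ac a(2)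
    by (metis insert_commute)+
  then have s: "separates {a, y} u a" "\<not> separates {a, y} a b" "\<not> separates {a, y} b c" "separates {a, y} c d \<longleftrightarrow> d = y"
    using consecutive_separates_edge[OF M y(1) ua] consecutive_separates_edge[OF M y(1) ab] consecutive_separates_edge[OF M y(1) bc]
      consecutive_separates_edge[OF M y(1) cd] a c ac ad by auto
  have "\<not> separates {a, y} u d" using sud y(1) unfolding separators_def by blast
  then have "d = y" using s unfolding separates_def by blast
  then have "{d, a} \<in> M" using y(1) by (simp add: insert_commute)
  then show thesis
    using that[OF ua ab bc cd ebc _ ga b(2) gc ac ad] gd gu v(4,5) by simp
qed

lemma consecutive_cover:
  assumes "consecutive V a b" "consecutive V b c" "consecutive V c d" "consecutive V d a" "a \<noteq> c" "b \<noteq> d"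
  shows "V = {a, b, c, d}"
proof
  show "V \<subseteq> {a, b, c, d}"
  proof
    fix x assume x: "x \<in> V"
    have m: "a \<in> V" "b \<in> V" "c \<in> V" "d \<in> V" "a \<noteq> b" "b \<noteq> c" "c \<noteq> d" "d \<noteq> a"
      using consecutiveD(1) assms by blast+
    have "x = a \<or> x = b \<or> x = c \<or> x = d"
      using consecutiveD(2)[OF assms(1) x] consecutiveD(2)[OF assms(2) x] consecutiveD(2)[OF assms(3) x] consecutiveD(2)[OF assms(4) x]
        consecutiveD(2)[OF assms(1) m(3)] consecutiveD(2)[OF assms(3) m(1)] m(5-8) assms(5,6) by (smt (verit) cyc_ax)
    then show "x \<in> {a, b, c, d}" by blast
  qed
qed (use consecutiveD(1) assms in blast)

text \<open>Without the quadrilateral at the end of the tree, \<open>M\<close> has the shorter tree.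
  The clause on labels locates the place of reattachment: the point u before the removed block lies
  in the end region of the shorter tree, so it is p1 or p3 of the shorter ladder. \<open>N\<close>
  arises on the way, from the sides that are not in \<open>M\<close>.\<close>

lemma labelling_ladder:
  "finite V \<Longrightarrow> pm V M \<Longrightarrow> labelling V M (Suc l) g \<Longrightarrow>
    \<exists>N f p1 p2 p3 p4. ladder V M N f p1 p2 p3 p4 \<and> (\<forall>x\<in>V. g x = Inr (Suc l) \<longrightarrow> x = p1 \<or> x = p3)"
proof (induction l arbitrary: V M)
  case (0 V M)
  note fin = 0(1) and M = 0(2) and L = 0(3)
  obtain u a b c d where c: "consecutive V u a" "consecutive V a b" "consecutive V b c" "consecutive V c d" and e: "{b, c} \<in> M" "{d, a} \<in> M"
    and g: "g a = Inr 1" "g b = Inl 1" "g c = Inr 1" "g d = Inl 0" and ne: "a \<noteq> c" "a \<noteq> d" "b \<noteq> d"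
    by (rule labelling_end[OF fin M L]) auto
  have m: "a \<in> V" "b \<in> V" "c \<in> V" "d \<in> V" "a \<noteq> b" "b \<noteq> c" "c \<noteq> d"
    using consecutiveD(1) c by blast+
  \<comment> \<open>Arc d is the leaf B_0, so the arc w after it lies in D_1 like c. Hence the chord
    at d ends at w, and w is a.\<close>
  obtain w where w: "consecutive V d w" by (rule consecutive_succ[OF fin m(4) m(1) ne(2)])
  have wV: "w \<in> V" using consecutiveD[OF w] by blast
  have "db_adj 1 (g d) (g w)" using consecutive_card[OF M w] labelling_adj[OF L m(4) wV] by simp
  then have "g w = Inr 1" using db_adj_leaf0[of 1] db_adj_sym g(4) by (metis order_refl)
  then have "separators M c w = {}" using labelling_eq[OF L m(3) wV] g by simp
  from consecutive2_edge[OF M c(4) w this] have "w = a" using pm_uniq[OF M e(2)] by blast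
  then have V: "V = {a, b, c, d}" using consecutive_cover[OF c(2-4) _ ne(1,3)] w by blast
  have cy: "cyc a b c" "cyc a c d"
    using consecutiveD(2)[OF c(2) m(3)] consecutiveD(2)[OF c(4) m(1)] m ne by (smt (verit) cyc_ax)+
  have "M = {{b, c}, {d, a}}"
    by (rule pm_sub_eq[OF M]) (use ladder_inv_basic(1)[OF quad_ladder_inv[OF cy]] V e in auto)
  then have "ladder V M {{a, b}, {c, d}} (a, b, c, d) a b c d" using ladder.base[OF cy] V by simp
  moreover have "\<forall>x\<in>V. g x = Inr (Suc 0) \<longrightarrow> x = a \<or> x = c" using V g by auto
  ultimately show ?case by blast
next
  case (Suc l V M)
  let ?l = "Suc l"
  note fin = Suc.prems(1) and M = Suc.prems(2) and L = Suc.prems(3)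
  obtain u a b c d where c: "consecutive V u a" "consecutive V a b" "consecutive V b c" "consecutive V c d" and e: "{b, c} \<in> M" "{d, a} \<in> M"
    and g: "g a = Inr (Suc ?l)" "g b = Inl (Suc ?l)" "g c = Inr (Suc ?l)" "g d = Inr ?l" "g u = Inr ?l"
    and ne: "a \<noteq> c" "a \<noteq> d" "b \<noteq> d"
    by (rule labelling_end[OF fin M L]) auto
  have m: "a \<in> V" "b \<in> V" "c \<in> V" "d \<in> V" "u \<in> V" "a \<noteq> b" "b \<noteq> c" "c \<noteq> d"
    using consecutiveD(1) c by blast+
  have gV: "g ` V = db_verts (Suc ?l)" using L unfolding labelling_def by blast
  let ?Q = "{a, b, c, d}" and ?Y = "{{b, c}, {d, a}}"
  define V0 where "V0 = V - ?Q"
  have V: "V = V0 \<union> ?Q" "V0 \<inter> ?Q = {}" using m unfolding V0_def by blast+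
  have cy: "cyc a b c" "cyc a c d"
    using consecutiveD(2)[OF c(2) m(3)] consecutiveD(2)[OF c(4) m(1)] m ne by (smt (verit) cyc_ax)+
  \<comment> \<open>Otherwise only four arcs would exist, none of them labelled B_0.\<close>
  have "u \<noteq> d"
  proof
    assume "u = d"
    then have VQ: "V = ?Q" using consecutive_cover[OF c(2-4) _ ne(1,3)] c(1) by blast
    have "Inl 0 \<in> g ` V" unfolding gV db_verts_def by simp
    then show False unfolding VQ using g by auto
  qed
  then have u: "u \<in> V0" using m(5) g unfolding V0_def by auto
  have Y: "pm ?Q ?Y" by (rule ladder_inv_basic(1)[OF quad_ladder_inv[OF cy]])
  have YM: "?Y \<subseteq> M" using e by simp
  define M0 where "M0 = {e \<in> M. e \<subseteq> V0}"
  have M0: "pm V0 M0" "M = M0 \<union> ?Y"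
    using pm_split[OF M[unfolded V(1)] Y YM V(2)] unfolding M0_def by simp_all
  have ins: "cyc u a b" "cyc u b c" "cyc u c d"
    using consecutiveD(2)[OF c(1)] consecutiveD(2)[OF c(2)] consecutiveD(2)[OF c(3)] consecutiveD(2)[OF c(4)] m ne cy u V(2)
    by (smt (verit) cyc_ax disjoint_iff insertI1 insert_commute)+
  have out: "cyc u d x" if x: "x \<in> V0" "x \<noteq> u" for x
  proof -
    have xV: "x \<in> V" "x \<noteq> a" "x \<noteq> b" "x \<noteq> c" "x \<noteq> d" using x unfolding V0_def by auto
    show ?thesis
      using consecutiveD(2)[OF c(1) xV(1)] consecutiveD(2)[OF c(2) xV(1)] consecutiveD(2)[OF c(3) xV(1)] consecutiveD(2)[OF c(4) xV(1)]
        xV x ins by (smt (verit) cyc_ax)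
  qed
  have outside: "x \<in> ?Q \<or> \<not> cyc u x d \<and> x \<noteq> a" if "x \<in> V" for x
  proof (cases "x \<in> ?Q")
    case False
    then have "x \<in> V0" using that unfolding V0_def by blast
    then have "\<not> cyc u x d" using out[of x] cyc_asym cyc_neq by metis
    then show ?thesis using False by blast
  qed blast
  note sq = separates_quad[OF ins outside outside]
  \<comment> \<open>The chords of the removed quadrilateral separate no remaining arcs, so distances
    between these are unchanged.\<close>
  have sepY: "separators ?Y i j = {}" if "i \<in> V0" "j \<in> V0" for i j
  proof -
    have "i \<in> V" "j \<in> V" "i \<notin> ?Q" "j \<notin> ?Q" using that V by blast+
    then show ?thesis using sq[of i j] unfolding separators_def by auto
  qed
  have S: "separators M0 i j = separators M i j" if "i \<in> V0" "j \<in> V0" for i j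
    unfolding M0(2) separators_Un using sepY[OF that] by simp
  have V0V: "V0 \<subseteq> V" unfolding V0_def by blast
  have old: "g x \<in> db_verts ?l" if x: "x \<in> V0" for x
  proof -
    have xV: "x \<in> V" "x \<notin> ?Q" using x V by blast+
    have "{b, c} \<in> separators M b x" "{d, a} \<in> separators M a x"
      using sq[OF m(2) xV(1)] sq[OF m(1) xV(1)] xV e m unfolding separators_def by auto
    then have "g b \<noteq> g x" "g a \<noteq> g x" using labelling_eq[OF L m(2) xV(1)] labelling_eq[OF L m(1) xV(1)] by auto
    moreover have "g x \<in> db_verts (Suc ?l)" using gV xV by blast
    ultimately show ?thesis using g db_verts_Suc[of ?l] by auto
  qed
  have "labelling V0 M0 ?l g" unfolding labelling_def
  proof (intro conjI ballI)
    show "g ` V0 = db_verts ?l"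
    proof
      show "db_verts ?l \<subseteq> g ` V0"
      proof
        fix y assume y: "y \<in> db_verts ?l"
        then have "y \<in> g ` V" unfolding gV db_verts_Suc[of ?l] by simp
        then obtain x where x: "x \<in> V" "y = g x" by blast
        have "x \<noteq> a" "x \<noteq> b" "x \<noteq> c" using x y g db_new[of ?l] by auto
        \<comment> \<open>Among the removed arcs only d has a label of the shorter tree, and u
          carries the same one.\<close>
        then have "x \<in> V0 \<or> x = d" using x unfolding V0_def by blast
        then show "y \<in> g ` V0" using x(2) imageI[OF u, of g] g by auto
      qed
    qed (use old in blast)
  next
    fix i j assume ij: "i \<in> V0" "j \<in> V0"
    then have ijV: "i \<in> V" "j \<in> V" using V0V by blast+
    show "separators M0 i j = {} \<longleftrightarrow> g i = g j" using labelling_eq[OF L ijV] S[OF ij] by simp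
    show "card (separators M0 i j) = 1 \<longleftrightarrow> db_adj ?l (g i) (g j)"
      using labelling_adj[OF L ijV] S[OF ij] db_adj_old[OF old[OF ij(1)] old[OF ij(2)]] by simp
  qed
  from Suc.IH[OF finite_subset[OF V0V fin] M0(1) this]
  obtain N f p1 p2 p3 p4 where Ld: "ladder V0 M0 N f p1 p2 p3 p4"
    and lp: "\<forall>x\<in>V0. g x = Inr ?l \<longrightarrow> x = p1 \<or> x = p3" by blast
  have labels: "\<forall>x\<in>V. g x = Inr (Suc ?l) \<longrightarrow> x = a \<or> x = c"
  proof (intro ballI impI)
    fix x assume x: "x \<in> V" "g x = Inr (Suc ?l)"
    then have "x \<notin> V0" using old[of x] db_new(2)[of ?l] by auto
    then have "x \<in> ?Q" using x(1) unfolding V0_def by blast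
    then show "x = a \<or> x = c" using x(2) g by auto
  qed
  have fin_step: ?case if L': "ladder V0 M0 N f u q2 q3 q4" for q2 q3 q4
  proof -
    have "q2 \<in> V0" "q2 \<noteq> u" using ladder_inv_mem[OF ladder_imp_inv[OF L']] ladder_imp_inv[OF L'] cyc_neq
      unfolding ladder_inv_def by blast+
    from ladder.step[OF L' V(2) ins out[OF this]]
    have "ladder V M (N \<union> {{a, b}, {c, d}}) f a b c d" using V(1) M0(2) by simp
    then show ?thesis using labels by blast
  qed
  from lp u g have "u = p1 \<or> u = p3" by blast
  then show ?case using fin_step Ld ladder.swap_end[OF Ld] by blast
qed

section \<open>The components of two matchings\<close>

lemma DCM_adj_iff:
  "DCM_adj k A B \<longleftrightarrow> pm {0..<2 * k} A \<and> pm {0..<2 * k} B \<and> A \<inter> B = {} \<and> compat A B"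
  unfolding DCM_adj_def disjoint_compatible_def is_matching_pm compat_def by blast

lemma DCM_adj_sym: "DCM_adj k A B \<longleftrightarrow> DCM_adj k B A"
  unfolding DCM_adj_iff using compat_sym by blast

text \<open>For k = 0 the empty matching would be adjacent to itself.\<close>

lemma DCM_adj_neq: assumes "1 \<le> k" "DCM_adj k A B" shows "A \<noteq> B"
proof
  assume "A = B"
  moreover obtain q where "{0, q} \<in> A" by (rule pm_ex[of "{0..<2 * k}" A 0]) (use assms in \<open>auto simp: DCM_adj_iff\<close>)
  ultimately show False using assms(2) unfolding DCM_adj_iff by blast
qed

lemma component_mutual:
  assumes k: "1 \<le> k" and c: "card (DCM_component k M) = 2"
  obtains N where "mutual {0..<2 * k} M N"
proof -
  have MC: "M \<in> DCM_component k M" unfolding DCM_component_def by simp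
  obtain N where N: "DCM_component k M = {M, N}" "N \<noteq> M"
    using c MC unfolding card_2_iff by (metis insertE insert_commute singletonD)
  have step: "Y \<in> {M, N}" if "X \<in> {M, N}" "DCM_adj k X Y" for X Y
    using that unfolding N(1)[symmetric] DCM_component_def by auto
  have "(DCM_adj k)\<^sup>*\<^sup>* M N" using N(1) unfolding DCM_component_def by blast
  \<comment> \<open>The walk to \<open>N\<close> has a first edge, and from \<open>M\<close> it can
    only lead to \<open>N\<close>.\<close>
  then obtain Y where "DCM_adj k M Y" using N(2) by (metis converse_rtranclpE)
  then have MN: "DCM_adj k M N" using step[of M Y] DCM_adj_neq[OF k] by blast
  have "X = N" if "DCM_adj k M X" for X using step[OF _ that] DCM_adj_neq[OF k that] by blast
  moreover have "X = M" if "DCM_adj k N X" for X using step[OF _ that] DCM_adj_neq[OF k that] by blast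
  ultimately have "only_nbr {0..<2 * k} M N" "only_nbr {0..<2 * k} N M"
    unfolding only_nbr_def using MN compat_sym unfolding DCM_adj_iff by (metis Int_commute)+
  then have "mutual {0..<2 * k} M N" using MN unfolding mutual_def DCM_adj_iff by blast
  then show thesis by (rule that)
qed

lemma mutual_component:
  assumes k: "1 \<le> k" and m: "mutual {0..<2 * k} M N"
  shows "card (DCM_component k M) = 2"
proof -
  have MN: "DCM_adj k M N" "DCM_adj k N M"
    using m DCM_adj_sym unfolding mutual_def DCM_adj_iff by blast+
  have only: "only_nbr {0..<2 * k} M N" "only_nbr {0..<2 * k} N M" using m unfolding mutual_def by blast+
  have M1: "X = N" if "DCM_adj k M X" for X
    using only_nbrD[OF only(1)] that compat_sym unfolding DCM_adj_iff by blast
  have N1: "X = M" if "DCM_adj k N X" for X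
    using only_nbrD[OF only(2)] that compat_sym unfolding DCM_adj_iff by blast
  have "X = M \<or> X = N" if "(DCM_adj k)\<^sup>*\<^sup>* M X" for X
    using that by (induction rule: rtranclp_induct) (use M1 N1 in auto)
  then have "DCM_component k M = {M, N}" unfolding DCM_component_def using MN(1) by auto
  moreover have "M \<noteq> N" by (rule DCM_adj_neq[OF k MN(1)])
  ultimately show ?thesis by simp
qed

theorem mainTheorem15:
  fixes k :: nat and M :: "nat set set"
  assumes "k \<ge> 1" and "even k" and "is_matching k M"
  shows "card (DCM_component k M) = 2 \<longleftrightarrow> is_DB_matching k M"
proof -
  let ?V = "{0..<2 * k}"
  have DB: "is_DB_matching k M \<longleftrightarrow> (\<exists>g. labelling ?V M (k div 2) g)"
    unfolding is_DB_matching_def graph_iso_labelling using assms(2,3) by blast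
  have M: "pm ?V M" using assms(3) is_matching_pm by blast
  have V: "finite ?V" "?V \<noteq> {}" "4 dvd card ?V" using assms(1,2) by (auto elim!: evenE)
  show ?thesis unfolding DB
  proof
    assume "card (DCM_component k M) = 2"
    then obtain N where "mutual ?V M N" by (rule component_mutual[OF assms(1)])
    then obtain f p1 p2 p3 p4 where "ladder ?V M N f p1 p2 p3 p4" using mutual_ladder[OF V] by blast
    from ladder_labelling[OF this] obtain l g where lg: "card ?V = 4 * l" "labelling ?V M l g" by blast
    have "l = k div 2" using lg(1) by simp
    then show "\<exists>g. labelling ?V M (k div 2) g" using lg(2) by blast
  next
    assume "\<exists>g. labelling ?V M (k div 2) g"
    then obtain g where g: "labelling ?V M (k div 2) g" by blast
    \<comment> \<open>As k is even and at least 1, its half is positive, which fits the successor in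
      \<open>labelling_ladder\<close>.\<close>
    obtain l where l: "k div 2 = Suc l" using assms(1,2) by (cases "k div 2") auto
    obtain N f p1 p2 p3 p4 where L: "ladder ?V M N f p1 p2 p3 p4"
      using labelling_ladder[OF V(1) M g[unfolded l]] by blast
    have "mutual ?V M N"
      using ladder_inv_basic[OF ladder_imp_inv[OF L]] ladder_unique[OF L] unfolding mutual_def by blast
    then show "card (DCM_component k M) = 2" by (rule mutual_component[OF assms(1)])
  qed
qed

end
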